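(* Let $k$ be $\mathbb R$ or $\mathbb C$ and $\Gamma$ a finitely generated group. The natural tensor structure on $A\mapsto\mathrm{Hom}_{\mathrm{Gp}}(\Gamma,A^\times)$ gives $k[\Gamma]^{\mathrm{an}}$ the structure of a multiplicatively convex Fréchet bialgebra, with comultiplication $\mu:k[\Gamma]^{\mathrm{an}}\to k[\Gamma]^{\mathrm{an}}\otimes^\pi k[\Gamma]^{\mathrm{an}}$ and counit $\varepsilon:k[\Gamma]^{\mathrm{an}}\to k$. The group $$G(k[\Gamma]^{\mathrm{an}})=\{a\in k[\Gamma]^{\mathrm{an}}\,:\,\mu(a)=a\otimes a\in k[\Gamma]^{\mathrm{an}}\otimes^\pi k[\Gamma]^{\mathrm{an}},\ \varepsilon(a)=1\in k\}$$ of grouplike elements of $k[\Gamma]^{\mathrm{an}}$ is then $\Gamma$.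
   Context: $k[\Gamma]^{\mathrm{an}}$ is the multiplicatively convex Fréchet $k$-algebra representing the functor $A\mapsto\mathrm{Hom}_{\mathrm{Gp}}(\Gamma,A^\times)$ on unital multiplicatively convex Fréchet $k$-algebras (countable inverse limits of Banach algebras); explicitly it is the completion of $k[\Gamma]$ for the norms $\|\sum\lambda_\gamma\gamma\|_{1,n}=\sum|\lambda_\gamma|\,n^{w(\gamma)}$, $n\in\mathbb N_{\geq 1}$, where $w$ is the word length for a fixed finite generating set. $\otimes^\pi$ is the (completed) projective tensor product over $k$. The tensor structure is the natural map $\mathrm{Hom}(\Gamma,B^\times)\times\mathrm{Hom}(\Gamma,C^\times)\to\mathrm{Hom}(\Gamma,(B\otimes^\pi C)^\times)$, $(\rho_1,\rho_2)\mapsto\rho_1\otimes\rho_2$, with unit the trivial representation. The comultiplication $\mu$ corresponds to the image of $(\xi,\xi)$ under this map, where $\xi:\Gamma\to (k[\Gamma]^{\mathrm{an}})^\times$ is the universal representation, and the counit $\varepsilon$ corresponds to the trivial representation $\Gamma\to k^\times$. *)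

theory Defs
  imports
    Complex_Main
    "HOL-Algebra.Module"
    "HOL-Algebra.Generated_Groups"
    "HOL-Library.Poly_Mapping"
begin

section \<open>Multiplicatively convex Frechet algebras\<close>

text \<open>
  The ground field is a type \<open>'k\<close> of class \<open>real_normed_field\<close> and \<open>banach\<close>.
  Both \<open>real\<close> and \<open>complex\<close> are instances and, by the Gelfand--Mazur theorem, these are the only
  ones up to isometric isomorphism.

  An algebra comes with a sequence of seminorms that defines its topology. In a Frechet algebra the
  sequence is required to be increasing, so that the sets given by \<open>seminorm A n x < d\<close> form a
  neighbourhood base of zero.
\<close>

record ('k, 'a) seminormed_algebra = "('k, 'a) module" +
  seminorm :: "nat \<Rightarrow> 'a \<Rightarrow> real"

definition ground :: "('k::real_normed_field, 'k) seminormed_algebra" where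
  "ground = \<lparr>carrier = UNIV, mult = (*), one = 1, zero = 0, add = (+), smult = (*),
     seminorm = (\<lambda>_. norm)\<rparr>"

definition cauchy_seqs :: "('k, 'a) seminormed_algebra \<Rightarrow> (nat \<Rightarrow> 'a) set" where
  "cauchy_seqs A = {s. (\<forall>i. s i \<in> carrier A) \<and>
     (\<forall>n. \<forall>e>0. \<exists>N. \<forall>i\<ge>N. \<forall>j\<ge>N. seminorm A n (s i \<ominus>\<^bsub>A\<^esub> s j) < e)}"

locale mc_frechet_algebra = ring A + module "ground :: ('k, 'k) seminormed_algebra" A
  for A :: "('k::{real_normed_field, banach}, 'a) seminormed_algebra" (structure) +
  assumes smult_mult_left:
      "\<lbrakk>x \<in> carrier A; y \<in> carrier A\<rbrakk> \<Longrightarrow> (c \<odot> x) \<otimes> y = c \<odot> (x \<otimes> y)"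
    and smult_mult_right:
      "\<lbrakk>x \<in> carrier A; y \<in> carrier A\<rbrakk> \<Longrightarrow> x \<otimes> (c \<odot> y) = c \<odot> (x \<otimes> y)"
    and seminorm_triangle:
      "\<lbrakk>x \<in> carrier A; y \<in> carrier A\<rbrakk> \<Longrightarrow> seminorm A n (x \<oplus> y) \<le> seminorm A n x + seminorm A n y"
    and seminorm_smult: "x \<in> carrier A \<Longrightarrow> seminorm A n (c \<odot> x) = norm c * seminorm A n x"
    and seminorm_mult:
      "\<lbrakk>x \<in> carrier A; y \<in> carrier A\<rbrakk> \<Longrightarrow> seminorm A n (x \<otimes> y) \<le> seminorm A n x * seminorm A n y"
    and seminorm_increasing: "x \<in> carrier A \<Longrightarrow> seminorm A n x \<le> seminorm A (Suc n) x"
    and hausdorff: "\<lbrakk>x \<in> carrier A; \<And>n. seminorm A n x = 0\<rbrakk> \<Longrightarrow> x = \<zero>"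
    and complete: "s \<in> cauchy_seqs A \<Longrightarrow>
      \<exists>x\<in>carrier A. \<forall>n. (\<lambda>i. seminorm A n (s i \<ominus> x)) \<longlonglongrightarrow> 0"

definition continuous_map_on ::
  "('k, 'a) seminormed_algebra \<Rightarrow> ('k, 'b) seminormed_algebra \<Rightarrow> ('a \<Rightarrow> 'b) \<Rightarrow> bool" where
  "continuous_map_on A B f \<longleftrightarrow> (\<forall>x\<in>carrier A. \<forall>n. \<forall>e>0. \<exists>m. \<exists>d>0. \<forall>y\<in>carrier A.
     seminorm A m (y \<ominus>\<^bsub>A\<^esub> x) < d \<longrightarrow> seminorm B n (f y \<ominus>\<^bsub>B\<^esub> f x) < e)"

definition continuous_linear ::
  "('k, 'a) seminormed_algebra \<Rightarrow> ('k, 'b) seminormed_algebra \<Rightarrow> ('a \<Rightarrow> 'b) \<Rightarrow> bool" where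
  "continuous_linear A B f \<longleftrightarrow> f \<in> carrier A \<rightarrow> carrier B \<and>
     (\<forall>x\<in>carrier A. \<forall>y\<in>carrier A. f (x \<oplus>\<^bsub>A\<^esub> y) = f x \<oplus>\<^bsub>B\<^esub> f y) \<and>
     (\<forall>c. \<forall>x\<in>carrier A. f (c \<odot>\<^bsub>A\<^esub> x) = c \<odot>\<^bsub>B\<^esub> f x) \<and>
     continuous_map_on A B f"

definition continuous_alg_hom ::
  "('k, 'a) seminormed_algebra \<Rightarrow> ('k, 'b) seminormed_algebra \<Rightarrow> ('a \<Rightarrow> 'b) \<Rightarrow> bool" where
  "continuous_alg_hom A B f \<longleftrightarrow> continuous_linear A B f \<and> f \<in> ring_hom A B"


section \<open>Hausdorff completion\<close>

definition null_rel :: "('k, 'a) seminormed_algebra \<Rightarrow> ((nat \<Rightarrow> 'a) \<times> (nat \<Rightarrow> 'a)) set" where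
  "null_rel A = {(s, t). s \<in> cauchy_seqs A \<and> t \<in> cauchy_seqs A \<and>
     (\<forall>n. (\<lambda>i. seminorm A n (s i \<ominus>\<^bsub>A\<^esub> t i)) \<longlonglongrightarrow> 0)}"

text \<open>
  Cauchy sequences modulo null sequences. The algebra \<open>A\<close> need not be Hausdorff: the elements on
  which all seminorms vanish are identified with zero.
\<close>

definition completion ::
  "('k, 'a) seminormed_algebra \<Rightarrow> ('k, (nat \<Rightarrow> 'a) set) seminormed_algebra" where
  "completion A = \<lparr>
     carrier = cauchy_seqs A // null_rel A,
     mult = (\<lambda>X Y. \<Union>s\<in>X. \<Union>t\<in>Y. null_rel A `` {\<lambda>i. s i \<otimes>\<^bsub>A\<^esub> t i}),
     one = null_rel A `` {\<lambda>_. \<one>\<^bsub>A\<^esub>},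
     zero = null_rel A `` {\<lambda>_. \<zero>\<^bsub>A\<^esub>},
     add = (\<lambda>X Y. \<Union>s\<in>X. \<Union>t\<in>Y. null_rel A `` {\<lambda>i. s i \<oplus>\<^bsub>A\<^esub> t i}),
     smult = (\<lambda>c X. \<Union>s\<in>X. null_rel A `` {\<lambda>i. c \<odot>\<^bsub>A\<^esub> s i}),
     seminorm = (\<lambda>n X. THE r. \<forall>s\<in>X. (\<lambda>i. seminorm A n (s i)) \<longlonglongrightarrow> r)\<rparr>"

definition to_completion :: "('k, 'a) seminormed_algebra \<Rightarrow> 'a \<Rightarrow> (nat \<Rightarrow> 'a) set" where
  "to_completion A x = null_rel A `` {\<lambda>_. x}"


section \<open>Monoid algebras\<close>

definition pm_scale :: "'k::real_normed_field \<Rightarrow> ('x \<Rightarrow>\<^sub>0 'k) \<Rightarrow> ('x \<Rightarrow>\<^sub>0 'k)" where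
  "pm_scale c u = Poly_Mapping.map ((*) c) u"

definition monoid_algebra ::
  "('x, 'm) monoid_scheme \<Rightarrow> (nat \<Rightarrow> ('x \<Rightarrow>\<^sub>0 'k) \<Rightarrow> real)
     \<Rightarrow> ('k::real_normed_field, 'x \<Rightarrow>\<^sub>0 'k) seminormed_algebra" where
  "monoid_algebra M p = \<lparr>
     carrier = {u. Poly_Mapping.keys u \<subseteq> carrier M},
     mult = (\<lambda>u v. \<Sum>x\<in>Poly_Mapping.keys u. \<Sum>y\<in>Poly_Mapping.keys v.
       Poly_Mapping.single (x \<otimes>\<^bsub>M\<^esub> y) (Poly_Mapping.lookup u x * Poly_Mapping.lookup v y)),
     one = Poly_Mapping.single \<one>\<^bsub>M\<^esub> 1,
     zero = 0,
     add = (+),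
     smult = pm_scale,
     seminorm = p\<rparr>"


section \<open>Completed projective tensor product\<close>

text \<open>
  The relations defining the algebraic tensor product as a quotient of the free vector space on
  \<open>carrier A \<times> carrier B\<close>.
\<close>

definition tensor_relations ::
  "('k::real_normed_field, 'a) seminormed_algebra \<Rightarrow> ('k, 'b) seminormed_algebra
     \<Rightarrow> ('a \<times> 'b \<Rightarrow>\<^sub>0 'k) set" where
  "tensor_relations A B =
     {Poly_Mapping.single (a \<oplus>\<^bsub>A\<^esub> a', b) 1 - Poly_Mapping.single (a, b) 1
        - Poly_Mapping.single (a', b) 1 | a a' b.
        a \<in> carrier A \<and> a' \<in> carrier A \<and> b \<in> carrier B} \<union>
     {Poly_Mapping.single (a, b \<oplus>\<^bsub>B\<^esub> b') 1 - Poly_Mapping.single (a, b) 1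
        - Poly_Mapping.single (a, b') 1 | a b b'.
        a \<in> carrier A \<and> b \<in> carrier B \<and> b' \<in> carrier B} \<union>
     {Poly_Mapping.single (c \<odot>\<^bsub>A\<^esub> a, b) 1 - Poly_Mapping.single (a, b) c | c a b.
        a \<in> carrier A \<and> b \<in> carrier B} \<union>
     {Poly_Mapping.single (a, c \<odot>\<^bsub>B\<^esub> b) 1 - Poly_Mapping.single (a, b) c | c a b.
        a \<in> carrier A \<and> b \<in> carrier B}"

text \<open>
  The projective seminorm of the class of \<open>u\<close> in the algebraic tensor product: the infimum of
  \<open>\<Sum> p(a\<^sub>i) q(b\<^sub>i)\<close> over all representations \<open>\<Sum> a\<^sub>i \<otimes> b\<^sub>i\<close> of that class.
\<close>

definition projective_seminorm ::
  "('k::real_normed_field, 'a) seminormed_algebra \<Rightarrow> ('k, 'b) seminormed_algebra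
     \<Rightarrow> nat \<Rightarrow> ('a \<times> 'b \<Rightarrow>\<^sub>0 'k) \<Rightarrow> real" where
  "projective_seminorm A B n u = Inf {(\<Sum>(a, b)\<leftarrow>l. seminorm A n a * seminorm B n b) | l.
     set l \<subseteq> carrier A \<times> carrier B \<and>
     u - (\<Sum>(a, b)\<leftarrow>l. Poly_Mapping.single (a, b) 1)
       \<in> Modules.module.span pm_scale (tensor_relations A B)}"

text \<open>
  The free vector space on pairs is an algebra via \<open>(a, b) (a', b') = (a a', b b')\<close>. The projective
  seminorms vanish on the tensor relations, so its Hausdorff completion is that of the algebraic
  tensor product. As the seminorm sequences of \<open>A\<close> and \<open>B\<close> are increasing, it suffices to pair
  seminorms of equal index.
\<close>

definition formal_tensor ::
  "('k::real_normed_field, 'a) seminormed_algebra \<Rightarrow> ('k, 'b) seminormed_algebra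
     \<Rightarrow> ('k, 'a \<times> 'b \<Rightarrow>\<^sub>0 'k) seminormed_algebra" where
  "formal_tensor A B = monoid_algebra (A \<times>\<times> B) (projective_seminorm A B)"

definition projective_tensor ::
  "('k::real_normed_field, 'a) seminormed_algebra \<Rightarrow> ('k, 'b) seminormed_algebra
     \<Rightarrow> ('k, (nat \<Rightarrow> ('a \<times> 'b \<Rightarrow>\<^sub>0 'k)) set) seminormed_algebra" where
  "projective_tensor A B = completion (formal_tensor A B)"

definition pure_tensor ::
  "('k::real_normed_field, 'a) seminormed_algebra \<Rightarrow> ('k, 'b) seminormed_algebra
     \<Rightarrow> 'a \<Rightarrow> 'b \<Rightarrow> (nat \<Rightarrow> ('a \<times> 'b \<Rightarrow>\<^sub>0 'k)) set" where
  "pure_tensor A B a b = to_completion (formal_tensor A B) (Poly_Mapping.single (a, b) 1)"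

text \<open>The continuous linear map induced by a continuous bilinear map \<open>\<beta>\<close> into \<open>F\<close>.\<close>

definition tensor_lift ::
  "('k::real_normed_field, 'a) seminormed_algebra \<Rightarrow> ('k, 'b) seminormed_algebra
     \<Rightarrow> ('k, 'f) seminormed_algebra \<Rightarrow> ('a \<Rightarrow> 'b \<Rightarrow> 'f)
     \<Rightarrow> (nat \<Rightarrow> ('a \<times> 'b \<Rightarrow>\<^sub>0 'k)) set \<Rightarrow> 'f" where
  "tensor_lift A B F \<beta> = (THE h. h \<in> extensional (carrier (projective_tensor A B)) \<and>
     continuous_linear (projective_tensor A B) F h \<and>
     (\<forall>a\<in>carrier A. \<forall>b\<in>carrier B. h (pure_tensor A B a b) = \<beta> a b))"

definition tensor_map where
  "tensor_map A B A' B' f g =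
     tensor_lift A B (projective_tensor A' B') (\<lambda>a b. pure_tensor A' B' (f a) (g b))"

text \<open>The associator \<open>(a \<otimes> b) \<otimes> c \<mapsto> a \<otimes> (b \<otimes> c)\<close>.\<close>

definition tensor_assoc where
  "tensor_assoc A B C =
     tensor_lift (projective_tensor A B) C (projective_tensor A (projective_tensor B C))
       (\<lambda>t c. tensor_lift A B (projective_tensor A (projective_tensor B C))
          (\<lambda>a b. pure_tensor A (projective_tensor B C) a (pure_tensor B C b c)) t)"


section \<open>Bialgebras and grouplike elements\<close>

text \<open>The counit laws are stated through the canonical isomorphisms of \<open>k \<otimes> A\<close> and \<open>A \<otimes> k\<close> with \<open>A\<close>.\<close>

definition mc_frechet_bialgebra ::
  "('k::{real_normed_field, banach}, 'a) seminormed_algebra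
     \<Rightarrow> ('a \<Rightarrow> (nat \<Rightarrow> ('a \<times> 'a \<Rightarrow>\<^sub>0 'k)) set) \<Rightarrow> ('a \<Rightarrow> 'k) \<Rightarrow> bool" where
  "mc_frechet_bialgebra A \<Delta> \<epsilon> \<longleftrightarrow>
     mc_frechet_algebra A \<and>
     continuous_alg_hom A (projective_tensor A A) \<Delta> \<and>
     continuous_alg_hom A ground \<epsilon> \<and>
     (\<forall>a\<in>carrier A.
        tensor_assoc A A A (tensor_map A A (projective_tensor A A) A \<Delta> id (\<Delta> a))
          = tensor_map A A A (projective_tensor A A) id \<Delta> (\<Delta> a)) \<and>
     (\<forall>a\<in>carrier A. tensor_map A A ground A \<epsilon> id (\<Delta> a) = pure_tensor ground A 1 a) \<and>
     (\<forall>a\<in>carrier A. tensor_map A A A ground id \<epsilon> (\<Delta> a) = pure_tensor A ground a 1)"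

definition grouplikes ::
  "('k::real_normed_field, 'a) seminormed_algebra
     \<Rightarrow> ('a \<Rightarrow> (nat \<Rightarrow> ('a \<times> 'a \<Rightarrow>\<^sub>0 'k)) set) \<Rightarrow> ('a \<Rightarrow> 'k) \<Rightarrow> 'a monoid" where
  "grouplikes A \<Delta> \<epsilon> = \<lparr>
     carrier = {a \<in> carrier A. \<Delta> a = pure_tensor A A a a \<and> \<epsilon> a = 1},
     mult = mult A,
     one = one A\<rparr>"


section \<open>The analytic group algebra\<close>

definition word_length :: "('g, 'm) monoid_scheme \<Rightarrow> 'g set \<Rightarrow> 'g \<Rightarrow> nat" where
  "word_length \<Gamma> S \<gamma> = (LEAST n. \<exists>l. length l = n \<and> set l \<subseteq> S \<union> (\<lambda>s. inv\<^bsub>\<Gamma>\<^esub> s) ` S \<and>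
     foldr (\<otimes>\<^bsub>\<Gamma>\<^esub>) l \<one>\<^bsub>\<Gamma>\<^esub> = \<gamma>)"

text \<open>The group algebra with the seminorms \<open>\<Sum> |\<lambda>\<^sub>\<gamma>| (n + 1)\<^sup>w\<^sup>(\<^sup>\<gamma>\<^sup>)\<close>, indexed from \<open>n = 0\<close>.\<close>

definition group_algebra ::
  "('g, 'm) monoid_scheme \<Rightarrow> 'g set \<Rightarrow> ('k::real_normed_field, 'g \<Rightarrow>\<^sub>0 'k) seminormed_algebra" where
  "group_algebra \<Gamma> S = monoid_algebra \<Gamma>
     (\<lambda>n u. \<Sum>\<gamma>\<in>Poly_Mapping.keys u.
        norm (Poly_Mapping.lookup u \<gamma>) * real (Suc n) ^ word_length \<Gamma> S \<gamma>)"

definition an_group_algebra ::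
  "('g, 'm) monoid_scheme \<Rightarrow> 'g set
     \<Rightarrow> ('k::real_normed_field, (nat \<Rightarrow> ('g \<Rightarrow>\<^sub>0 'k)) set) seminormed_algebra" where
  "an_group_algebra \<Gamma> S = completion (group_algebra \<Gamma> S)"

definition universal_rep ::
  "('g, 'm) monoid_scheme \<Rightarrow> 'g set \<Rightarrow> 'g \<Rightarrow> (nat \<Rightarrow> ('g \<Rightarrow>\<^sub>0 'k::real_normed_field)) set" where
  "universal_rep \<Gamma> S \<gamma> = to_completion (group_algebra \<Gamma> S) (Poly_Mapping.single \<gamma> 1)"

definition tensor_rep ::
  "('k::real_normed_field, 'b) seminormed_algebra \<Rightarrow> ('k, 'c) seminormed_algebra
     \<Rightarrow> ('g \<Rightarrow> 'b) \<Rightarrow> ('g \<Rightarrow> 'c) \<Rightarrow> 'g \<Rightarrow> (nat \<Rightarrow> ('b \<times> 'c \<Rightarrow>\<^sub>0 'k)) set" where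
  "tensor_rep B C \<rho>\<^sub>1 \<rho>\<^sub>2 \<gamma> = pure_tensor B C (\<rho>\<^sub>1 \<gamma>) (\<rho>\<^sub>2 \<gamma>)"

definition trivial_rep :: "'g \<Rightarrow> 'k::real_normed_field" where
  "trivial_rep \<gamma> = 1"

text \<open>
  \<open>\<phi>\<close> corresponds to the representation \<open>\<rho>\<close> of \<open>\<Gamma>\<close> in the units of \<open>B\<close> under the representability
  of \<open>B \<mapsto> Hom(\<Gamma>, B\<^sup>\<times>)\<close> by the analytic group algebra.
\<close>

definition corresponds ::
  "('g, 'm) monoid_scheme \<Rightarrow> 'g set \<Rightarrow> ('k::real_normed_field, 'b) seminormed_algebra
     \<Rightarrow> ('g \<Rightarrow> 'b) \<Rightarrow> ((nat \<Rightarrow> ('g \<Rightarrow>\<^sub>0 'k)) set \<Rightarrow> 'b) \<Rightarrow> bool" where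
  "corresponds \<Gamma> S B \<rho> \<phi> \<longleftrightarrow> \<rho> \<in> hom \<Gamma> (units_of B) \<and>
     \<phi> \<in> extensional (carrier (an_group_algebra \<Gamma> S)) \<and>
     continuous_alg_hom (an_group_algebra \<Gamma> S) B \<phi> \<and>
     (\<forall>\<gamma>\<in>carrier \<Gamma>. \<phi> (universal_rep \<Gamma> S \<gamma>) = \<rho> \<gamma>)"

end

theory Submission
  imports Defs
begin

text \<open>
  An element of the analytic group algebra \<open>A\<close> is determined by its coefficients: for every \<open>\<gamma>\<close> the
  coefficient \<open>e\<^sub>\<gamma>\<close> is a continuous functional, and these functionals separate points. Hence
  \<open>e\<^sub>\<gamma> \<otimes> e\<^sub>\<delta>\<close> is a continuous functional on the projective tensor product. By density of the span of
  \<open>\<Gamma>\<close> it maps \<open>\<mu>(a)\<close> to \<open>e\<^sub>\<gamma>(a)\<close> if \<open>\<gamma> = \<delta>\<close> and to \<open>0\<close> otherwise. So \<open>\<mu>(a) = a \<otimes> a\<close> says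
  \<open>e\<^sub>\<gamma>(a) e\<^sub>\<delta>(a) = 0\<close> for \<open>\<gamma> \<noteq> \<delta>\<close> and \<open>e\<^sub>\<gamma>(a)\<^sup>2 = e\<^sub>\<gamma>(a)\<close>: at most one coefficient is
  non-zero, and it is \<open>1\<close>. The counit excludes \<open>a = 0\<close>. The bialgebra laws compare continuous linear
  maps that agree on \<open>\<Gamma>\<close>.
\<close>

section \<open>Seminormed algebras\<close>

text \<open>The two basic algebras, the group algebra and the formal tensors, are monoid algebras
  that need not be complete or Hausdorff; the analytic group algebra and the projective tensor
  product are their completions. Hence \<open>seminormed_alg\<close> omits these two axioms, and
  maps out of either completion arise alike: linear extension from the basis, a seminorm bound,
  extension by limits. They are unique because the basis spans a dense subspace. The quotient by the
  tensor relations is performed by the Hausdorff completion, since the projective seminorms vanish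
  on the relations. The maps \<mu> and \<epsilon> exist because a representation grows at most
  exponentially in the word length: submultiplicativity bounds the image of a word by a power of a
  bound for the finitely many letters, up to a constant. The norms with base n + 1, for all n
  together, dominate every such growth. The delicate point is that coefficients separate points. In
  a general completion all extended coordinates of a non-zero element may vanish; the weighted l1
  shape of the norms excludes this.\<close>

locale seminormed_alg = ring A
  for A :: "('k::real_normed_field, 'a) seminormed_algebra" (structure) +
  assumes smult_closed [simp, intro]: "x \<in> carrier A \<Longrightarrow> c \<odot> x \<in> carrier A"
    and smult_add_left: "x \<in> carrier A \<Longrightarrow> (c + d) \<odot> x = c \<odot> x \<oplus> d \<odot> x"
    and smult_add_right:
      "\<lbrakk>x \<in> carrier A; y \<in> carrier A\<rbrakk> \<Longrightarrow> c \<odot> (x \<oplus> y) = c \<odot> x \<oplus> c \<odot> y"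
    and smult_smult: "x \<in> carrier A \<Longrightarrow> (c * d) \<odot> x = c \<odot> (d \<odot> x)"
    and smult_one [simp]: "x \<in> carrier A \<Longrightarrow> 1 \<odot> x = x"
    and smult_mult_left:
      "\<lbrakk>x \<in> carrier A; y \<in> carrier A\<rbrakk> \<Longrightarrow> (c \<odot> x) \<otimes> y = c \<odot> (x \<otimes> y)"
    and smult_mult_right:
      "\<lbrakk>x \<in> carrier A; y \<in> carrier A\<rbrakk> \<Longrightarrow> x \<otimes> (c \<odot> y) = c \<odot> (x \<otimes> y)"
    and seminorm_triangle:
      "\<lbrakk>x \<in> carrier A; y \<in> carrier A\<rbrakk> \<Longrightarrow> seminorm A n (x \<oplus> y) \<le> seminorm A n x + seminorm A n y"
    and seminorm_smult: "x \<in> carrier A \<Longrightarrow> seminorm A n (c \<odot> x) = norm c * seminorm A n x"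
    and seminorm_mult:
      "\<lbrakk>x \<in> carrier A; y \<in> carrier A\<rbrakk> \<Longrightarrow> seminorm A n (x \<otimes> y) \<le> seminorm A n x * seminorm A n y"
    and seminorm_increasing: "x \<in> carrier A \<Longrightarrow> seminorm A n x \<le> seminorm A (Suc n) x"

locale frechet_alg = seminormed_alg +
  assumes hausdorff: "\<lbrakk>x \<in> carrier A; \<And>n. seminorm A n x = 0\<rbrakk> \<Longrightarrow> x = \<zero>"
    and complete: "s \<in> cauchy_seqs A \<Longrightarrow>
      \<exists>x\<in>carrier A. \<forall>n. (\<lambda>i. seminorm A n (s i \<ominus> x)) \<longlonglongrightarrow> 0"

lemma cring_ground: "cring (ground :: ('k::real_normed_field, 'k) seminormed_algebra)"
proof (rule cringI)
  show "abelian_group (ground :: ('k, 'k) seminormed_algebra)"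
  proof (rule abelian_groupI)
    fix x :: 'k assume "x \<in> carrier ground"
    show "\<exists>y\<in>carrier ground. y \<oplus>\<^bsub>ground\<^esub> x = \<zero>\<^bsub>ground\<^esub>"
      by (rule bexI[of _ "- x"]) (auto simp: ground_def)
  qed (auto simp: ground_def)
  show "comm_monoid (ground :: ('k, 'k) seminormed_algebra)"
    by (rule comm_monoidI) (auto simp: ground_def)
qed (auto simp: ground_def algebra_simps)

text \<open>The module axioms over \<open>ground\<close> are the scalar laws of
  \<open>seminormed_alg\<close>, because the carrier of \<open>ground\<close> is the whole type. The
  proof works with the latter form and returns to the definition through this equivalence.\<close>

lemma mc_frechet_algebra_iff_frechet_alg:
  fixes A :: "('k::{real_normed_field, banach}, 'a) seminormed_algebra"
  shows "mc_frechet_algebra A \<longleftrightarrow> frechet_alg A"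
proof
  assume "mc_frechet_algebra A"
  then interpret mc_frechet_algebra A .
  show "frechet_alg A"
  proof (unfold_locales, goal_cases)
    case (1 x c)
    then show ?case using smult_closed[of c x] by (simp add: ground_def)
  next
    case (2 x c d)
    then show ?case using smult_l_distr[of c d x] by (simp add: ground_def)
  next
    case (3 x y c)
    then show ?case using smult_r_distr[of c x y] by (simp add: ground_def)
  next
    case (4 x c d)
    then show ?case using smult_assoc1[of c d x] by (simp add: ground_def)
  next
    case (5 x)
    then show ?case using smult_one[of x] by (simp add: ground_def)
  qed (auto intro: smult_mult_left smult_mult_right seminorm_triangle seminorm_smult seminorm_mult
      seminorm_increasing hausdorff complete)
next
  assume "frechet_alg A"
  then interpret frechet_alg A .
  have "module (ground :: ('k, 'k) seminormed_algebra) A"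
    by (rule moduleI)
      (auto simp: cring_ground is_abelian_group, auto simp: ground_def smult_add_left
          smult_add_right smult_smult)
  moreover have "mc_frechet_algebra_axioms A"
    by unfold_locales
     (auto intro: smult_mult_left smult_mult_right seminorm_triangle seminorm_smult seminorm_mult
      seminorm_increasing hausdorff complete)
  ultimately show "mc_frechet_algebra A"
    by (intro mc_frechet_algebra.intro) (simp_all add: ring_axioms)
qed

lemma tendsto_0_le_real:
  fixes f g :: "nat \<Rightarrow> real"
  assumes "g \<longlonglongrightarrow> 0" and "\<And>i. 0 \<le> f i" and "\<And>i. f i \<le> g i"
  shows "f \<longlonglongrightarrow> 0"
  by (rule tendsto_sandwich[OF _ _ tendsto_const assms(1)]) (simp_all add: assms)

context seminormed_alg
begin

lemma smult_zero [simp]: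
  assumes "x \<in> carrier A" shows "0 \<odot> x = \<zero>"
  using smult_add_left[OF assms, of 0 0] assms add.l_cancel_one' by simp

lemma smult_neg_one:
  assumes "x \<in> carrier A" shows "(- 1) \<odot> x = \<ominus> x"
  using smult_add_left[OF assms, of "- 1" 1] assms by (intro minus_equality[symmetric]) auto

lemma smult_of_zero [simp]: "c \<odot> \<zero> = \<zero>"
  using smult_smult[of \<zero> c 0] by simp

lemma smult_minus_right:
  assumes "x \<in> carrier A" "y \<in> carrier A" shows "c \<odot> (x \<ominus> y) = c \<odot> x \<ominus> c \<odot> y"
proof -
  have "c \<odot> (\<ominus> y) = \<ominus> (c \<odot> y)"
    using assms smult_smult[of y c "- 1"] smult_smult[of y "- 1" c]
    by (simp flip: smult_neg_one)
  then show ?thesis using assms by (simp add: a_minus_def smult_add_right)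
qed

lemma seminorm_zero [simp]: "seminorm A n \<zero> = 0"
  using seminorm_smult[of \<zero> n 0] by simp

lemma seminorm_neg [simp]: "x \<in> carrier A \<Longrightarrow> seminorm A n (\<ominus> x) = seminorm A n x"
  using seminorm_smult[of x n "- 1"] by (simp add: smult_neg_one)

text \<open>Twice the seminorm of \<open>x\<close> bounds the seminorm of
  \<open>x \<oplus> \<ominus> x\<close>, which is 0.\<close>

lemma seminorm_nonneg [simp]: "x \<in> carrier A \<Longrightarrow> 0 \<le> seminorm A n x"
  using seminorm_triangle[of x "\<ominus> x" n] by (simp add: r_neg)

lemma seminorm_mono: "x \<in> carrier A \<Longrightarrow> m \<le> n \<Longrightarrow> seminorm A m x \<le> seminorm A n x"
  by (rule lift_Suc_mono_le[of "\<lambda>n. seminorm A n x"]) (auto intro: seminorm_increasing)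

lemma seminorm_minus_commute:
  "\<lbrakk>x \<in> carrier A; y \<in> carrier A\<rbrakk> \<Longrightarrow> seminorm A n (x \<ominus> y) = seminorm A n (y \<ominus> x)"
  using seminorm_neg[of "x \<ominus> y" n] by (simp add: a_minus_def minus_add a_comm)

lemma minus_self [simp]: "x \<in> carrier A \<Longrightarrow> x \<ominus> x = \<zero>"
  by (simp add: a_minus_def r_neg)

lemma minus_zero_right [simp]: "x \<in> carrier A \<Longrightarrow> x \<ominus> \<zero> = x"
  by (simp add: a_minus_def)

lemma minus_add_minus:
  assumes "x \<in> carrier A" "y \<in> carrier A" "z \<in> carrier A"
  shows "(x \<ominus> y) \<oplus> (y \<ominus> z) = x \<ominus> z"
  using assms by (simp add: a_minus_def a_assoc r_neg1)

lemma minus_add_cancel: "\<lbrakk>x \<in> carrier A; y \<in> carrier A\<rbrakk> \<Longrightarrow> (x \<ominus> y) \<oplus> y = x"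
  by (simp add: a_minus_def a_assoc l_neg)

lemma add_minus_add:
  assumes "x \<in> carrier A" "y \<in> carrier A" "x' \<in> carrier A" "y' \<in> carrier A"
  shows "(x \<oplus> y) \<ominus> (x' \<oplus> y') = (x \<ominus> x') \<oplus> (y \<ominus> y')"
  using assms by (simp add: a_minus_def minus_add a_ac)

text \<open>The splitting behind every product estimate: only one factor varies at a time.\<close>

lemma mult_minus_mult:
  assumes "x \<in> carrier A" "y \<in> carrier A" "x' \<in> carrier A" "y' \<in> carrier A"
  shows "(x \<otimes> y) \<ominus> (x' \<otimes> y') = (x \<ominus> x') \<otimes> y \<oplus> x' \<otimes> (y \<ominus> y')"
proof -
  have "(x \<ominus> x') \<otimes> y = x \<otimes> y \<ominus> x' \<otimes> y" "x' \<otimes> (y \<ominus> y') = x' \<otimes> y \<ominus> x' \<otimes> y'"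
    using assms by (simp_all add: a_minus_def l_distr r_distr l_minus r_minus)
  then show ?thesis using assms by (simp add: minus_add_minus)
qed

lemma seminorm_triangle_minus:
  assumes "x \<in> carrier A" "y \<in> carrier A" "z \<in> carrier A"
  shows "seminorm A n (x \<ominus> z) \<le> seminorm A n (x \<ominus> y) + seminorm A n (y \<ominus> z)"
  using seminorm_triangle[of "x \<ominus> y" "y \<ominus> z" n] assms by (simp add: minus_add_minus)

lemma seminorm_triangle_abs:
  assumes "x \<in> carrier A" "y \<in> carrier A"
  shows "\<bar>seminorm A n x - seminorm A n y\<bar> \<le> seminorm A n (x \<ominus> y)"
  using seminorm_triangle[of "x \<ominus> y" y n] seminorm_triangle[of "y \<ominus> x" x n] assms
  by (simp add: minus_add_cancel seminorm_minus_commute[of y x])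

lemma eq_if_minus_eq_zero: "\<lbrakk>x \<in> carrier A; y \<in> carrier A; x \<ominus> y = \<zero>\<rbrakk> \<Longrightarrow> x = y"
  using minus_add_cancel[of x y] by simp

end

section \<open>Limits of sequences\<close>

definition converges_to :: "('k, 'a) seminormed_algebra \<Rightarrow> (nat \<Rightarrow> 'a) \<Rightarrow> 'a \<Rightarrow> bool" where
  "converges_to A s x \<longleftrightarrow> (\<forall>n. (\<lambda>i. seminorm A n (s i \<ominus>\<^bsub>A\<^esub> x)) \<longlonglongrightarrow> 0)"

context seminormed_alg
begin

lemma converges_to_add:
  assumes "converges_to A s x" "converges_to A t y" "\<And>i. s i \<in> carrier A" "\<And>i. t i \<in> carrier A"
    "x \<in> carrier A" "y \<in> carrier A"
  shows "converges_to A (\<lambda>i. s i \<oplus> t i) (x \<oplus> y)"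
  unfolding converges_to_def
proof
  fix n
  have "(\<lambda>i. seminorm A n (s i \<ominus> x) + seminorm A n (t i \<ominus> y)) \<longlonglongrightarrow> 0"
    using tendsto_add[of _ 0 _ _ 0] assms(1,2) by (fastforce simp: converges_to_def)
  then show "(\<lambda>i. seminorm A n (s i \<oplus> t i \<ominus> (x \<oplus> y))) \<longlonglongrightarrow> 0"
    by (rule tendsto_0_le_real) (use assms in \<open>auto simp: add_minus_add intro: seminorm_triangle\<close>)
qed

lemma converges_to_smult:
  assumes "converges_to A s x" "\<And>i. s i \<in> carrier A" "x \<in> carrier A"
  shows "converges_to A (\<lambda>i. c \<odot> s i) (c \<odot> x)"
  unfolding converges_to_def
proof
  fix n
  have "(\<lambda>i. norm c * seminorm A n (s i \<ominus> x)) \<longlonglongrightarrow> 0"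
    using tendsto_mult_right_zero assms(1) by (fastforce simp: converges_to_def)
  then show "(\<lambda>i. seminorm A n (c \<odot> s i \<ominus> c \<odot> x)) \<longlonglongrightarrow> 0"
    by (simp add: assms(2,3) seminorm_smult flip: smult_minus_right)
qed

lemma converges_to_seminorm:
  assumes "converges_to A s x" "\<And>i. s i \<in> carrier A" "x \<in> carrier A"
  shows "(\<lambda>i. seminorm A n (s i)) \<longlonglongrightarrow> seminorm A n x"
proof -
  have "(\<lambda>i. seminorm A n (s i \<ominus> x)) \<longlonglongrightarrow> 0" using assms(1) by (simp add: converges_to_def)
  then have "(\<lambda>i. \<bar>seminorm A n (s i) - seminorm A n x\<bar>) \<longlonglongrightarrow> 0"
    by (rule tendsto_0_le_real) (use assms in \<open>auto intro: seminorm_triangle_abs\<close>)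
  then show ?thesis by (simp add: LIM_zero_cancel tendsto_rabs_zero_iff)
qed

lemma converges_to_mult:
  assumes "converges_to A s x" "converges_to A t y" "\<And>i. s i \<in> carrier A" "\<And>i. t i \<in> carrier A"
    "x \<in> carrier A" "y \<in> carrier A"
  shows "converges_to A (\<lambda>i. s i \<otimes> t i) (x \<otimes> y)"
  unfolding converges_to_def
proof
  fix n
  have "(\<lambda>i. seminorm A n (s i \<ominus> x) * seminorm A n (t i) + seminorm A n x * seminorm A n (t i \<ominus> y))
      \<longlonglongrightarrow> 0 * seminorm A n y + seminorm A n x * 0"
    using assms by (intro tendsto_intros converges_to_seminorm) (auto simp: converges_to_def)
  then have "(\<lambda>i. seminorm A n (s i \<ominus> x) * seminorm A n (t i) + seminorm A n x * seminorm A n (t i \<ominus>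
      y))
      \<longlonglongrightarrow> 0" by simp
  then show "(\<lambda>i. seminorm A n (s i \<otimes> t i \<ominus> (x \<otimes> y))) \<longlonglongrightarrow> 0"
  proof (rule tendsto_0_le_real)
    fix i
    show "seminorm A n (s i \<otimes> t i \<ominus> x \<otimes> y) \<le>
        seminorm A n (s i \<ominus> x) * seminorm A n (t i) + seminorm A n x * seminorm A n (t i \<ominus> y)"
      using assms
        by (simp add: mult_minus_mult, intro order.trans[OF seminorm_triangle] add_mono seminorm_mult) auto
  qed (use assms in auto)
qed

text \<open>Without the Hausdorff axiom, limits are unique only up to elements on which all
  seminorms vanish.\<close>

lemma seminorm_minus_eq_zero_if_limits:
  assumes "converges_to A s x" "converges_to A s y" "\<And>i. s i \<in> carrier A"
    "x \<in> carrier A" "y \<in> carrier A"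
  shows "seminorm A n (x \<ominus> y) = 0"
proof -
  have "(\<lambda>i. seminorm A n (s i \<ominus> x) + seminorm A n (s i \<ominus> y)) \<longlonglongrightarrow> 0"
    using tendsto_add[of _ 0 _ _ 0] assms(1,2) by (fastforce simp: converges_to_def)
  moreover have "seminorm A n (x \<ominus> y) \<le> seminorm A n (s i \<ominus> x) + seminorm A n (s i \<ominus> y)" for i
    using seminorm_triangle_minus[of x "s i" y n] assms by (simp add: seminorm_minus_commute)
  ultimately have "seminorm A n (x \<ominus> y) \<le> 0"
    by (intro LIMSEQ_le_const) auto
  then show ?thesis using assms seminorm_nonneg[of "x \<ominus> y" n] by (intro antisym) simp_all
qed

end

lemma (in frechet_alg) converges_to_unique:
  assumes "converges_to A s x" "converges_to A s y" "\<And>i. s i \<in> carrier A"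
    "x \<in> carrier A" "y \<in> carrier A"
  shows "x = y"
  using seminorm_minus_eq_zero_if_limits[OF assms] assms(4,5)
  by (intro eq_if_minus_eq_zero[OF _ _ hausdorff]) simp_all


section \<open>Bounded linear maps\<close>

definition linear_map :: "('k, 'a) seminormed_algebra \<Rightarrow> ('k, 'b) seminormed_algebra \<Rightarrow> ('a \<Rightarrow> 'b) \<Rightarrow>
    bool" where
  "linear_map A B f \<longleftrightarrow> f \<in> carrier A \<rightarrow> carrier B \<and>
     (\<forall>x\<in>carrier A. \<forall>y\<in>carrier A. f (x \<oplus>\<^bsub>A\<^esub> y) = f x \<oplus>\<^bsub>B\<^esub> f y) \<and>
     (\<forall>c. \<forall>x\<in>carrier A. f (c \<odot>\<^bsub>A\<^esub> x) = c \<odot>\<^bsub>B\<^esub> f x)"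

text \<open>The usual continuity criterion for linear maps. A single index \<open>m\<close> replaces
  a maximum over finitely many seminorms because the seminorms increase.\<close>

definition bounded_map ::
  "('k, 'a) seminormed_algebra \<Rightarrow> ('k, 'b) seminormed_algebra \<Rightarrow> ('a \<Rightarrow> 'b) \<Rightarrow> bool" where
  "bounded_map A B f \<longleftrightarrow>
     (\<forall>n. \<exists>m C. 0 \<le> C \<and> (\<forall>x\<in>carrier A. seminorm B n (f x) \<le> C * seminorm A m x))"

lemma bounded_mapE:
  assumes "bounded_map A B f"
  obtains m C where "0 \<le> C" "\<And>x. x \<in> carrier A \<Longrightarrow> seminorm B n (f x) \<le> C * seminorm A m x"
  using assms unfolding bounded_map_def by blast

lemma linear_map_closed: "linear_map A B f \<Longrightarrow> x \<in> carrier A \<Longrightarrow> f x \<in> carrier B"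
  and linear_map_add: "linear_map A B f \<Longrightarrow> x \<in> carrier A \<Longrightarrow> y \<in> carrier A \<Longrightarrow>
    f (x \<oplus>\<^bsub>A\<^esub> y) = f x \<oplus>\<^bsub>B\<^esub> f y"
  and linear_map_smult: "linear_map A B f \<Longrightarrow> x \<in> carrier A \<Longrightarrow> f (c \<odot>\<^bsub>A\<^esub> x) = c \<odot>\<^bsub>B\<^esub> f x"
  by (auto simp: linear_map_def)

lemma linear_map_minus:
  assumes "seminormed_alg A" "seminormed_alg B" "linear_map A B f" "x \<in> carrier A" "y \<in> carrier A"
  shows "f (x \<ominus>\<^bsub>A\<^esub> y) = f x \<ominus>\<^bsub>B\<^esub> f y"
proof -
  interpret A: seminormed_alg A by fact
  interpret B: seminormed_alg B by fact
  show ?thesis using assms(3-5)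
    by (simp add: a_minus_def linear_map_closed linear_map_add linear_map_smult
        flip: A.smult_neg_one B.smult_neg_one)
qed

lemma linear_map_zero:
  assumes "seminormed_alg A" "seminormed_alg B" "linear_map A B f"
  shows "f \<zero>\<^bsub>A\<^esub> = \<zero>\<^bsub>B\<^esub>"
proof -
  interpret A: seminormed_alg A by fact
  interpret B: seminormed_alg B by fact
  show ?thesis using linear_map_smult[OF assms(3), of "\<zero>\<^bsub>A\<^esub>" 0] linear_map_closed[OF assms(3), of
      "\<zero>\<^bsub>A\<^esub>"]
    by simp
qed

lemma linear_map_comp:
  "linear_map A B f \<Longrightarrow> linear_map B D g \<Longrightarrow> linear_map A D (\<lambda>x. g (f x))"
  by (auto simp: linear_map_def Pi_iff)

lemma bounded_map_comp:
  assumes "linear_map A B f" "bounded_map A B f" "bounded_map B D g"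
  shows "bounded_map A D (\<lambda>x. g (f x))"
  unfolding bounded_map_def
proof
  fix n
  obtain m C where C: "0 \<le> C" "\<And>x. x \<in> carrier B \<Longrightarrow> seminorm D n (g x) \<le> C * seminorm B m x"
    by (rule bounded_mapE[OF assms(3), of n], rule that)
  obtain l E where E: "0 \<le> E" "\<And>x. x \<in> carrier A \<Longrightarrow> seminorm B m (f x) \<le> E * seminorm A l x"
    by (rule bounded_mapE[OF assms(2), of m], rule that)
  have "seminorm D n (g (f x)) \<le> (C * E) * seminorm A l x" if "x \<in> carrier A" for x
    using order.trans[OF C(2) mult_left_mono[OF E(2)[OF that] C(1)]] that assms(1)
    by (simp add: linear_map_closed mult.assoc)
  then show "\<exists>m C. 0 \<le> C \<and> (\<forall>x\<in>carrier A. seminorm D n (g (f x)) \<le> C * seminorm A m x)"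
    using C(1) E(1) by (intro exI[of _ l] exI[of _ "C * E"]) auto
qed

lemma continuous_linear_iff_bounded:
  fixes A :: "('k::real_normed_field, 'a) seminormed_algebra"
  assumes "seminormed_alg A" "seminormed_alg B"
  shows "continuous_linear A B f \<longleftrightarrow> linear_map A B f \<and> bounded_map A B f"
proof -
  interpret A: seminormed_alg A by fact
  interpret B: seminormed_alg B by fact
  have "continuous_map_on A B f \<longleftrightarrow> bounded_map A B f" if f: "linear_map A B f"
  proof
    assume cont: "continuous_map_on A B f"
    show "bounded_map A B f"
      unfolding bounded_map_def
    proof
      fix n
      \<comment> \<open>Continuity is used only at zero and for \<open>e = 1\<close>; homogeneity
        does the rest.\<close>
      obtain m d where d: "d > 0" and fd: "\<And>y. y \<in> carrier A \<Longrightarrow>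
          seminorm A m (y \<ominus>\<^bsub>A\<^esub> \<zero>\<^bsub>A\<^esub>) < d \<Longrightarrow> seminorm B n (f y \<ominus>\<^bsub>B\<^esub> f \<zero>\<^bsub>A\<^esub>) < 1"
        using cont unfolding continuous_map_on_def by (meson A.zero_closed zero_less_one)
      \<comment> \<open>The factor 2 comes from testing at
        \<open>t = d / 2 / seminorm A m x\<close>, which keeps the inequality required of
        \<open>t\<close> strict.\<close>
      have "seminorm B n (f x) \<le> 2 / d * seminorm A m x" if x: "x \<in> carrier A" for x
      proof -
        have *: "t * seminorm B n (f x) < 1" if "0 \<le> t" "t * seminorm A m x < d" for t
        proof -
          have "seminorm A m (of_real t \<odot>\<^bsub>A\<^esub> x) < d"
            using that x by (simp add: A.seminorm_smult)
          then have "seminorm B n (f (of_real t \<odot>\<^bsub>A\<^esub> x)) < 1"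
            using fd[of "of_real t \<odot>\<^bsub>A\<^esub> x"] x linear_map_closed[OF f] linear_map_zero[OF assms f] by
                simp
          then show ?thesis
            using that x linear_map_closed[OF f]
              by (simp add: linear_map_smult[OF f] B.seminorm_smult)
        qed
        show ?thesis
        proof (cases "seminorm A m x = 0")
          case True
          \<comment> \<open>Every \<open>t \<ge> 0\<close> is admissible here, so a non-zero
            seminorm of \<open>f x\<close> could be scaled up to 1.\<close>
          have "seminorm B n (f x) = 0"
          proof (rule ccontr)
            assume "seminorm B n (f x) \<noteq> 0"
            then have "0 < seminorm B n (f x)" 
              using B.seminorm_nonneg[OF linear_map_closed[OF f x], of n] by linarith
            then show False using *[of "1 / seminorm B n (f x)"] True d by simp
          qed
          with True show ?thesis by simp
        next
          case False
          then have "0 < seminorm A m x" using A.seminorm_nonneg[OF x, of m] by linarith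
          then show ?thesis using *[of "d / 2 / seminorm A m x"] d by (simp add: field_simps)
        qed
      qed
      then show "\<exists>m C. 0 \<le> C \<and> (\<forall>x\<in>carrier A. seminorm B n (f x) \<le> C * seminorm A m x)"
        using d by (intro exI[of _ m] exI[of _ "2 / d"]) auto
    qed
  next
    assume bdd: "bounded_map A B f"
    show "continuous_map_on A B f"
      unfolding continuous_map_on_def
    proof (intro ballI allI impI)
      fix x n and e :: real assume x: "x \<in> carrier A" and e: "e > 0"
      obtain m C where C: "0 \<le> C" "\<And>x. x \<in> carrier A \<Longrightarrow> seminorm B n (f x) \<le> C * seminorm A m x"
        by (rule bounded_mapE[OF bdd, of n], rule that)
      \<comment> \<open>The denominator is \<open>C + 1\<close> because \<open>C\<close> may be
        0.\<close>
      have "seminorm B n (f y \<ominus>\<^bsub>B\<^esub> f x) < e" 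
        if y: "y \<in> carrier A" and less: "seminorm A m (y \<ominus>\<^bsub>A\<^esub> x) < e / (C + 1)" for y
      proof -
        have "seminorm B n (f y \<ominus>\<^bsub>B\<^esub> f x) \<le> C * seminorm A m (y \<ominus>\<^bsub>A\<^esub> x)"
          using C(2)[of "y \<ominus>\<^bsub>A\<^esub> x"] x y by (simp add: linear_map_minus[OF assms f])
        also have "\<dots> \<le> (C + 1) * seminorm A m (y \<ominus>\<^bsub>A\<^esub> x)"
          using x y by (intro mult_right_mono) auto
        also have "\<dots> < e" using less C(1) by (simp add: field_simps)
        finally show ?thesis .
      qed
      then show "\<exists>m. \<exists>d>0. \<forall>y\<in>carrier A. seminorm A m (y \<ominus>\<^bsub>A\<^esub> x) < d \<longrightarrow> seminorm B n (f y \<ominus>\<^bsub>B\<^esub> f x) <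
          e"
        using e C(1) by (intro exI[of _ m] exI[of _ "e / (C + 1)"]) auto
    qed
  qed
  then show ?thesis by (auto simp: continuous_linear_def linear_map_def)
qed

lemma bounded_linear_preserves_limits:
  assumes "seminormed_alg A" "seminormed_alg B" "linear_map A B f" "bounded_map A B f"
    and "converges_to A s x" "\<And>i. s i \<in> carrier A" "x \<in> carrier A"
  shows "converges_to B (\<lambda>i. f (s i)) (f x)"
  unfolding converges_to_def
proof
  fix n
  interpret A: seminormed_alg A by fact
  interpret B: seminormed_alg B by fact
  obtain m C where C: "0 \<le> C" "\<And>x. x \<in> carrier A \<Longrightarrow> seminorm B n (f x) \<le> C * seminorm A m x"
    by (rule bounded_mapE[OF assms(4), of n], rule that)
  have "(\<lambda>i. C * seminorm A m (s i \<ominus>\<^bsub>A\<^esub> x)) \<longlonglongrightarrow> 0"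
    using tendsto_mult_right_zero assms(5) by (fastforce simp: converges_to_def)
  then show "(\<lambda>i. seminorm B n (f (s i) \<ominus>\<^bsub>B\<^esub> f x)) \<longlonglongrightarrow> 0"
  proof (rule tendsto_0_le_real)
    show "seminorm B n (f (s i) \<ominus>\<^bsub>B\<^esub> f x) \<le> C * seminorm A m (s i \<ominus>\<^bsub>A\<^esub> x)" for i
      using C(2)[of "s i \<ominus>\<^bsub>A\<^esub> x"] assms by (simp add: linear_map_minus[OF assms(1-3)])
    show "0 \<le> seminorm B n (f (s i) \<ominus>\<^bsub>B\<^esub> f x)" for i
      using assms linear_map_closed[OF assms(3)] by simp
  qed
qed


section \<open>The completion\<close>

lemma cauchy_seqsD: "s \<in> cauchy_seqs A \<Longrightarrow> s i \<in> carrier A"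
  by (simp add: cauchy_seqs_def)

lemma cauchy_seqsE:
  assumes "s \<in> cauchy_seqs A" "0 < e"
  obtains N where "\<And>i j. i \<ge> N \<Longrightarrow> j \<ge> N \<Longrightarrow> seminorm A n (s i \<ominus>\<^bsub>A\<^esub> s j) < e"
  using assms unfolding cauchy_seqs_def by blast

context seminormed_alg
begin

lemma const_cauchy: "x \<in> carrier A \<Longrightarrow> (\<lambda>_. x) \<in> cauchy_seqs A"
  by (auto simp: cauchy_seqs_def)

lemma cauchy_add:
  assumes "s \<in> cauchy_seqs A" "t \<in> cauchy_seqs A" shows "(\<lambda>i. s i \<oplus> t i) \<in> cauchy_seqs A"
  unfolding cauchy_seqs_def
proof (intro CollectI conjI allI impI)
  fix n and e :: real assume "e > 0"
  then have e2: "e / 2 > 0" by simp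
  obtain N where N: "\<And>i j. i \<ge> N \<Longrightarrow> j \<ge> N \<Longrightarrow> seminorm A n (s i \<ominus> s j) < e / 2"
    using cauchy_seqsE[OF assms(1) e2] by blast
  obtain M where M: "\<And>i j. i \<ge> M \<Longrightarrow> j \<ge> M \<Longrightarrow> seminorm A n (t i \<ominus> t j) < e / 2"
    using cauchy_seqsE[OF assms(2) e2] by blast
  show "\<exists>N. \<forall>i\<ge>N. \<forall>j\<ge>N. seminorm A n (s i \<oplus> t i \<ominus> (s j \<oplus> t j)) < e"
  proof (intro exI[of _ "max N M"] allI impI)
    fix i j assume "max N M \<le> i" "max N M \<le> j"
    then show "seminorm A n (s i \<oplus> t i \<ominus> (s j \<oplus> t j)) < e"
      using seminorm_triangle[of "s i \<ominus> s j" "t i \<ominus> t j" n] N[of i j] M[of i j] assms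
      by (simp add: add_minus_add cauchy_seqsD)
  qed
qed (use assms in \<open>auto dest: cauchy_seqsD\<close>)

lemma cauchy_smult:
  assumes "s \<in> cauchy_seqs A" shows "(\<lambda>i. c \<odot> s i) \<in> cauchy_seqs A"
  unfolding cauchy_seqs_def
proof (intro CollectI conjI allI impI)
  fix n and e :: real assume e: "e > 0"
  then have "e / (norm c + 1) > 0" by (simp add: add_nonneg_pos)
  then obtain N where N: "\<And>i j. i \<ge> N \<Longrightarrow> j \<ge> N \<Longrightarrow> seminorm A n (s i \<ominus> s j) < e / (norm c + 1)"
    using assms unfolding cauchy_seqs_def by blast
  have "seminorm A n (c \<odot> s i \<ominus> c \<odot> s j) < e" if "i \<ge> N" "j \<ge> N" for i j
  proof -
    have "seminorm A n (c \<odot> s i \<ominus> c \<odot> s j) = norm c * seminorm A n (s i \<ominus> s j)"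
      using assms by (simp add: cauchy_seqsD seminorm_smult flip: smult_minus_right)
    also have "\<dots> \<le> (norm c + 1) * seminorm A n (s i \<ominus> s j)"
      using assms by (intro mult_right_mono) (auto simp: cauchy_seqsD)
    also have "\<dots> < e"
      using N[OF that] by (simp add: pos_less_divide_eq add_nonneg_pos mult.commute)
    finally show ?thesis .
  qed
  then show "\<exists>N. \<forall>i\<ge>N. \<forall>j\<ge>N. seminorm A n (c \<odot> s i \<ominus> c \<odot> s j) < e" by blast
qed (use assms in \<open>auto dest: cauchy_seqsD\<close>)

text \<open>By the reverse triangle inequality the seminorms form a real Cauchy sequence. Their
  limit becomes the seminorm of the class.\<close>

lemma cauchy_seminorm_convergent:
  assumes "s \<in> cauchy_seqs A" shows "convergent (\<lambda>i. seminorm A n (s i))"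
proof (rule Cauchy_convergent, rule metric_CauchyI)
  fix e :: real assume "e > 0"
  then obtain N where N: "\<And>i j. i \<ge> N \<Longrightarrow> j \<ge> N \<Longrightarrow> seminorm A n (s i \<ominus> s j) < e"
    using assms unfolding cauchy_seqs_def by blast
  have "dist (seminorm A n (s i)) (seminorm A n (s j)) < e" if "i \<ge> N" "j \<ge> N" for i j
    using seminorm_triangle_abs[of "s i" "s j" n] N[OF that] assms
      by (simp add: dist_real_def cauchy_seqsD)
  then show "\<exists>N. \<forall>m\<ge>N. \<forall>k\<ge>N. dist (seminorm A n (s m)) (seminorm A n (s k)) < e" by blast
qed

lemma cauchy_seminorm_bounded:
  assumes "s \<in> cauchy_seqs A"
  obtains C where "C > 0" "\<And>i. seminorm A n (s i) \<le> C"
proof -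
  have "Bseq (\<lambda>i. seminorm A n (s i))"
    using cauchy_seminorm_convergent[OF assms] by (rule convergent_imp_Bseq)
  then obtain C where "C > 0" "\<And>i. norm (seminorm A n (s i)) \<le> C" by (auto simp: Bseq_def)
  then show ?thesis using that[of C] by (simp add: abs_le_iff)
qed

lemma cauchy_mult:
  assumes "s \<in> cauchy_seqs A" "t \<in> cauchy_seqs A" shows "(\<lambda>i. s i \<otimes> t i) \<in> cauchy_seqs A"
  unfolding cauchy_seqs_def
proof (intro CollectI conjI allI impI)
  fix n and e :: real assume e: "e > 0"
  obtain C where C: "C > 0" "\<And>i. seminorm A n (s i) \<le> C"
    using cauchy_seminorm_bounded[OF assms(1), of n] by blast
  obtain D where D: "D > 0" "\<And>i. seminorm A n (t i) \<le> D"
    using cauchy_seminorm_bounded[OF assms(2), of n] by blast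
  \<comment> \<open>These tolerances make each of the two terms of \<open>mult_minus_mult\<close>
    smaller than \<open>e / 2\<close>; the bounds are taken positive to allow the division.\<close>
  have "e / (2 * D) > 0" "e / (2 * C) > 0" using e C D by auto
  note pos = this
  obtain N where N: "\<And>i j. i \<ge> N \<Longrightarrow> j \<ge> N \<Longrightarrow> seminorm A n (s i \<ominus> s j) < e / (2 * D)"
    using cauchy_seqsE[OF assms(1) pos(1)] by blast
  obtain M where M: "\<And>i j. i \<ge> M \<Longrightarrow> j \<ge> M \<Longrightarrow> seminorm A n (t i \<ominus> t j) < e / (2 * C)"
    using cauchy_seqsE[OF assms(2) pos(2)] by blast
  show "\<exists>N. \<forall>i\<ge>N. \<forall>j\<ge>N. seminorm A n (s i \<otimes> t i \<ominus> (s j \<otimes> t j)) < e"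
  proof (intro exI[of _ "max N M"] allI impI)
    fix i j assume ij: "max N M \<le> i" "max N M \<le> j"
    note [simp] = cauchy_seqsD[OF assms(1)] cauchy_seqsD[OF assms(2)]
    have "seminorm A n (s i \<otimes> t i \<ominus> (s j \<otimes> t j))
        \<le> seminorm A n ((s i \<ominus> s j) \<otimes> t i) + seminorm A n (s j \<otimes> (t i \<ominus> t j))"
      by (simp add: mult_minus_mult seminorm_triangle)
    also have "\<dots> \<le> seminorm A n (s i \<ominus> s j) * seminorm A n (t i) + seminorm A n (s j) * seminorm A n
        (t i \<ominus> t j)"
      by (intro add_mono seminorm_mult) auto
    also have "\<dots> \<le> seminorm A n (s i \<ominus> s j) * D + C * seminorm A n (t i \<ominus> t j)"
      using C D by (intro add_mono mult_left_mono mult_right_mono) auto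
    also have "\<dots> < e / (2 * D) * D + C * (e / (2 * C))"
      using N[of i j] M[of i j] ij C D
        by (intro add_strict_mono mult_strict_left_mono mult_strict_right_mono) auto
    also have "\<dots> = e" using C D by (simp add: field_simps)
    finally show "seminorm A n (s i \<otimes> t i \<ominus> (s j \<otimes> t j)) < e" .
  qed
qed (use assms in \<open>auto dest: cauchy_seqsD\<close>)

section \<open>Classes modulo null sequences and their algebra\<close>

lemma null_rel_iff:
  "(s, t) \<in> null_rel A \<longleftrightarrow> s \<in> cauchy_seqs A \<and> t \<in> cauchy_seqs A \<and>
     (\<forall>n. (\<lambda>i. seminorm A n (s i \<ominus> t i)) \<longlonglongrightarrow> 0)"
  by (simp add: null_rel_def)

lemma equiv_null_rel: "equiv (cauchy_seqs A) (null_rel A)"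
proof (rule equivI)
  show "null_rel A \<subseteq> cauchy_seqs A \<times> cauchy_seqs A" by (auto simp: null_rel_def)
  show "refl_on (cauchy_seqs A) (null_rel A)"
    by (auto simp: refl_on_def null_rel_def cauchy_seqsD)
  show "sym (null_rel A)"
    by (auto simp: sym_def null_rel_def cauchy_seqsD seminorm_minus_commute)
  show "trans (null_rel A)"
  proof (rule transI)
    fix r s t assume rs: "(r, s) \<in> null_rel A" and st: "(s, t) \<in> null_rel A"
    have "(\<lambda>i. seminorm A n (r i \<ominus> t i)) \<longlonglongrightarrow> 0" for n
    proof -
      have "(\<lambda>i. seminorm A n (r i \<ominus> s i) + seminorm A n (s i \<ominus> t i)) \<longlonglongrightarrow> 0"
        using tendsto_add[of _ 0 _ _ 0] rs st by (fastforce simp: null_rel_def)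
      then show ?thesis
        by (rule tendsto_0_le_real)
          (use rs st in \<open>auto simp: null_rel_def cauchy_seqsD intro!: seminorm_triangle_minus\<close>)
    qed
    then show "(r, t) \<in> null_rel A" using rs st by (simp add: null_rel_def)
  qed
qed

abbreviation cls :: "(nat \<Rightarrow> 'a) \<Rightarrow> (nat \<Rightarrow> 'a) set" where
  "cls s \<equiv> null_rel A `` {s}"

lemma cls_eq_iff:
  "s \<in> cauchy_seqs A \<Longrightarrow> t \<in> cauchy_seqs A \<Longrightarrow> cls s = cls t \<longleftrightarrow> (s, t) \<in> null_rel A"
  by (rule eq_equiv_class_iff[OF equiv_null_rel])

lemma cls_closed [simp, intro]: "s \<in> cauchy_seqs A \<Longrightarrow> cls s \<in> carrier (completion A)"
  by (simp add: completion_def quotientI)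

lemma completionE:
  assumes "X \<in> carrier (completion A)"
  obtains s where "s \<in> cauchy_seqs A" "X = cls s"
  using assms by (auto simp: completion_def elim: quotientE)

text \<open>The union over all representatives in \<open>completion\<close> collapses to one class
  once that class is known not to depend on them, which is what \<open>congruent2\<close> expresses.
  Products and scalar multiples follow the same pattern.\<close>

lemma add_cls:
  assumes "s \<in> cauchy_seqs A" "t \<in> cauchy_seqs A"
  shows "cls s \<oplus>\<^bsub>completion A\<^esub> cls t = cls (\<lambda>i. s i \<oplus> t i)"
proof -
  have "congruent2 (null_rel A) (null_rel A) (\<lambda>s t. cls (\<lambda>i. s i \<oplus> t i))"
  proof (rule congruent2I')
    fix s s' t t' assume st: "(s, s') \<in> null_rel A" "(t, t') \<in> null_rel A"
    have "(\<lambda>i. seminorm A n (s i \<oplus> t i \<ominus> (s' i \<oplus> t' i))) \<longlonglongrightarrow> 0" for n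
    proof -
      have "(\<lambda>i. seminorm A n (s i \<ominus> s' i) + seminorm A n (t i \<ominus> t' i)) \<longlonglongrightarrow> 0"
        using tendsto_add[of _ 0 _ _ 0] st by (fastforce simp: null_rel_def)
      then show ?thesis
        by (rule tendsto_0_le_real)
          (use st in \<open>auto simp: null_rel_def cauchy_seqsD add_minus_add intro!: seminorm_triangle\<close>)
    qed
    with st show "cls (\<lambda>i. s i \<oplus> t i) = cls (\<lambda>i. s' i \<oplus> t' i)"
      by (subst cls_eq_iff) (auto simp: null_rel_iff cauchy_add)
  qed
  from UN_equiv_class2[OF equiv_null_rel equiv_null_rel this assms] show ?thesis
    by (simp add: completion_def)
qed

lemma mult_cls:
  assumes "s \<in> cauchy_seqs A" "t \<in> cauchy_seqs A"
  shows "cls s \<otimes>\<^bsub>completion A\<^esub> cls t = cls (\<lambda>i. s i \<otimes> t i)"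
proof -
  have "congruent2 (null_rel A) (null_rel A) (\<lambda>s t. cls (\<lambda>i. s i \<otimes> t i))"
  proof (rule congruent2I')
    fix s s' t t' assume st: "(s, s') \<in> null_rel A" "(t, t') \<in> null_rel A"
    have [simp]: "s i \<in> carrier A" "s' i \<in> carrier A" "t i \<in> carrier A" "t' i \<in> carrier A" for i
      using st by (auto simp: null_rel_def cauchy_seqsD)
    have "(\<lambda>i. seminorm A n (s i \<otimes> t i \<ominus> (s' i \<otimes> t' i))) \<longlonglongrightarrow> 0" for n
    proof -
      \<comment> \<open>Cauchy sequences are bounded in each seminorm, so the factor that stays
        fixed in each term cannot spoil the convergence to 0.\<close>
      obtain C where C: "\<And>i. seminorm A n (s' i) \<le> C"
        using cauchy_seminorm_bounded[of s' n] st unfolding null_rel_iff by metis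
      obtain D where D: "\<And>i. seminorm A n (t i) \<le> D"
        using cauchy_seminorm_bounded[of t n] st unfolding null_rel_iff by metis
      have "(\<lambda>i. seminorm A n (s i \<ominus> s' i) * D + C * seminorm A n (t i \<ominus> t' i)) \<longlonglongrightarrow> 0 * D + C * 0"
        using st by (intro tendsto_intros) (auto simp: null_rel_def)
      then have "(\<lambda>i. seminorm A n (s i \<ominus> s' i) * D + C * seminorm A n (t i \<ominus> t' i)) \<longlonglongrightarrow> 0" by simp
      then show ?thesis
      proof (rule tendsto_0_le_real)
        fix i
        have "seminorm A n (s i \<otimes> t i \<ominus> (s' i \<otimes> t' i))
            \<le> seminorm A n ((s i \<ominus> s' i) \<otimes> t i) + seminorm A n (s' i \<otimes> (t i \<ominus> t' i))"
          by (simp add: mult_minus_mult seminorm_triangle)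
        also have "\<dots> \<le> seminorm A n (s i \<ominus> s' i) * seminorm A n (t i) + seminorm A n (s' i) *
            seminorm A n (t i \<ominus> t' i)"
          by (intro add_mono seminorm_mult) auto
        also have "\<dots> \<le> seminorm A n (s i \<ominus> s' i) * D + C * seminorm A n (t i \<ominus> t' i)"
          using C D by (intro add_mono mult_left_mono mult_right_mono) auto
        finally show "seminorm A n (s i \<otimes> t i \<ominus> s' i \<otimes> t' i)
            \<le> seminorm A n (s i \<ominus> s' i) * D + C * seminorm A n (t i \<ominus> t' i)" .
      qed simp
    qed
    with st show "cls (\<lambda>i. s i \<otimes> t i) = cls (\<lambda>i. s' i \<otimes> t' i)"
      by (subst cls_eq_iff) (auto simp: null_rel_iff cauchy_mult)
  qed
  from UN_equiv_class2[OF equiv_null_rel equiv_null_rel this assms] show ?thesis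
    by (simp add: completion_def)
qed

lemma smult_cls:
  assumes "s \<in> cauchy_seqs A"
  shows "c \<odot>\<^bsub>completion A\<^esub> cls s = cls (\<lambda>i. c \<odot> s i)"
proof -
  have "congruent (null_rel A) (\<lambda>s. cls (\<lambda>i. c \<odot> s i))"
  proof (rule congruentI)
    fix s s' assume st: "(s, s') \<in> null_rel A"
    have "(\<lambda>i. seminorm A n (c \<odot> s i \<ominus> c \<odot> s' i)) \<longlonglongrightarrow> 0" for n
    proof -
      have "(\<lambda>i. norm c * seminorm A n (s i \<ominus> s' i)) \<longlonglongrightarrow> 0"
        using tendsto_mult_right_zero st by (fastforce simp: null_rel_def)
      then show ?thesis using st
        by (simp add: null_rel_def cauchy_seqsD seminorm_smult flip: smult_minus_right)
    qed
    with st show "cls (\<lambda>i. c \<odot> s i) = cls (\<lambda>i. c \<odot> s' i)"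
      by (subst cls_eq_iff) (auto simp: null_rel_iff cauchy_smult)
  qed
  from UN_equiv_class[OF equiv_null_rel this assms] show ?thesis
    by (simp add: completion_def)
qed

lemma zero_completion: "\<zero>\<^bsub>completion A\<^esub> = cls (\<lambda>_. \<zero>)"
  and one_completion: "\<one>\<^bsub>completion A\<^esub> = cls (\<lambda>_. \<one>)"
  by (simp_all add: completion_def)

text \<open>Justifies the \<open>THE\<close> in \<open>completion\<close>: the limit exists, and
  adding a null sequence does not change it.\<close>

lemma seminorm_cls:
  assumes "s \<in> cauchy_seqs A"
  shows "(\<lambda>i. seminorm A n (s i)) \<longlonglongrightarrow> seminorm (completion A) n (cls s)"
proof -
  obtain r where r: "(\<lambda>i. seminorm A n (s i)) \<longlonglongrightarrow> r"
    using cauchy_seminorm_convergent[OF assms] by (auto simp: convergent_def)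
  have "(\<lambda>i. seminorm A n (t i)) \<longlonglongrightarrow> r" if "(s, t) \<in> null_rel A" for t
  proof -
    have "(\<lambda>i. seminorm A n (s i \<ominus> t i)) \<longlonglongrightarrow> 0" using that by (simp add: null_rel_def)
    then have "(\<lambda>i. \<bar>seminorm A n (s i) - seminorm A n (t i)\<bar>) \<longlonglongrightarrow> 0"
      by (rule tendsto_0_le_real) (use that in \<open>auto simp: null_rel_def cauchy_seqsD
          seminorm_triangle_abs\<close>)
    then have "(\<lambda>i. seminorm A n (s i) - seminorm A n (t i)) \<longlonglongrightarrow> 0"
      by (simp add: tendsto_rabs_zero_iff)
    from tendsto_diff[OF r this] show ?thesis by simp
  qed
  moreover have "s \<in> cls s" using assms equiv_class_self[OF equiv_null_rel] by blast
  ultimately have "(THE r. \<forall>t\<in>cls s. (\<lambda>i. seminorm A n (t i)) \<longlonglongrightarrow> r) = r"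
    by (intro the_equality) (auto dest: LIMSEQ_unique[OF r])
  then show ?thesis using r by (simp add: completion_def)
qed

text \<open>The algebraic laws hold termwise on representatives, and the seminorm inequalities pass
  to the limit.\<close>

lemma seminormed_alg_completion: "seminormed_alg (completion A)"
proof (rule seminormed_alg.intro)
  let ?K = "completion A"
  note cls_simps = add_cls mult_cls smult_cls zero_completion one_completion const_cauchy cauchy_add
    cauchy_smult cauchy_mult cauchy_seqsD
  have neg: "cls (\<lambda>i. (- 1) \<odot> s i) \<oplus>\<^bsub>?K\<^esub> cls s = \<zero>\<^bsub>?K\<^esub>" if "s \<in> cauchy_seqs A" for s
    by (simp only: add_cls[OF cauchy_smult[OF that] that])
      (simp add: zero_completion smult_neg_one[OF cauchy_seqsD[OF that]] l_neg[OF cauchy_seqsD[OF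
          that]])
  show "ring ?K"
  proof (rule ringI)
    show "abelian_group ?K"
    proof (rule abelian_groupI)
      fix X assume "X \<in> carrier ?K"
      then show "\<exists>Y\<in>carrier ?K. Y \<oplus>\<^bsub>?K\<^esub> X = \<zero>\<^bsub>?K\<^esub>"
        using neg cauchy_smult by (blast elim: completionE)
    qed (auto elim!: completionE simp: cls_simps a_ac)
    show "monoid ?K"
      by (rule monoidI) (auto elim!: completionE simp: cls_simps m_assoc)
  qed (auto elim!: completionE simp: cls_simps l_distr r_distr)
  show "seminormed_alg_axioms ?K"
  proof (unfold_locales, goal_cases)
    case (8 X Y n)
    then obtain s t where [simp]: "X = cls s" "Y = cls t" and st: "s \<in> cauchy_seqs A" "t \<in>
        cauchy_seqs A"
      by (blast elim: completionE)
    show ?case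
      using st LIMSEQ_le[OF seminorm_cls[OF cauchy_add[OF st]] tendsto_add[OF seminorm_cls[OF st(1)]
          seminorm_cls[OF st(2)]]]
      by (simp add: add_cls seminorm_triangle cauchy_seqsD)
  next
    case (9 X n c)
    then obtain s where [simp]: "X = cls s" and s: "s \<in> cauchy_seqs A"
      by (blast elim: completionE)
    show ?case
      using s LIMSEQ_unique[OF seminorm_cls[OF cauchy_smult[OF s]] ] tendsto_mult_left[OF
          seminorm_cls[OF s], of "norm c"]
      by (simp add: smult_cls seminorm_smult cauchy_seqsD)
  next
    case (10 X Y n)
    then obtain s t where [simp]: "X = cls s" "Y = cls t" and st: "s \<in> cauchy_seqs A" "t \<in>
        cauchy_seqs A"
      by (blast elim: completionE)
    show ?case
      using st LIMSEQ_le[OF seminorm_cls[OF cauchy_mult[OF st]] tendsto_mult[OF seminorm_cls[OF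
          st(1)] seminorm_cls[OF st(2)]]]
      by (simp add: mult_cls seminorm_mult cauchy_seqsD)
  next
    case (11 X n)
    then obtain s where [simp]: "X = cls s" and s: "s \<in> cauchy_seqs A"
      by (blast elim: completionE)
    show ?case
      using LIMSEQ_le[OF seminorm_cls[OF s] seminorm_cls[OF s]] s
      by (simp add: seminorm_increasing cauchy_seqsD)
  qed (auto elim!: completionE simp: cls_simps smult_add_left smult_add_right smult_smult
      smult_mult_left smult_mult_right)
qed

section \<open>The canonical map, its density, and completeness\<close>

lemma to_completion_closed [simp]: "x \<in> carrier A \<Longrightarrow> to_completion A x \<in> carrier (completion A)"
  by (simp add: to_completion_def const_cauchy)

lemma linear_to_completion: "linear_map A (completion A) (to_completion A)"
  by (auto simp: linear_map_def to_completion_def const_cauchy add_cls smult_cls)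

lemma to_completion_mult:
  "x \<in> carrier A \<Longrightarrow> y \<in> carrier A \<Longrightarrow>
    to_completion A (x \<otimes> y) = to_completion A x \<otimes>\<^bsub>completion A\<^esub> to_completion A y"
  by (simp add: to_completion_def const_cauchy mult_cls)

lemma to_completion_one: "to_completion A \<one> = \<one>\<^bsub>completion A\<^esub>"
  by (simp add: to_completion_def one_completion)

lemma seminorm_to_completion:
  "x \<in> carrier A \<Longrightarrow> seminorm (completion A) n (to_completion A x) = seminorm A n x"
  using seminorm_cls[OF const_cauchy[of x], of n] by (simp add: to_completion_def LIMSEQ_const_iff)

lemma minus_cls:
  assumes "s \<in> cauchy_seqs A" "t \<in> cauchy_seqs A"
  shows "cls s \<ominus>\<^bsub>completion A\<^esub> cls t = cls (\<lambda>i. s i \<ominus> t i)"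
    and "(\<lambda>i. s i \<ominus> t i) \<in> cauchy_seqs A"
proof -
  interpret K: seminormed_alg "completion A" by (rule seminormed_alg_completion)
  have *: "(\<lambda>i. s i \<oplus> (- 1) \<odot> t i) = (\<lambda>i. s i \<ominus> t i)"
    using assms by (simp add: a_minus_def smult_neg_one cauchy_seqsD)
  show "cls s \<ominus>\<^bsub>completion A\<^esub> cls t = cls (\<lambda>i. s i \<ominus> t i)"
    using assms * by (simp add: a_minus_def[of "completion A"] smult_cls add_cls cauchy_smult flip:
        K.smult_neg_one)
  show "(\<lambda>i. s i \<ominus> t i) \<in> cauchy_seqs A"
    using cauchy_add[OF assms(1) cauchy_smult[OF assms(2), of "- 1"]] * by simp
qed

text \<open>The distance from \<open>s i\<close> to the class of \<open>s\<close> is the limit over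
  \<open>j\<close> of the seminorms of \<open>s i \<ominus> s j\<close>, which the Cauchy condition
  makes small for large \<open>i\<close>.\<close>

lemma to_completion_converges:
  assumes "s \<in> cauchy_seqs A"
  shows "converges_to (completion A) (\<lambda>i. to_completion A (s i)) (cls s)"
  unfolding converges_to_def
proof (intro allI LIMSEQ_I)
  fix n and r :: real assume "r > 0"
  then obtain N where N: "\<And>i j. i \<ge> N \<Longrightarrow> j \<ge> N \<Longrightarrow> seminorm A n (s i \<ominus> s j) < r / 2"
    using assms half_gt_zero[of r] unfolding cauchy_seqs_def by blast
  interpret K: seminormed_alg "completion A" by (rule seminormed_alg_completion)
  have "norm (seminorm (completion A) n (to_completion A (s i) \<ominus>\<^bsub>completion A\<^esub> cls s) - 0) < r"
    if i: "i \<ge> N" for i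
  proof -
    note m = minus_cls[OF const_cauchy[OF cauchy_seqsD[OF assms, of i]] assms]
    \<comment> \<open>Passing to the limit turns the strict bound into a weak one; the bound
      \<open>r / 2\<close> leaves room for the strict inequality wanted.\<close>
    have "seminorm (completion A) n (to_completion A (s i) \<ominus>\<^bsub>completion A\<^esub> cls s) \<le> r / 2"
      unfolding to_completion_def m(1)
      by (rule LIMSEQ_le_const2[OF seminorm_cls[OF m(2)]]) (use N[OF i] in \<open>auto intro:
          less_imp_le\<close>)
    then show ?thesis using \<open>r > 0\<close> assms by (simp add: cauchy_seqsD)
  qed
  then show "\<exists>N. \<forall>i\<ge>N. norm (seminorm (completion A) n (to_completion A (s i) \<ominus>\<^bsub>completion A\<^esub> cls s)
      - 0) < r"
    by blast
qed

lemma completion_approx: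
  assumes "X \<in> carrier (completion A)" "e > 0"
  obtains x where "x \<in> carrier A" "seminorm (completion A) n (X \<ominus>\<^bsub>completion A\<^esub> to_completion A x) <
      e"
proof -
  interpret K: seminormed_alg "completion A" by (rule seminormed_alg_completion)
  obtain s where s: "s \<in> cauchy_seqs A" "X = cls s" using assms by (blast elim: completionE)
  then have "(\<lambda>i. seminorm (completion A) n (to_completion A (s i) \<ominus>\<^bsub>completion A\<^esub> X)) \<longlonglongrightarrow> 0"
    using to_completion_converges by (simp add: converges_to_def)
  then obtain i where "norm (seminorm (completion A) n (to_completion A (s i) \<ominus>\<^bsub>completion A\<^esub> X) -
      0) < e"
    using LIMSEQ_D assms(2) by blast
  then show ?thesis using that[of "s i"] s assms
    by (simp add: cauchy_seqsD K.seminorm_minus_commute)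
qed

text \<open>A class of seminorm 0 consists of null sequences. For completeness, a diagonal sequence
  in \<open>A\<close> approximates \<open>S\<close>, and its own class is the limit of
  \<open>S\<close>.\<close>

theorem frechet_alg_completion: "frechet_alg (completion A)"
proof -
  let ?K = "completion A"
  interpret K: seminormed_alg ?K by (rule seminormed_alg_completion)
  show ?thesis
  proof (unfold_locales, goal_cases)
    case (1 X)
    then obtain s where s: "s \<in> cauchy_seqs A" "X = cls s" by (blast elim: completionE)
    with seminorm_cls[OF s(1)] 1(2) have "(\<lambda>i. seminorm A n (s i)) \<longlonglongrightarrow> 0" for n by metis
    then show ?case unfolding s(2) zero_completion
      using s by (subst cls_eq_iff) (auto simp: null_rel_iff const_cauchy cauchy_seqsD)
  next
    case (2 S)
    then have SC: "S i \<in> carrier ?K" for i by (simp add: cauchy_seqsD)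
    then have "\<exists>x. x \<in> carrier A \<and>
        seminorm ?K i (S i \<ominus>\<^bsub>?K\<^esub> to_completion A x) < 1 / real (Suc i)" for i
      using completion_approx[of "S i" "1 / real (Suc i)" i]
        by (metis zero_less_divide_1_iff of_nat_0_less_iff zero_less_Suc)
    \<comment> \<open>As the seminorms increase, \<open>x\<close> approximates \<open>S\<close> in all of them.\<close>
    then obtain x where xA: "\<And>i. x i \<in> carrier A"
      and x: "\<And>i. seminorm ?K i (S i \<ominus>\<^bsub>?K\<^esub> to_completion A (x i)) < 1 / real (Suc i)" by metis
    have lim0: "(\<lambda>i. seminorm ?K n (S i \<ominus>\<^bsub>?K\<^esub> to_completion A (x i))) \<longlonglongrightarrow> 0" for n
    proof (rule tendsto_sandwich[OF _ _ tendsto_const LIMSEQ_inverse_real_of_nat])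
      have "seminorm ?K n (S i \<ominus>\<^bsub>?K\<^esub> to_completion A (x i)) \<le> inverse (real (Suc i))" if "i \<ge> n" for
          i
        using K.seminorm_mono[OF _ that, of "S i \<ominus>\<^bsub>?K\<^esub> to_completion A (x i)"] x[of i] SC xA
        by (simp add: inverse_eq_divide)
      then show "\<forall>\<^sub>F i in sequentially. seminorm ?K n (S i \<ominus>\<^bsub>?K\<^esub> to_completion A (x i)) \<le> inverse
          (real (Suc i))"
        by (auto simp: eventually_sequentially)
    qed (use SC xA in auto)
    have xc: "x \<in> cauchy_seqs A"
      unfolding cauchy_seqs_def
    proof (intro CollectI conjI allI impI xA)
      fix n and e :: real assume "e > 0"
      then have e3: "e / 3 > 0" by simp
      obtain N where N: "\<And>i j. i \<ge> N \<Longrightarrow> j \<ge> N \<Longrightarrow> seminorm ?K n (S i \<ominus>\<^bsub>?K\<^esub> S j) < e / 3"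
        using 2 e3 unfolding cauchy_seqs_def by blast
      obtain M where M: "\<And>i. i \<ge> M \<Longrightarrow> seminorm ?K n (S i \<ominus>\<^bsub>?K\<^esub> to_completion A (x i)) < e / 3"
        using LIMSEQ_D[OF lim0[of n] e3] SC xA by auto
      show "\<exists>N. \<forall>i\<ge>N. \<forall>j\<ge>N. seminorm A n (x i \<ominus> x j) < e"
      proof (intro exI[of _ "max N M"] allI impI)
        fix i j assume ij: "max N M \<le> i" "max N M \<le> j"
        \<comment> \<open>The canonical map preserves seminorms, so the Cauchy condition can be
          checked in the completion, passing through \<open>S i\<close> and
          \<open>S j\<close>.\<close>
        have "seminorm A n (x i \<ominus> x j) = seminorm ?K n (to_completion A (x i) \<ominus>\<^bsub>?K\<^esub> to_completion A
            (x j))"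
          using xA linear_map_minus[OF seminormed_alg_axioms seminormed_alg_completion
              linear_to_completion]
          by (simp flip: seminorm_to_completion)
        also have "\<dots> \<le> seminorm ?K n (to_completion A (x i) \<ominus>\<^bsub>?K\<^esub> S i) + 
           (seminorm ?K n (S i \<ominus>\<^bsub>?K\<^esub> S j) + seminorm ?K n (S j \<ominus>\<^bsub>?K\<^esub> to_completion A (x j)))"
          using SC xA by (intro order.trans[OF K.seminorm_triangle_minus[of _ "S i"]] add_left_mono
              K.seminorm_triangle_minus) auto
        also have "\<dots> < e"
          using M[of i] M[of j] N[of i j] ij SC xA by (simp add: K.seminorm_minus_commute[of _ "S
              i"])
        finally show "seminorm A n (x i \<ominus> x j) < e" .
      qed
    qed
    have "(\<lambda>i. seminorm ?K n (S i \<ominus>\<^bsub>?K\<^esub> cls x)) \<longlonglongrightarrow> 0" for n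
    proof (rule tendsto_0_le_real)
      show "(\<lambda>i. seminorm ?K n (S i \<ominus>\<^bsub>?K\<^esub> to_completion A (x i)) + seminorm ?K n (to_completion A (x
          i) \<ominus>\<^bsub>?K\<^esub> cls x)) \<longlonglongrightarrow> 0"
        using tendsto_add[OF lim0[of n], of _ 0] to_completion_converges[OF xc]
          by (simp add: converges_to_def)
    qed (use SC xA xc in \<open>auto intro: K.seminorm_triangle_minus\<close>)
    then show ?case using xc by (intro bexI[of _ "cls x"]) auto
  qed
qed

end


section \<open>Extension of maps to the completion\<close>

text \<open>Every class is a limit of images of elements of \<open>A\<close>. Both maps preserve
  this limit, and limits in \<open>B\<close> are unique.\<close>

lemma eq_on_completion:
  assumes "seminormed_alg A" "frechet_alg B"
    and "linear_map (completion A) B f" "bounded_map (completion A) B f"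
    and "linear_map (completion A) B g" "bounded_map (completion A) B g"
    and eq: "\<And>x. x \<in> carrier A \<Longrightarrow> f (to_completion A x) = g (to_completion A x)"
    and X: "X \<in> carrier (completion A)"
  shows "f X = g X"
proof -
  interpret A: seminormed_alg A by fact
  interpret B: frechet_alg B by fact
  interpret K: frechet_alg "completion A" by (rule A.frechet_alg_completion)
  obtain s where s: "s \<in> cauchy_seqs A" "X = null_rel A `` {s}" using X
    by (blast elim: A.completionE)
  have conv: "converges_to (completion A) (\<lambda>i. to_completion A (s i)) X"
    using A.to_completion_converges s by simp
  have "converges_to B (\<lambda>i. f (to_completion A (s i))) (f X)"
    "converges_to B (\<lambda>i. g (to_completion A (s i))) (g X)"
    using bounded_linear_preserves_limits[OF K.seminormed_alg_axioms B.seminormed_alg_axioms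
        assms(3,4) conv]
      bounded_linear_preserves_limits[OF K.seminormed_alg_axioms B.seminormed_alg_axioms assms(5,6)
          conv] s(1) X
    by (simp_all add: cauchy_seqsD)
  then show ?thesis
    using assms s X by (intro B.converges_to_unique[of "\<lambda>i. f (to_completion A (s i))"])
      (auto simp: cauchy_seqsD linear_map_closed)
qed

text \<open>The limit is required along every representative at once, so none has to be chosen. The
  map is extensional because \<open>tensor_lift\<close> and \<open>corresponds\<close> single out
  functions by their values on the carrier.\<close>

definition completion_lift ::
  "('k, 'a) seminormed_algebra \<Rightarrow> ('k, 'b) seminormed_algebra \<Rightarrow> ('a \<Rightarrow> 'b) \<Rightarrow> (nat \<Rightarrow> 'a) set \<Rightarrow> 'b"
      where
  "completion_lift A B f = (\<lambda>X\<in>carrier (completion A).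
     THE b. b \<in> carrier B \<and> (\<forall>s\<in>X. converges_to B (\<lambda>i. f (s i)) b))"

locale bounded_into_frechet = A: seminormed_alg A + B: frechet_alg B
  for A :: "('k::real_normed_field, 'a) seminormed_algebra" and B :: "('k, 'b) seminormed_algebra" +
  fixes f :: "'a \<Rightarrow> 'b"
  assumes linear: "linear_map A B f" and bounded: "bounded_map A B f"
begin

text \<open>A bounded linear map sends Cauchy sequences to Cauchy sequences and null differences to
  null differences. So the image of a representative converges, and its limit depends on the class
  only.\<close>

lemma completion_lift_cls:
  assumes s: "s \<in> cauchy_seqs A"
  shows "completion_lift A B f (A.cls s) \<in> carrier B"
    and "converges_to B (\<lambda>i. f (s i)) (completion_lift A B f (A.cls s))"
proof -
  note minus = linear_map_minus[OF A.seminormed_alg_axioms B.seminormed_alg_axioms linear]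
  have "(\<lambda>i. f (s i)) \<in> cauchy_seqs B"
    unfolding cauchy_seqs_def
  proof (intro CollectI conjI allI impI)
    fix n and e :: real assume e: "e > 0"
    obtain m C where C: "0 \<le> C" "\<And>x. x \<in> carrier A \<Longrightarrow> seminorm B n (f x) \<le> C * seminorm A m x"
      by (rule bounded_mapE[OF bounded, of n], rule that)
    have "e / (C + 1) > 0" using e C by simp
    then obtain N where N: "\<And>i j. i \<ge> N \<Longrightarrow> j \<ge> N \<Longrightarrow> seminorm A m (s i \<ominus>\<^bsub>A\<^esub> s j) < e / (C + 1)"
      using s unfolding cauchy_seqs_def by blast
    have "seminorm B n (f (s i) \<ominus>\<^bsub>B\<^esub> f (s j)) < e" if "i \<ge> N" "j \<ge> N" for i j
    proof -
      have "seminorm B n (f (s i) \<ominus>\<^bsub>B\<^esub> f (s j)) \<le> C * seminorm A m (s i \<ominus>\<^bsub>A\<^esub> s j)"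
        using C(2)[of "s i \<ominus>\<^bsub>A\<^esub> s j"] s by (simp add: minus cauchy_seqsD)
      also have "\<dots> \<le> (C + 1) * seminorm A m (s i \<ominus>\<^bsub>A\<^esub> s j)"
        using s by (intro mult_right_mono) (auto simp: cauchy_seqsD)
      also have "\<dots> < e" using N[OF that] C(1) by (simp add: field_simps)
      finally show ?thesis .
    qed
    then show "\<exists>N. \<forall>i\<ge>N. \<forall>j\<ge>N. seminorm B n (f (s i) \<ominus>\<^bsub>B\<^esub> f (s j)) < e" by blast
  qed (use s in \<open>auto simp: cauchy_seqsD linear_map_closed[OF linear]\<close>)
  then obtain b where b: "b \<in> carrier B" "converges_to B (\<lambda>i. f (s i)) b"
    using B.complete unfolding converges_to_def by blast
  have conv: "converges_to B (\<lambda>i. f (t i)) b" if "(s, t) \<in> null_rel A" for t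
    unfolding converges_to_def
  proof
    fix n
    have [simp]: "s i \<in> carrier A" "t i \<in> carrier A" "f (s i) \<in> carrier B" "f (t i) \<in> carrier B" for
        i
      using that linear_map_closed[OF linear] by (auto simp: null_rel_def cauchy_seqsD)
    obtain m C where C: "0 \<le> C" "\<And>x. x \<in> carrier A \<Longrightarrow> seminorm B n (f x) \<le> C * seminorm A m x"
      by (rule bounded_mapE[OF bounded, of n], rule that)
    have "(\<lambda>i. C * seminorm A m (s i \<ominus>\<^bsub>A\<^esub> t i) + seminorm B n (f (s i) \<ominus>\<^bsub>B\<^esub> b)) \<longlonglongrightarrow> C * 0 + 0"
      using that b(2) by (intro tendsto_intros) (auto simp: null_rel_def converges_to_def)
    then have "(\<lambda>i. C * seminorm A m (s i \<ominus>\<^bsub>A\<^esub> t i) + seminorm B n (f (s i) \<ominus>\<^bsub>B\<^esub> b)) \<longlonglongrightarrow> 0" by simp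
    then show "(\<lambda>i. seminorm B n (f (t i) \<ominus>\<^bsub>B\<^esub> b)) \<longlonglongrightarrow> 0"
    proof (rule tendsto_0_le_real)
      fix i
      show "seminorm B n (f (t i) \<ominus>\<^bsub>B\<^esub> b) \<le> C * seminorm A m (s i \<ominus>\<^bsub>A\<^esub> t i) + seminorm B n (f (s i)
          \<ominus>\<^bsub>B\<^esub> b)"
        using C(2)[of "s i \<ominus>\<^bsub>A\<^esub> t i"] B.seminorm_triangle_minus[of "f (t i)" "f (s i)" b n] b(1)
        by (simp add: minus B.seminorm_minus_commute[of "f (t i)"])
    qed (use b in simp)
  qed
  have self: "s \<in> A.cls s" using s equiv_class_self[OF A.equiv_null_rel] by blast
  have "(THE b. b \<in> carrier B \<and> (\<forall>s\<in>A.cls s. converges_to B (\<lambda>i. f (s i)) b)) = b"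
  proof (rule the_equality)
    fix b' assume "b' \<in> carrier B \<and> (\<forall>s\<in>A.cls s. converges_to B (\<lambda>i. f (s i)) b')"
    then show "b' = b"
      using B.converges_to_unique[OF _ b(2)] b(1) self s
        by (auto simp: cauchy_seqsD linear_map_closed[OF linear])
  qed (use b conv in auto)
  then have "completion_lift A B f (A.cls s) = b" using s by (simp add: completion_lift_def)
  then show "completion_lift A B f (A.cls s) \<in> carrier B"
    and "converges_to B (\<lambda>i. f (s i)) (completion_lift A B f (A.cls s))"
    using b by auto
qed

lemma completion_lift_eqI:
  assumes "s \<in> cauchy_seqs A" "b \<in> carrier B" "converges_to B (\<lambda>i. f (s i)) b"
  shows "completion_lift A B f (A.cls s) = b"
  using B.converges_to_unique[OF completion_lift_cls(2)[OF assms(1)] assms(3)]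
      completion_lift_cls(1) assms
  by (auto simp: cauchy_seqsD linear_map_closed[OF linear])

lemma completion_lift_extensional: "completion_lift A B f \<in> extensional (carrier (completion A))"
  by (simp add: completion_lift_def)

lemma completion_lift_to_completion: "x \<in> carrier A \<Longrightarrow> completion_lift A B f (to_completion A x) = f
    x"
  unfolding to_completion_def
  by (rule completion_lift_eqI)
    (auto simp: A.const_cauchy linear_map_closed[OF linear] converges_to_def)

lemma completion_lift_linear: "linear_map (completion A) B (completion_lift A B f)"
  unfolding linear_map_def
proof (intro conjI ballI allI)
  show "completion_lift A B f \<in> carrier (completion A) \<rightarrow> carrier B"
    by (auto elim!: A.completionE intro: completion_lift_cls)
next
  fix X Y assume "X \<in> carrier (completion A)" "Y \<in> carrier (completion A)"
  then obtain s t where [simp]: "X = A.cls s" "Y = A.cls t" and st: "s \<in> cauchy_seqs A" "t \<in>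
      cauchy_seqs A"
    by (blast elim: A.completionE)
  show "completion_lift A B f (X \<oplus>\<^bsub>completion A\<^esub> Y) = completion_lift A B f X \<oplus>\<^bsub>B\<^esub> completion_lift A
      B f Y"
    using B.converges_to_add[OF completion_lift_cls(2)[OF st(1)] completion_lift_cls(2)[OF st(2)]]
        st
    by (auto simp: A.add_cls A.cauchy_add completion_lift_cls(1) cauchy_seqsD linear_map_closed[OF
        linear]
        linear_map_add[OF linear] intro!: completion_lift_eqI)
next
  fix c X assume "X \<in> carrier (completion A)"
  then obtain s where [simp]: "X = A.cls s" and s: "s \<in> cauchy_seqs A"
    by (blast elim: A.completionE)
  show "completion_lift A B f (c \<odot>\<^bsub>completion A\<^esub> X) = c \<odot>\<^bsub>B\<^esub> completion_lift A B f X"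
    using B.converges_to_smult[OF completion_lift_cls(2)[OF s]] s
    by (auto simp: A.smult_cls A.cauchy_smult completion_lift_cls(1) cauchy_seqsD
        linear_map_closed[OF linear]
        linear_map_smult[OF linear] intro!: completion_lift_eqI)
qed

text \<open>Keeps the constant and the index, which plain boundedness would hide; the bounds for
  coefficients and for tensor lifts rest on this.\<close>

lemma completion_lift_bound:
  assumes "\<And>x. x \<in> carrier A \<Longrightarrow> seminorm B n (f x) \<le> C * seminorm A m x"
    and "X \<in> carrier (completion A)"
  shows "seminorm B n (completion_lift A B f X) \<le> C * seminorm (completion A) m X"
proof -
  obtain s where [simp]: "X = A.cls s" and s: "s \<in> cauchy_seqs A"
    using assms(2) by (blast elim: A.completionE)
  have "(\<lambda>i. seminorm B n (f (s i))) \<longlonglongrightarrow> seminorm B n (completion_lift A B f X)"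
    using completion_lift_cls[OF s] s
      by (auto intro!: B.converges_to_seminorm simp: cauchy_seqsD linear_map_closed[OF linear])
  moreover have "(\<lambda>i. C * seminorm A m (s i)) \<longlonglongrightarrow> C * seminorm (completion A) m X"
    using A.seminorm_cls[OF s] by (intro tendsto_intros) simp
  ultimately show ?thesis
    using assms(1) s by (intro LIMSEQ_le) (auto simp: cauchy_seqsD)
qed

lemma completion_lift_bounded: "bounded_map (completion A) B (completion_lift A B f)"
  unfolding bounded_map_def
proof
  fix n
  obtain m C where C: "0 \<le> C" "\<And>x. x \<in> carrier A \<Longrightarrow> seminorm B n (f x) \<le> C * seminorm A m x"
    by (rule bounded_mapE[OF bounded, of n], rule that)
  then show "\<exists>m C. 0 \<le> C \<and> (\<forall>X\<in>carrier (completion A). seminorm B n (completion_lift A B f X) \<le> C *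
      seminorm (completion A) m X)"
    using completion_lift_bound by blast
qed

lemma completion_lift_ring_hom:
  assumes "f \<in> ring_hom A B"
  shows "completion_lift A B f \<in> ring_hom (completion A) B"
proof (rule ring_hom_memI)
  show "completion_lift A B f \<one>\<^bsub>completion A\<^esub> = \<one>\<^bsub>B\<^esub>"
    using completion_lift_to_completion[of "\<one>\<^bsub>A\<^esub>"] ring_hom_one[OF assms]
      by (simp add: A.to_completion_one)
next
  fix X Y assume "X \<in> carrier (completion A)" "Y \<in> carrier (completion A)"
  then obtain s t where [simp]: "X = A.cls s" "Y = A.cls t" and st: "s \<in> cauchy_seqs A" "t \<in>
      cauchy_seqs A"
    by (blast elim: A.completionE)
  show "completion_lift A B f (X \<otimes>\<^bsub>completion A\<^esub> Y) = completion_lift A B f X \<otimes>\<^bsub>B\<^esub> completion_lift A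
      B f Y"
    using B.converges_to_mult[OF completion_lift_cls(2)[OF st(1)] completion_lift_cls(2)[OF st(2)]]
        st
    by (auto simp: A.mult_cls A.cauchy_mult completion_lift_cls(1) cauchy_seqsD linear_map_closed[OF
        linear]
        ring_hom_mult[OF assms] intro!: completion_lift_eqI)
qed (use completion_lift_linear in \<open>auto simp: linear_map_closed linear_map_add\<close>)

end


section \<open>Monoid algebras\<close>

lemma lookup_pm_scale [simp]: "Poly_Mapping.lookup (pm_scale c u) x = c * Poly_Mapping.lookup u x"
  by (simp add: pm_scale_def Poly_Mapping.map.rep_eq when_def)

lemma keys_pm_scale: "Poly_Mapping.keys (pm_scale c u) \<subseteq> Poly_Mapping.keys u"
  by (auto simp: in_keys_iff)

lemma keys_minus: "Poly_Mapping.keys (u - v) \<subseteq> Poly_Mapping.keys u \<union> Poly_Mapping.keys v"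
  by (auto simp: in_keys_iff lookup_minus)

lemma pm_scale_single [simp]: "pm_scale c (Poly_Mapping.single x d) = Poly_Mapping.single x (c * d)"
  by (rule poly_mapping_eqI) (simp add: lookup_single when_def)

lemma module_pm_scale: "Modules.module (pm_scale :: 'k::real_normed_field \<Rightarrow> ('x \<Rightarrow>\<^sub>0 'k) \<Rightarrow> _)"
  by unfold_locales (auto intro!: poly_mapping_eqI simp: lookup_add algebra_simps)

interpretation pm: Modules.module "pm_scale :: 'k::real_normed_field \<Rightarrow> ('x \<Rightarrow>\<^sub>0 'k) \<Rightarrow> _"
  by (rule module_pm_scale)

lemma poly_mapping_eq_sum_single:
  "u = (\<Sum>x\<in>Poly_Mapping.keys u. Poly_Mapping.single x (Poly_Mapping.lookup u x))"
  by (rule poly_mapping_eqI) (simp add: lookup_sum lookup_single when_def sum.delta in_keys_iff)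

text \<open>A finitely supported function is the sum of its monomials. This rule reduces multilinear
  identities in a monoid algebra to basis elements without losing the condition on the
  support.\<close>

lemma poly_mapping_keys_induct [consumes 1, case_names zero add single]:
  fixes u :: "'x \<Rightarrow>\<^sub>0 'k::comm_monoid_add"
  assumes "Poly_Mapping.keys u \<subseteq> M"
    and "P 0"
    and "\<And>u v. Poly_Mapping.keys u \<subseteq> M \<Longrightarrow> Poly_Mapping.keys v \<subseteq> M \<Longrightarrow> P u \<Longrightarrow> P v \<Longrightarrow> P (u + v)"
    and "\<And>x c. x \<in> M \<Longrightarrow> P (Poly_Mapping.single x c)"
  shows "P u"
proof -
  \<comment> \<open>The support condition is part of the claim because the hypothesis on sums asks
    for it in both summands.\<close>
  have "Poly_Mapping.keys (\<Sum>x\<in>X. Poly_Mapping.single x (Poly_Mapping.lookup u x)) \<subseteq> M \<and>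
      P (\<Sum>x\<in>X. Poly_Mapping.single x (Poly_Mapping.lookup u x))" if "finite X" "X \<subseteq> M" for X
    using that
  proof (induction X)
    case (insert x X)
    have "Poly_Mapping.keys (Poly_Mapping.single x (Poly_Mapping.lookup u x)) \<subseteq> M"
      using insert.prems by simp
    with insert show ?case
      by (auto intro!: assms(3,4) dest!: subsetD[OF keys_add])
  qed (simp add: assms(2))
  from this[OF finite_keys assms(1)] show ?thesis
    unfolding poly_mapping_eq_sum_single[of u, symmetric] by simp
qed

section \<open>Convolution and monoid algebras\<close>

definition convolution :: "('x, 'm) monoid_scheme \<Rightarrow> ('x \<Rightarrow>\<^sub>0 'k::real_normed_field) \<Rightarrow> ('x \<Rightarrow>\<^sub>0 'k) \<Rightarrow>
    ('x \<Rightarrow>\<^sub>0 'k)" where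
  "convolution M u v = (\<Sum>x\<in>Poly_Mapping.keys u. \<Sum>y\<in>Poly_Mapping.keys v.
     Poly_Mapping.single (x \<otimes>\<^bsub>M\<^esub> y) (Poly_Mapping.lookup u x * Poly_Mapping.lookup v y))"

lemma monoid_algebra_simps [simp]:
  "carrier (monoid_algebra M p) = {u. Poly_Mapping.keys u \<subseteq> carrier M}"
  "mult (monoid_algebra M p) = convolution M"
  "one (monoid_algebra M p) = Poly_Mapping.single \<one>\<^bsub>M\<^esub> 1"
  "zero (monoid_algebra M p) = 0"
  "add (monoid_algebra M p) = (+)"
  "smult (monoid_algebra M p) = pm_scale"
  "seminorm (monoid_algebra M p) = p"
  by (simp_all add: monoid_algebra_def convolution_def fun_eq_iff)

text \<open>Cancellation can shrink the support of a sum. Summing over a common larger index set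
  makes additivity a termwise identity.\<close>

lemma convolution_superset:
  assumes "finite X" "Poly_Mapping.keys u \<subseteq> X" "finite Y" "Poly_Mapping.keys v \<subseteq> Y"
  shows "convolution M u v = (\<Sum>x\<in>X. \<Sum>y\<in>Y.
     Poly_Mapping.single (x \<otimes>\<^bsub>M\<^esub> y) (Poly_Mapping.lookup u x * Poly_Mapping.lookup v y))"
proof -
  have "(\<Sum>y\<in>Poly_Mapping.keys v. Poly_Mapping.single (x \<otimes>\<^bsub>M\<^esub> y) (Poly_Mapping.lookup u x *
      Poly_Mapping.lookup v y))
    = (\<Sum>y\<in>Y. Poly_Mapping.single (x \<otimes>\<^bsub>M\<^esub> y) (Poly_Mapping.lookup u x * Poly_Mapping.lookup v y))"
        for x
    using assms by (intro sum.mono_neutral_left) (auto simp: in_keys_iff)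
  then show ?thesis
    unfolding convolution_def using assms by (auto intro!: sum.mono_neutral_left simp: in_keys_iff)
qed

lemma convolution_add_left: "convolution M (u + u') v = convolution M u v + convolution M u' v"
proof -
  let ?X = "Poly_Mapping.keys u \<union> Poly_Mapping.keys u'"
  have "Poly_Mapping.keys (u + u') \<subseteq> ?X" by (rule keys_add)
  then show ?thesis
    by (simp add: convolution_superset[of ?X _ "Poly_Mapping.keys v"] lookup_add distrib_right
        single_add sum.distrib)
qed

lemma convolution_add_right: "convolution M u (v + v') = convolution M u v + convolution M u v'"
proof -
  let ?Y = "Poly_Mapping.keys v \<union> Poly_Mapping.keys v'"
  have "Poly_Mapping.keys (v + v') \<subseteq> ?Y" by (rule keys_add)
  then show ?thesis
    by (simp add: convolution_superset[of "Poly_Mapping.keys u" _ ?Y] lookup_add distrib_left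
        single_add sum.distrib)
qed

lemma convolution_zero [simp]: "convolution M 0 v = 0" "convolution M u 0 = 0"
  by (simp_all add: convolution_def)

lemma convolution_minus_left: "convolution M (u - u') v = convolution M u v - convolution M u' v"
  using convolution_add_left[of M "u - u'" u' v] by (simp add: algebra_simps)

lemma convolution_minus_right: "convolution M u (v - v') = convolution M u v - convolution M u v'"
  using convolution_add_right[of M u "v - v'" v'] by (simp add: algebra_simps)

lemma convolution_single [simp]:
  "convolution M (Poly_Mapping.single x c) (Poly_Mapping.single y d) = Poly_Mapping.single (x \<otimes>\<^bsub>M\<^esub>
      y) (c * d)"
  by (cases "c = 0"; cases "d = 0") (simp_all add: convolution_def)

lemma convolution_scale_left: "convolution M (pm_scale c u) v = pm_scale c (convolution M u v)"
proof -
  have "convolution M (pm_scale c u) v = (\<Sum>x\<in>Poly_Mapping.keys u. \<Sum>y\<in>Poly_Mapping.keys v.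
     Poly_Mapping.single (x \<otimes>\<^bsub>M\<^esub> y) (Poly_Mapping.lookup (pm_scale c u) x * Poly_Mapping.lookup v
         y))"
    by (rule convolution_superset) (simp_all add: keys_pm_scale)
  then show ?thesis by (simp add: convolution_def pm.scale_sum_right mult.assoc)
qed

lemma convolution_scale_right: "convolution M u (pm_scale c v) = pm_scale c (convolution M u v)"
proof -
  have "convolution M u (pm_scale c v) = (\<Sum>x\<in>Poly_Mapping.keys u. \<Sum>y\<in>Poly_Mapping.keys v.
     Poly_Mapping.single (x \<otimes>\<^bsub>M\<^esub> y) (Poly_Mapping.lookup u x * Poly_Mapping.lookup (pm_scale c v)
         y))"
    by (rule convolution_superset) (simp_all add: keys_pm_scale)
  then show ?thesis by (simp add: convolution_def pm.scale_sum_right mult.left_commute)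
qed

lemma keys_sum_subset: "(\<And>x. x \<in> X \<Longrightarrow> Poly_Mapping.keys (f x) \<subseteq> M) \<Longrightarrow> Poly_Mapping.keys (sum f X) \<subseteq> M"
  by (induction X rule: infinite_finite_induct) (auto dest!: subsetD[OF keys_add])

context monoid
begin

lemma keys_convolution:
  assumes "Poly_Mapping.keys u \<subseteq> carrier G" "Poly_Mapping.keys v \<subseteq> carrier G"
  shows "Poly_Mapping.keys (convolution G u v) \<subseteq> carrier G"
  unfolding convolution_def using assms
  by (intro keys_sum_subset) (auto split: if_splits)

lemma convolution_assoc:
  assumes "Poly_Mapping.keys u \<subseteq> carrier G" "Poly_Mapping.keys v \<subseteq> carrier G" "Poly_Mapping.keys w \<subseteq>
      carrier G"
  shows "convolution G (convolution G u v) w = convolution G u (convolution G v w)"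
  using assms(1)
proof (induction u rule: poly_mapping_keys_induct)
  case (single x c)
  note x = single
  show ?case using assms(2)
  proof (induction v rule: poly_mapping_keys_induct)
    case (single y d)
    note y = single
    show ?case using assms(3)
      by (induction w rule: poly_mapping_keys_induct)
        (simp_all add: convolution_add_right m_assoc x y mult.assoc)
  qed (simp_all add: convolution_add_left convolution_add_right)
qed (simp_all add: convolution_add_left)

lemma convolution_one:
  assumes "Poly_Mapping.keys u \<subseteq> carrier G"
  shows "convolution G (Poly_Mapping.single \<one> 1) u = u" "convolution G u (Poly_Mapping.single \<one> 1) =
      u"
  using assms by (induction u rule: poly_mapping_keys_induct)
    (simp_all add: convolution_add_left convolution_add_right)

text \<open>The ring and scalar laws come from convolution alone, so only these four properties of
  the seminorms remain to be checked for the group algebra and for the formal tensors.\<close>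

lemma seminormed_alg_monoid_algebra:
  fixes p :: "nat \<Rightarrow> ('a \<Rightarrow>\<^sub>0 'k::real_normed_field) \<Rightarrow> real"
  assumes "\<And>n u v. Poly_Mapping.keys u \<subseteq> carrier G \<Longrightarrow> Poly_Mapping.keys v \<subseteq> carrier G \<Longrightarrow> p n (u + v) \<le>
      p n u + p n v"
    and "\<And>n c u. Poly_Mapping.keys u \<subseteq> carrier G \<Longrightarrow> p n (pm_scale c u) = norm c * p n u"
    and "\<And>n u v. Poly_Mapping.keys u \<subseteq> carrier G \<Longrightarrow> Poly_Mapping.keys v \<subseteq> carrier G \<Longrightarrow>
      p n (convolution G u v) \<le> p n u * p n v"
    and "\<And>n u. Poly_Mapping.keys u \<subseteq> carrier G \<Longrightarrow> p n u \<le> p (Suc n) u"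
  shows "seminormed_alg (monoid_algebra G p)"
proof (rule seminormed_alg.intro)
  have keys_add': "Poly_Mapping.keys (u + v) \<subseteq> carrier G"
    if "Poly_Mapping.keys u \<subseteq> carrier G" "Poly_Mapping.keys v \<subseteq> carrier G" for u v :: "'a \<Rightarrow>\<^sub>0 'k"
    using that keys_add[of u v] by blast
  show "ring (monoid_algebra G p)"
  proof (rule ringI)
    show "abelian_group (monoid_algebra G p)"
    proof (rule abelian_groupI)
      fix u assume "u \<in> carrier (monoid_algebra G p)"
      then show "\<exists>v\<in>carrier (monoid_algebra G p). v \<oplus>\<^bsub>monoid_algebra G p\<^esub> u = \<zero>\<^bsub>monoid_algebra G p\<^esub>"
        by (intro bexI[of _ "- u"]) (auto simp: in_keys_iff)
    qed (simp_all add: keys_add' add_ac)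
    show "Group.monoid (monoid_algebra G p)"
      by (rule monoidI) (simp_all add: keys_convolution convolution_assoc convolution_one)
  qed (simp_all add: convolution_add_left convolution_add_right)
  show "seminormed_alg_axioms (monoid_algebra G p)"
  proof (unfold_locales, goal_cases)
    case (1 u c)
    then show ?case using keys_pm_scale[of c u] by auto
  qed (simp_all add: assms pm.scale_left_distrib pm.scale_right_distrib convolution_scale_left
      convolution_scale_right)
qed

end

text \<open>Reconciles the difference derived from the ring structure with the pointwise
  one.\<close>

lemma minus_monoid_algebra:
  assumes "seminormed_alg (monoid_algebra M p)" "Poly_Mapping.keys u \<subseteq> carrier M" "Poly_Mapping.keys
      v \<subseteq> carrier M"
  shows "u \<ominus>\<^bsub>monoid_algebra M p\<^esub> v = u - v"
proof -
  interpret seminormed_alg "monoid_algebra M p" by fact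
  have "\<ominus>\<^bsub>monoid_algebra M p\<^esub> v = - v"
    using assms(3) by (intro minus_equality) (auto simp: in_keys_iff)
  then show ?thesis by (simp add: a_minus_def)
qed


section \<open>Linear extension from the basis\<close>

definition linear_ext :: "('k::real_normed_field, 'b) seminormed_algebra \<Rightarrow> ('x \<Rightarrow> 'b) \<Rightarrow> ('x \<Rightarrow>\<^sub>0 'k) \<Rightarrow>
    'b" where
  "linear_ext B f u = (\<Oplus>\<^bsub>B\<^esub>x\<in>Poly_Mapping.keys u. Poly_Mapping.lookup u x \<odot>\<^bsub>B\<^esub> f x)"

context seminormed_alg
begin

lemma linear_ext_superset:
  assumes "finite X" "Poly_Mapping.keys u \<subseteq> X" "f \<in> X \<rightarrow> carrier A"
  shows "linear_ext A f u = (\<Oplus>x\<in>X. Poly_Mapping.lookup u x \<odot> f x)"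
  unfolding linear_ext_def using assms
  by (intro add.finprod_mono_neutral_cong_left) (auto simp: in_keys_iff Pi_iff)

lemma linear_ext_closed:
  "f \<in> Poly_Mapping.keys u \<rightarrow> carrier A \<Longrightarrow> linear_ext A f u \<in> carrier A"
  unfolding linear_ext_def by (intro finsum_closed) auto

lemma linear_ext_add:
  assumes "f \<in> M \<rightarrow> carrier A" "Poly_Mapping.keys u \<subseteq> M" "Poly_Mapping.keys v \<subseteq> M"
  shows "linear_ext A f (u + v) = linear_ext A f u \<oplus> linear_ext A f v"
proof -
  let ?X = "Poly_Mapping.keys u \<union> Poly_Mapping.keys v"
  have f: "f x \<in> carrier A" if "x \<in> ?X" for x using assms that by blast
  have "Poly_Mapping.keys (u + v) \<subseteq> ?X" by (rule keys_add)
  then have "linear_ext A f (u + v) = (\<Oplus>x\<in>?X. Poly_Mapping.lookup (u + v) x \<odot> f x)"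
    using f by (intro linear_ext_superset) auto
  also have "\<dots> = (\<Oplus>x\<in>?X. Poly_Mapping.lookup u x \<odot> f x \<oplus> Poly_Mapping.lookup v x \<odot> f x)"
    using f by (intro finsum_cong') (auto simp: lookup_add smult_add_left)
  also have "\<dots> = linear_ext A f u \<oplus> linear_ext A f v"
    using f linear_ext_superset[of ?X u f] linear_ext_superset[of ?X v f]
      by (simp add: finsum_addf Pi_iff)
  finally show ?thesis .
qed

lemma linear_ext_zero [simp]: "linear_ext A f 0 = \<zero>"
  by (simp add: linear_ext_def)

lemma linear_ext_single [simp]:
  "f x \<in> carrier A \<Longrightarrow> linear_ext A f (Poly_Mapping.single x c) = c \<odot> f x"
  by (cases "c = 0") (simp_all add: linear_ext_def)

lemma linear_ext_scale:
  assumes "f \<in> M \<rightarrow> carrier A" "Poly_Mapping.keys u \<subseteq> M"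
  shows "linear_ext A f (pm_scale c u) = c \<odot> linear_ext A f u"
  using assms(2)
proof (induction u rule: poly_mapping_keys_induct)
  case (add u v)
  have "linear_ext A f u \<in> carrier A" "linear_ext A f v \<in> carrier A"
    using add assms(1) by (auto intro!: linear_ext_closed)
  moreover have "Poly_Mapping.keys (pm_scale c u) \<subseteq> M" "Poly_Mapping.keys (pm_scale c v) \<subseteq> M"
    by (rule order.trans[OF keys_pm_scale], rule add)+
  ultimately show ?case
    using add assms(1) by (simp add: linear_ext_add[of f M] pm.scale_right_distrib smult_add_right)
next
  case (single x d)
  then have "f x \<in> carrier A" using assms(1) by auto
  then show ?case by (simp add: smult_smult)
qed simp

lemma linear_map_linear_ext:
  assumes "f \<in> carrier M \<rightarrow> carrier A"
  shows "linear_map (monoid_algebra M p) A (linear_ext A f)"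
proof -
  have "linear_ext A f u \<in> carrier A" if "Poly_Mapping.keys u \<subseteq> carrier M" for u
    using that assms by (intro linear_ext_closed) auto
  then show ?thesis
    using linear_ext_add[OF assms] linear_ext_scale[OF assms] by (simp add: linear_map_def)
qed

lemma seminorm_linear_ext_le:
  assumes "f \<in> Poly_Mapping.keys u \<rightarrow> carrier A"
  shows "seminorm A n (linear_ext A f u) \<le> (\<Sum>x\<in>Poly_Mapping.keys u. norm (Poly_Mapping.lookup u x) *
      seminorm A n (f x))"
proof -
  have "seminorm A n (\<Oplus>x\<in>X. g x) \<le> (\<Sum>x\<in>X. seminorm A n (g x))" if "finite X" "g \<in> X \<rightarrow> carrier A" for
      X and g :: "'c \<Rightarrow> 'a"
    using that
  proof (induction X)
    case (insert x X)
    then have "seminorm A n (\<Oplus>x\<in>insert x X. g x) \<le> seminorm A n (g x) + seminorm A n (\<Oplus>x\<in>X. g x)"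
      by (simp add: seminorm_triangle finsum_closed)
    with insert show ?case by simp
  qed simp
  from this[of "Poly_Mapping.keys u" "\<lambda>x. Poly_Mapping.lookup u x \<odot> f x"] show ?thesis
    using assms unfolding linear_ext_def by (simp add: Pi_iff seminorm_smult)
qed

text \<open>Both sides of the product law are bilinear, so two nested inductions reduce it to basis
  elements, where it is multiplicativity of \<open>f\<close>.\<close>

lemma linear_ext_ring_hom:
  assumes "Group.monoid M" and f: "f \<in> carrier M \<rightarrow> carrier A"
    and mult: "\<And>x y. x \<in> carrier M \<Longrightarrow> y \<in> carrier M \<Longrightarrow> f (x \<otimes>\<^bsub>M\<^esub> y) = f x \<otimes> f y"
    and one: "f \<one>\<^bsub>M\<^esub> = \<one>"
  shows "linear_ext A f \<in> ring_hom (monoid_algebra M p) A"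
proof (rule ring_hom_memI)
  interpret M: Group.monoid M by fact
  fix u v assume "u \<in> carrier (monoid_algebra M p)" "v \<in> carrier (monoid_algebra M p)"
  then have u: "Poly_Mapping.keys u \<subseteq> carrier M" and v: "Poly_Mapping.keys v \<subseteq> carrier M" by
      simp_all
  have cl: "linear_ext A f w \<in> carrier A" if "Poly_Mapping.keys w \<subseteq> carrier M" for w
    using that f by (auto intro!: linear_ext_closed)
  from u have "linear_ext A f (convolution M u v) = linear_ext A f u \<otimes> linear_ext A f v"
  proof (induction u rule: poly_mapping_keys_induct)
    case zero
    show ?case using cl[OF v] by simp
  next
    case (add u u')
    then show ?case using cl[OF v] v
      by (simp add: convolution_add_left linear_ext_add[OF f] M.keys_convolution l_distr cl)
  next
    case (single x c)
    then have x: "x \<in> carrier M" "f x \<in> carrier A" using f by auto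
    then have kx: "Poly_Mapping.keys (Poly_Mapping.single x c) \<subseteq> carrier M" by simp
    from v show ?case
    proof (induction v rule: poly_mapping_keys_induct)
      case zero
      show ?case using x by simp
    next
      case (add v v')
      then show ?case using x
        by (simp add: convolution_add_right linear_ext_add[OF f] M.keys_convolution[OF kx] r_distr
            cl)
    next
      case (single y d)
      then have "f y \<in> carrier A" using f by auto
      with single x show ?case
        by (simp add: mult smult_mult_left smult_mult_right mult.commute[of c d] flip: smult_smult)
    qed
  qed
  then show "linear_ext A f (u \<otimes>\<^bsub>monoid_algebra M p\<^esub> v) = linear_ext A f u \<otimes> linear_ext A f v" by
      simp
next
  interpret M: Group.monoid M by fact
  show "linear_ext A f \<one>\<^bsub>monoid_algebra M p\<^esub> = \<one>" by (simp add: one)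
qed (use linear_map_linear_ext[OF f, of p] in \<open>simp_all add: linear_map_def Pi_iff\<close>)

end

lemma linear_eq_on_monoid_algebra:
  assumes "seminormed_alg (monoid_algebra M p)" "seminormed_alg B"
    and "linear_map (monoid_algebra M p) B f" "linear_map (monoid_algebra M p) B g"
    and "\<And>x. x \<in> carrier M \<Longrightarrow> f (Poly_Mapping.single x 1) = g (Poly_Mapping.single x 1)"
    and "Poly_Mapping.keys u \<subseteq> carrier M"
  shows "f u = g u"
  using assms(6)
proof (induction u rule: poly_mapping_keys_induct)
  case zero
  then show ?case
    using linear_map_zero[OF assms(1-3)] linear_map_zero[OF assms(1,2,4)] by simp
next
  case (add u v)
  then show ?case
    using linear_map_add[OF assms(3), of u v] linear_map_add[OF assms(4), of u v] by simp
next
  case (single x c)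
  then show ?case
    using linear_map_smult[OF assms(3), of "Poly_Mapping.single x 1" c] linear_map_smult[OF
        assms(4), of "Poly_Mapping.single x 1" c] assms(5)
    by simp
qed

text \<open>The span of the basis is dense. Specialised once to pure tensors and once to the image
  of \<Gamma>, this is the uniqueness principle of the whole development.\<close>

lemma eq_on_completed_monoid_algebra:
  assumes "seminormed_alg (monoid_algebra M p)" "frechet_alg B"
    and "linear_map (completion (monoid_algebra M p)) B f" "bounded_map (completion (monoid_algebra
        M p)) B f"
    and "linear_map (completion (monoid_algebra M p)) B g" "bounded_map (completion (monoid_algebra
        M p)) B g"
    and "\<And>x. x \<in> carrier M \<Longrightarrow> f (to_completion (monoid_algebra M p) (Poly_Mapping.single x 1))
      = g (to_completion (monoid_algebra M p) (Poly_Mapping.single x 1))"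
    and "X \<in> carrier (completion (monoid_algebra M p))"
  shows "f X = g X"
proof (rule eq_on_completion[OF assms(1-6) _ assms(8)])
  interpret seminormed_alg "monoid_algebra M p" by fact
  interpret B: frechet_alg B by fact
  fix u assume "u \<in> carrier (monoid_algebra M p)"
  then show "f (to_completion (monoid_algebra M p) u) = g (to_completion (monoid_algebra M p) u)"
    using linear_eq_on_monoid_algebra[OF assms(1) B.seminormed_alg_axioms
        linear_map_comp[OF linear_to_completion assms(3)] linear_map_comp[OF linear_to_completion
            assms(5)] assms(7)]
    by simp
qed


section \<open>Projective tensor products\<close>

text \<open>Here \<open>rep\<close> refers to writing a tensor as a sum of pairs, not to group
  representations. The lists carry no coefficients because a scalar can be absorbed into a
  factor.\<close>

definition tensor_rep_list ::
  "('k::real_normed_field, 'a) seminormed_algebra \<Rightarrow> ('k, 'b) seminormed_algebra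
     \<Rightarrow> ('a \<times> 'b \<Rightarrow>\<^sub>0 'k) \<Rightarrow> ('a \<times> 'b) list \<Rightarrow> bool" where
  "tensor_rep_list A B u l \<longleftrightarrow> set l \<subseteq> carrier A \<times> carrier B \<and>
     u - (\<Sum>(a, b)\<leftarrow>l. Poly_Mapping.single (a, b) 1) \<in> pm.span (tensor_relations A B)"

abbreviation tensor_cost ::
  "('k::real_normed_field, 'a) seminormed_algebra \<Rightarrow> ('k, 'b) seminormed_algebra
     \<Rightarrow> nat \<Rightarrow> ('a \<times> 'b) list \<Rightarrow> real" where
  "tensor_cost A B n l \<equiv> (\<Sum>(a, b)\<leftarrow>l. seminorm A n a * seminorm B n b)"

lemma projective_seminorm_eq:
  "projective_seminorm A B n u = Inf (tensor_cost A B n ` {l. tensor_rep_list A B u l})"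
  unfolding projective_seminorm_def tensor_rep_list_def by (rule arg_cong[of _ _ Inf]) blast

definition bilinear_map ::
  "('k::real_normed_field, 'a) seminormed_algebra \<Rightarrow> ('k, 'b) seminormed_algebra
     \<Rightarrow> ('k, 'f) seminormed_algebra \<Rightarrow> ('a \<Rightarrow> 'b \<Rightarrow> 'f) \<Rightarrow> bool" where
  "bilinear_map A B F \<beta> \<longleftrightarrow> (\<forall>a\<in>carrier A. linear_map B F (\<beta> a)) \<and>
     (\<forall>b\<in>carrier B. linear_map A F (\<lambda>a. \<beta> a b))"

text \<open>The same index \<open>m\<close> on both factors matches
  \<open>projective_seminorm\<close>, which pairs seminorms of equal index.\<close>

definition bilinear_bound ::
  "('k::real_normed_field, 'a) seminormed_algebra \<Rightarrow> ('k, 'b) seminormed_algebra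
     \<Rightarrow> ('k, 'f) seminormed_algebra \<Rightarrow> ('a \<Rightarrow> 'b \<Rightarrow> 'f) \<Rightarrow> nat \<Rightarrow> nat \<Rightarrow> real \<Rightarrow> bool" where
  "bilinear_bound A B F \<beta> n m C \<longleftrightarrow> 0 \<le> C \<and>
     (\<forall>a\<in>carrier A. \<forall>b\<in>carrier B. seminorm F n (\<beta> a b) \<le> C * (seminorm A m a * seminorm B m b))"

section \<open>The ideal of tensor relations\<close>

locale tensor_factors = A: seminormed_alg A + B: seminormed_alg B
  for A :: "('k::real_normed_field, 'a) seminormed_algebra" and B :: "('k, 'b) seminormed_algebra"
begin

abbreviation "V \<equiv> pm.span (tensor_relations A B)"

abbreviation "T \<equiv> formal_tensor A B"

abbreviation (input) "C \<equiv> carrier A \<times> carrier B"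

text \<open>The defining relations have coefficient 1. An arbitrary \<open>c\<close> is gained by
  scaling in the span and is needed when a relation is multiplied by a monomial.\<close>

lemma relation_add_left:
  assumes "a \<in> carrier A" "a' \<in> carrier A" "b \<in> carrier B"
  shows "Poly_Mapping.single (a \<oplus>\<^bsub>A\<^esub> a', b) c - Poly_Mapping.single (a, b) c - Poly_Mapping.single
      (a', b) c \<in> V"
proof -
  have "Poly_Mapping.single (a \<oplus>\<^bsub>A\<^esub> a', b) (1::'k) - Poly_Mapping.single (a, b) 1 -
      Poly_Mapping.single (a', b) 1
      \<in> tensor_relations A B"
    using assms unfolding tensor_relations_def by blast
  from pm.span_scale[OF pm.span_base[OF this], of c] show ?thesis
    by (simp add: pm.scale_right_diff_distrib)
qed

lemma relation_add_right:
  assumes "a \<in> carrier A" "b \<in> carrier B" "b' \<in> carrier B"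
  shows "Poly_Mapping.single (a, b \<oplus>\<^bsub>B\<^esub> b') c - Poly_Mapping.single (a, b) c - Poly_Mapping.single
      (a, b') c \<in> V"
proof -
  have "Poly_Mapping.single (a, b \<oplus>\<^bsub>B\<^esub> b') (1::'k) - Poly_Mapping.single (a, b) 1 -
      Poly_Mapping.single (a, b') 1
      \<in> tensor_relations A B"
    using assms unfolding tensor_relations_def by blast
  from pm.span_scale[OF pm.span_base[OF this], of c] show ?thesis
    by (simp add: pm.scale_right_diff_distrib)
qed

lemma relation_smult_left:
  assumes "a \<in> carrier A" "b \<in> carrier B"
  shows "Poly_Mapping.single (d \<odot>\<^bsub>A\<^esub> a, b) c - Poly_Mapping.single (a, b) (d * c) \<in> V"
proof -
  have "Poly_Mapping.single (d \<odot>\<^bsub>A\<^esub> a, b) 1 - Poly_Mapping.single (a, b) d \<in> tensor_relations A B"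
    using assms unfolding tensor_relations_def by blast
  from pm.span_scale[OF pm.span_base[OF this], of c] show ?thesis
    by (simp add: pm.scale_right_diff_distrib mult.commute)
qed

lemma relation_smult_right:
  assumes "a \<in> carrier A" "b \<in> carrier B"
  shows "Poly_Mapping.single (a, d \<odot>\<^bsub>B\<^esub> b) c - Poly_Mapping.single (a, b) (d * c) \<in> V"
proof -
  have "Poly_Mapping.single (a, d \<odot>\<^bsub>B\<^esub> b) 1 - Poly_Mapping.single (a, b) d \<in> tensor_relations A B"
    using assms unfolding tensor_relations_def by blast
  from pm.span_scale[OF pm.span_base[OF this], of c] show ?thesis
    by (simp add: pm.scale_right_diff_distrib mult.commute)
qed

lemma tensor_relationsE:
  assumes "r \<in> tensor_relations A B"
  obtains (add_left) a a' b where "a \<in> carrier A" "a' \<in> carrier A" "b \<in> carrier B"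
      "r = Poly_Mapping.single (a \<oplus>\<^bsub>A\<^esub> a', b) 1 - Poly_Mapping.single (a, b) 1 - Poly_Mapping.single
          (a', b) 1"
  | (add_right) a b b' where "a \<in> carrier A" "b \<in> carrier B" "b' \<in> carrier B"
      "r = Poly_Mapping.single (a, b \<oplus>\<^bsub>B\<^esub> b') 1 - Poly_Mapping.single (a, b) 1 - Poly_Mapping.single
          (a, b') 1"
  | (smult_left) c a b where "a \<in> carrier A" "b \<in> carrier B"
      "r = Poly_Mapping.single (c \<odot>\<^bsub>A\<^esub> a, b) 1 - Poly_Mapping.single (a, b) c"
  | (smult_right) c a b where "a \<in> carrier A" "b \<in> carrier B"
      "r = Poly_Mapping.single (a, c \<odot>\<^bsub>B\<^esub> b) 1 - Poly_Mapping.single (a, b) c"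
  using assms unfolding tensor_relations_def
    by (elim UnE CollectE exE conjE) (rule that; assumption)+

text \<open>Multiplying a relation by a monomial gives a multiple of a relation of the same kind, by
  distributivity and by compatibility of scalars with products. This ideal property makes the
  projective seminorms submultiplicative.\<close>

lemma span_mult_closed:
  assumes "r \<in> V" "Poly_Mapping.keys v \<subseteq> C"
  shows "convolution (A \<times>\<times> B) r v \<in> V" "convolution (A \<times>\<times> B) v r \<in> V"
proof -
  have "convolution (A \<times>\<times> B) r v \<in> V \<and> convolution (A \<times>\<times> B) v r \<in> V"
    using assms(2)
  proof (induction v rule: poly_mapping_keys_induct)
    case zero
    then show ?case by (simp add: pm.span_zero)
  next
    case (add u v)
    then show ?case by (simp add: convolution_add_left convolution_add_right pm.span_add)
  next
    case (single xy c)
    then obtain x y where [simp]: "xy = (x, y)" "x \<in> carrier A" "y \<in> carrier B" by auto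
    show ?case using assms(1)
    proof (induction rule: pm.span_induct)
      case base
      show ?case
        by (auto simp: pm.subspace_def convolution_add_left convolution_add_right
            convolution_scale_left
            convolution_scale_right pm.span_zero pm.span_add pm.span_scale)
    next
      case (step r)
      then show ?case
      proof (cases rule: tensor_relationsE)
        case (add_left a a' b)
        then show ?thesis
          by (simp add: convolution_minus_left convolution_minus_right A.l_distr A.r_distr
              relation_add_left)
      next
        case (add_right a b b')
        then show ?thesis
          by (simp add: convolution_minus_left convolution_minus_right B.l_distr B.r_distr
              relation_add_right)
      next
        case (smult_left d a b)
        then show ?thesis
          using relation_smult_left[of "a \<otimes>\<^bsub>A\<^esub> x" "b \<otimes>\<^bsub>B\<^esub> y" d c] relation_smult_left[of "x \<otimes>\<^bsub>A\<^esub> a"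
              "y \<otimes>\<^bsub>B\<^esub> b" d c]
          by (simp add: convolution_minus_left convolution_minus_right A.smult_mult_left
              A.smult_mult_right mult.commute)
      next
        case (smult_right d a b)
        then show ?thesis
          using relation_smult_right[of "a \<otimes>\<^bsub>A\<^esub> x" "b \<otimes>\<^bsub>B\<^esub> y" d c] relation_smult_right[of "x \<otimes>\<^bsub>A\<^esub>
              a" "y \<otimes>\<^bsub>B\<^esub> b" d c]
          by (simp add: convolution_minus_left convolution_minus_right B.smult_mult_left
              B.smult_mult_right mult.commute)
      qed
    qed
  qed
  then show "convolution (A \<times>\<times> B) r v \<in> V" "convolution (A \<times>\<times> B) v r \<in> V" by auto
qed

section \<open>Projective seminorms on formal tensors\<close>

lemma tensor_cost_nonneg: "set l \<subseteq> C \<Longrightarrow> 0 \<le> tensor_cost A B n l"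
  by (induction l) auto

lemma keys_sum_list_single:
  "set l \<subseteq> C \<Longrightarrow> Poly_Mapping.keys (\<Sum>(a, b)\<leftarrow>l. Poly_Mapping.single (a, b) (1::'k)) \<subseteq> C"
proof (induction l)
  case (Cons ab l)
  then show ?case
    by (auto intro!: order.trans[OF keys_add] simp del: split_paired_All)
qed simp

lemma projective_seminorm_le: "tensor_rep_list A B u l \<Longrightarrow> projective_seminorm A B n u \<le> tensor_cost A
    B n l"
  unfolding projective_seminorm_eq
  by (intro cINF_lower bdd_belowI2[of _ 0]) (auto simp: tensor_rep_list_def intro!:
      tensor_cost_nonneg)

text \<open>Makes the infimum in the projective seminorm one over a non-empty set. Sums are
  represented by concatenation, and a coefficient moves into the left factor.\<close>

lemma tensor_rep_list_exists:
  assumes "Poly_Mapping.keys u \<subseteq> C"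
  obtains l where "tensor_rep_list A B u l"
proof -
  have "\<exists>l. tensor_rep_list A B u l" using assms
  proof (induction u rule: poly_mapping_keys_induct)
    case zero
    show ?case by (intro exI[of _ "[]"]) (simp add: tensor_rep_list_def pm.span_zero)
  next
    case (add u v)
    then obtain l l' where "tensor_rep_list A B u l" "tensor_rep_list A B v l'" by blast
    then show ?case
      using pm.span_add by (intro exI[of _ "l @ l'"]) (fastforce simp: tensor_rep_list_def
          add_diff_add)
  next
    case (single ab c)
    then obtain a b where ab: "ab = (a, b)" "a \<in> carrier A" "b \<in> carrier B" by auto
    then show ?case
      using pm.span_neg[OF relation_smult_left[OF ab(2,3), of c 1]]
      by (intro exI[of _ "[(c \<odot>\<^bsub>A\<^esub> a, b)]"]) (simp add: tensor_rep_list_def)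
  qed
  then show ?thesis using that by blast
qed

lemma projective_seminorm_greatest:
  assumes "Poly_Mapping.keys u \<subseteq> C" "\<And>l. tensor_rep_list A B u l \<Longrightarrow> c \<le> tensor_cost A B n l"
  shows "c \<le> projective_seminorm A B n u"
  unfolding projective_seminorm_eq
  using tensor_rep_list_exists[OF assms(1)] assms(2) by (intro cINF_greatest) auto

lemma projective_seminorm_nonneg: "Poly_Mapping.keys u \<subseteq> C \<Longrightarrow> 0 \<le> projective_seminorm A B n u"
  by (rule projective_seminorm_greatest) (auto simp: tensor_rep_list_def intro!: tensor_cost_nonneg)

text \<open>Moves a factor past the infimum. For \<open>d = 0\<close> division is impossible, and
  the existence of one representation gives the claim.\<close>

lemma projective_seminorm_greatest_mult:
  assumes "Poly_Mapping.keys u \<subseteq> C" "0 \<le> d" "\<And>l. tensor_rep_list A B u l \<Longrightarrow> c \<le> d * tensor_cost A B n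
      l"
  shows "c \<le> d * projective_seminorm A B n u"
proof (cases "d = 0")
  case True
  then show ?thesis using assms(3) tensor_rep_list_exists[OF assms(1)] by auto
next
  case False
  then have "c / d \<le> projective_seminorm A B n u"
    using assms by (intro projective_seminorm_greatest) (auto simp: field_simps)
  then show ?thesis using False assms(2) by (simp add: field_simps)
qed

text \<open>Concatenated representations add their costs; the two infima are then taken one after
  the other.\<close>

lemma projective_seminorm_triangle:
  assumes "Poly_Mapping.keys u \<subseteq> C" "Poly_Mapping.keys v \<subseteq> C"
  shows "projective_seminorm A B n (u + v) \<le> projective_seminorm A B n u + projective_seminorm A B n
      v"
proof -
  have "projective_seminorm A B n (u + v) \<le> tensor_cost A B n l + tensor_cost A B n l'"
    if "tensor_rep_list A B u l" "tensor_rep_list A B v l'" for l l'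
  proof -
    have "tensor_rep_list A B (u + v) (l @ l')"
      using that pm.span_add by (fastforce simp: tensor_rep_list_def add_diff_add)
    from projective_seminorm_le[OF this] show ?thesis by simp
  qed
  then have "projective_seminorm A B n (u + v) - tensor_cost A B n l' \<le> projective_seminorm A B n u"
    if "tensor_rep_list A B v l'" for l'
    using that by (intro projective_seminorm_greatest[OF assms(1)]) (simp add: algebra_simps)
  then have "projective_seminorm A B n (u + v) - projective_seminorm A B n u \<le> projective_seminorm A
      B n v"
    by (intro projective_seminorm_greatest[OF assms(2)]) (simp add: algebra_simps)
  then show ?thesis by simp
qed

lemma tensor_rep_list_scale:
  assumes "tensor_rep_list A B u l"
  shows "tensor_rep_list A B (pm_scale c u) (map (\<lambda>(a, b). (c \<odot>\<^bsub>A\<^esub> a, b)) l)"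
proof -
  have "pm_scale c (\<Sum>(a, b)\<leftarrow>l. Poly_Mapping.single (a, b) 1)
      - (\<Sum>(a, b)\<leftarrow>map (\<lambda>(a, b). (c \<odot>\<^bsub>A\<^esub> a, b)) l. Poly_Mapping.single (a, b) 1) \<in> V"
    if "set l \<subseteq> C" for l
    using that
  proof (induction l)
    case (Cons ab l)
    then obtain a b where ab: "ab = (a, b)" "a \<in> carrier A" "b \<in> carrier B" by auto
    from Cons pm.span_add[OF pm.span_neg[OF relation_smult_left[OF ab(2,3), of c 1]] Cons.IH] ab
        show ?case
      by (simp add: pm.scale_right_distrib add_diff_add)
  qed (simp add: pm.span_zero)
  from pm.span_add[OF pm.span_scale[of "u - (\<Sum>(a, b)\<leftarrow>l. Poly_Mapping.single (a, b) 1)" _ c] this[of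
      l]] assms
  show ?thesis by (auto simp: tensor_rep_list_def pm.scale_right_diff_distrib)
qed

lemma tensor_cost_scale: "set l \<subseteq> C \<Longrightarrow>
  tensor_cost A B n (map (\<lambda>(a, b). (c \<odot>\<^bsub>A\<^esub> a, b)) l) = norm c * tensor_cost A B n l"
  by (induction l) (auto simp: A.seminorm_smult algebra_simps)

text \<open>Scaling a representation yields one inequality. The other is the same inequality for
  \<open>inverse c\<close>, applied to the scaled element.\<close>

lemma projective_seminorm_scale:
  assumes u: "Poly_Mapping.keys u \<subseteq> C"
  shows "projective_seminorm A B n (pm_scale c u) = norm c * projective_seminorm A B n u"
proof -
  have le: "projective_seminorm A B n (pm_scale c u) \<le> norm c * projective_seminorm A B n u"
    if u: "Poly_Mapping.keys u \<subseteq> C" for c u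
    by (rule projective_seminorm_greatest_mult[OF u])
      (use projective_seminorm_le[OF tensor_rep_list_scale] tensor_cost_scale in \<open>fastforce simp:
          tensor_rep_list_def\<close>)+
  have ku: "Poly_Mapping.keys (pm_scale c u) \<subseteq> C" using keys_pm_scale u by (rule order.trans)
  show ?thesis
  proof (cases "c = 0")
    case True
    then show ?thesis using le[OF u, of c] projective_seminorm_nonneg[OF ku, of n] by simp
  next
    case False
    then have "projective_seminorm A B n u \<le> norm (inverse c) * projective_seminorm A B n (pm_scale
        c u)"
      using le[OF ku, of "inverse c"] by simp
    then have "norm c * projective_seminorm A B n u \<le> projective_seminorm A B n (pm_scale c u)"
      using False by (simp add: norm_divide field_simps)
    with le[OF u, of c] show ?thesis by simp
  qed
qed

definition list_mult :: "('a \<times> 'b) list \<Rightarrow> ('a \<times> 'b) list \<Rightarrow> ('a \<times> 'b) list" where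
  "list_mult l l' = concat (map (\<lambda>(a, b). map (\<lambda>(a', b'). (a \<otimes>\<^bsub>A\<^esub> a', b \<otimes>\<^bsub>B\<^esub> b')) l') l)"

lemma sum_list_mult:
  "convolution (A \<times>\<times> B) (\<Sum>(a, b)\<leftarrow>l. Poly_Mapping.single (a, b) 1) (\<Sum>(a, b)\<leftarrow>l'. Poly_Mapping.single
      (a, b) (1::'k))
     = (\<Sum>(a, b)\<leftarrow>list_mult l l'. Poly_Mapping.single (a, b) 1)"
proof -
  have "convolution (A \<times>\<times> B) (Poly_Mapping.single (a, b) 1) (\<Sum>(a, b)\<leftarrow>l'. Poly_Mapping.single (a, b)
      (1::'k))
     = (\<Sum>(a, b)\<leftarrow>map (\<lambda>(a', b'). (a \<otimes>\<^bsub>A\<^esub> a', b \<otimes>\<^bsub>B\<^esub> b')) l'. Poly_Mapping.single (a, b) 1)" for a b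
    by (induction l') (auto simp: convolution_add_right)
  then show ?thesis by (induction l) (auto simp: list_mult_def convolution_add_left)
qed

lemma tensor_cost_mult:
  assumes "set l \<subseteq> C" "set l' \<subseteq> C"
  shows "tensor_cost A B n (list_mult l l') \<le> tensor_cost A B n l * tensor_cost A B n l'"
proof -
  have *: "tensor_cost A B n (map (\<lambda>(a', b'). (a \<otimes>\<^bsub>A\<^esub> a', b \<otimes>\<^bsub>B\<^esub> b')) l')
      \<le> (seminorm A n a * seminorm B n b) * tensor_cost A B n l'"
    if ab: "a \<in> carrier A" "b \<in> carrier B" for a b
    using assms(2)
  proof (induction l')
    case (Cons ab' l')
    then obtain a' b' where ab': "ab' = (a', b')" "a' \<in> carrier A" "b' \<in> carrier B" by auto
    have "seminorm A n (a \<otimes>\<^bsub>A\<^esub> a') * seminorm B n (b \<otimes>\<^bsub>B\<^esub> b')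
        \<le> (seminorm A n a * seminorm A n a') * (seminorm B n b * seminorm B n b')"
      using ab ab' by (intro mult_mono A.seminorm_mult B.seminorm_mult) auto
    with Cons ab' show ?case by (simp add: algebra_simps)
  qed simp
  from assms(1) show ?thesis
  proof (induction l)
    case (Cons ab l)
    then obtain a b where ab: "ab = (a, b)" "a \<in> carrier A" "b \<in> carrier B" by auto
    with Cons *[OF ab(2,3)] show ?case by (simp add: list_mult_def algebra_simps)
  qed (simp add: list_mult_def)
qed

lemma tensor_rep_list_mult:
  assumes l: "tensor_rep_list A B u l" and l': "tensor_rep_list A B v l'" and v: "Poly_Mapping.keys
      v \<subseteq> C"
  shows "tensor_rep_list A B (convolution (A \<times>\<times> B) u v) (list_mult l l')"
proof -
  let ?s = "\<lambda>l. \<Sum>(a, b)\<leftarrow>l. Poly_Mapping.single (a, b) (1::'k)"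
  have "set (list_mult l l') \<subseteq> C"
    using l l' by (auto simp: tensor_rep_list_def list_mult_def)
  \<comment> \<open>With \<open>s\<close> and \<open>s'\<close> the two represented sums,
    \<open>u v - s s' = (u - s) v + s (v - s')\<close>, and both terms lie in the ideal.\<close>
  moreover have "convolution (A \<times>\<times> B) (u - ?s l) v + convolution (A \<times>\<times> B) (?s l) (v - ?s l') \<in> V"
    using l l' v
      by (intro pm.span_add span_mult_closed) (auto simp: tensor_rep_list_def dest!: keys_sum_list_single)
  then have "convolution (A \<times>\<times> B) u v - ?s (list_mult l l') \<in> V"
    by (simp add: convolution_minus_left convolution_minus_right sum_list_mult)
  ultimately show ?thesis by (simp add: tensor_rep_list_def)
qed

text \<open>The costs of products of representations are submultiplicative. The infimum is taken
  first over representations of \<open>u\<close> with that of \<open>v\<close> fixed, then over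
  those of \<open>v\<close>.\<close>

lemma projective_seminorm_mult:
  assumes "Poly_Mapping.keys u \<subseteq> C" "Poly_Mapping.keys v \<subseteq> C"
  shows "projective_seminorm A B n (convolution (A \<times>\<times> B) u v) \<le> projective_seminorm A B n u *
      projective_seminorm A B n v"
proof (rule projective_seminorm_greatest_mult[OF assms(2) projective_seminorm_nonneg[OF assms(1)]])
  fix l' assume l': "tensor_rep_list A B v l'"
  have "projective_seminorm A B n (convolution (A \<times>\<times> B) u v) \<le> tensor_cost A B n l' *
      projective_seminorm A B n u"
  proof (rule projective_seminorm_greatest_mult[OF assms(1)])
    fix l assume l: "tensor_rep_list A B u l"
    from order.trans[OF projective_seminorm_le[OF tensor_rep_list_mult[OF l l' assms(2)]]
        tensor_cost_mult] l l'
    show "projective_seminorm A B n (convolution (A \<times>\<times> B) u v) \<le> tensor_cost A B n l' * tensor_cost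
        A B n l"
      by (simp add: tensor_rep_list_def mult.commute)
  qed (use l' in \<open>auto simp: tensor_rep_list_def intro: tensor_cost_nonneg\<close>)
  then show "projective_seminorm A B n (convolution (A \<times>\<times> B) u v) \<le> projective_seminorm A B n u *
      tensor_cost A B n l'"
    by (simp add: mult.commute)
qed

lemma projective_seminorm_increasing:
  assumes "Poly_Mapping.keys u \<subseteq> C"
  shows "projective_seminorm A B n u \<le> projective_seminorm A B (Suc n) u"
proof (rule projective_seminorm_greatest[OF assms])
  fix l assume l: "tensor_rep_list A B u l"
  have "tensor_cost A B n l \<le> tensor_cost A B (Suc n) l"
    using l
      by (intro sum_list_mono) (auto simp: tensor_rep_list_def intro!: mult_mono A.seminorm_increasing B.seminorm_increasing)
  with projective_seminorm_le[OF l, of n] show "projective_seminorm A B n u \<le> tensor_cost A B (Suc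
      n) l" by simp
qed

section \<open>The completed tensor product and pure tensors\<close>

lemma seminormed_alg_formal_tensor: "seminormed_alg T"
proof -
  interpret AB: Group.monoid "A \<times>\<times> B" by (rule DirProd_monoid) (rule A.is_monoid B.is_monoid)+
  show ?thesis
    unfolding formal_tensor_def
    by (rule AB.seminormed_alg_monoid_algebra)
      (simp_all add: projective_seminorm_triangle projective_seminorm_scale projective_seminorm_mult
          projective_seminorm_increasing)
qed

sublocale T: seminormed_alg T by (rule seminormed_alg_formal_tensor)

sublocale PT: frechet_alg "projective_tensor A B"
  unfolding projective_tensor_def by (rule T.frechet_alg_completion)

lemma carrier_formal_tensor: "carrier T = {u. Poly_Mapping.keys u \<subseteq> C}"
  by (simp add: formal_tensor_def)

lemma pure_tensor_closed [simp, intro]: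
  "a \<in> carrier A \<Longrightarrow> b \<in> carrier B \<Longrightarrow> pure_tensor A B a b \<in> carrier (projective_tensor A B)"
  by (simp add: pure_tensor_def projective_tensor_def T.to_completion_closed carrier_formal_tensor)

text \<open>The empty list represents every element of the span and costs 0, so all seminorms vanish
  there. In this way the Hausdorff completion realises the quotient by the tensor relations.\<close>

lemma to_completion_eq_zero_if_relation:
  assumes "Poly_Mapping.keys u \<subseteq> C" "u \<in> V"
  shows "to_completion T u = \<zero>\<^bsub>projective_tensor A B\<^esub>"
proof (rule PT.hausdorff)
  have "projective_seminorm A B n u \<le> 0" for n
    using projective_seminorm_le[of u "[]" n] assms(2) by (simp add: tensor_rep_list_def)
  then have "projective_seminorm A B n u = 0" for n
    using projective_seminorm_nonneg[OF assms(1), of n] by (simp add: antisym)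
  then show "seminorm (projective_tensor A B) n (to_completion T u) = 0" for n
    using assms(1) T.seminorm_to_completion[of u n]
    by (simp add: projective_tensor_def carrier_formal_tensor) (simp add: formal_tensor_def)
  show "to_completion T u \<in> carrier (projective_tensor A B)"
    using assms(1) by (simp add: projective_tensor_def T.to_completion_closed carrier_formal_tensor)
qed

lemma to_completion_linear:
  "linear_map (monoid_algebra (A \<times>\<times> B) (projective_seminorm A B)) (projective_tensor A B)
      (to_completion T)"
  using T.linear_to_completion by (simp add: projective_tensor_def formal_tensor_def)

lemma to_completion_eq_if_relation:
  assumes "Poly_Mapping.keys u \<subseteq> C" "Poly_Mapping.keys v \<subseteq> C" "u - v \<in> V"
  shows "to_completion T u = to_completion T v"
proof -
  have "Poly_Mapping.keys (u - v) \<subseteq> C" by (rule order.trans[OF keys_minus]) (use assms(1,2) in simp)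
  with assms(3) have "to_completion T (u - v) = \<zero>\<^bsub>projective_tensor A B\<^esub>"
    by (intro to_completion_eq_zero_if_relation)
  with \<open>Poly_Mapping.keys (u - v) \<subseteq> C\<close> show ?thesis
    using linear_map_add[OF to_completion_linear, of "u - v" v] assms(1,2) linear_map_closed[OF
        to_completion_linear, of v] by simp
qed

text \<open>Each of the four laws is one of the four kinds of relation, which the completion
  identifies with zero.\<close>

lemma bilinear_pure_tensor: "bilinear_map A B (projective_tensor A B) (pure_tensor A B)"
proof -
  let ?s = "\<lambda>a b. Poly_Mapping.single (a, b) (1::'k)"
  have *: "to_completion T (u + v) = to_completion T u \<oplus>\<^bsub>projective_tensor A B\<^esub> to_completion T v"
    if "Poly_Mapping.keys u \<subseteq> C" "Poly_Mapping.keys v \<subseteq> C" for u v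
    using that linear_map_add[OF to_completion_linear, of u v] by simp
  have **: "to_completion T (pm_scale c u) = c \<odot>\<^bsub>projective_tensor A B\<^esub> to_completion T u"
    if "Poly_Mapping.keys u \<subseteq> C" for u c
    using that linear_map_smult[OF to_completion_linear, of u c] by simp
  have keys: "Poly_Mapping.keys (?s a b) \<subseteq> C" "Poly_Mapping.keys (?s a b + ?s a' b') \<subseteq> C"
    "Poly_Mapping.keys (pm_scale c (?s a b)) \<subseteq> C"
    if "a \<in> carrier A" "a' \<in> carrier A" "b \<in> carrier B" "b' \<in> carrier B" for a a' b b' c
    using that keys_add[of "?s a b" "?s a' b'"] by auto
  show ?thesis
    unfolding bilinear_map_def linear_map_def
  proof (intro conjI ballI allI)
    fix a b b' assume ab: "a \<in> carrier A" "b \<in> carrier B" "b' \<in> carrier B"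
    have "to_completion T (?s a (b \<oplus>\<^bsub>B\<^esub> b')) = to_completion T (?s a b + ?s a b')"
      using ab relation_add_right[OF ab, of 1]
        by (intro to_completion_eq_if_relation) (auto simp: keys diff_diff_eq simp del: keys_single)
    then show "pure_tensor A B a (b \<oplus>\<^bsub>B\<^esub> b') = pure_tensor A B a b \<oplus>\<^bsub>projective_tensor A B\<^esub>
        pure_tensor A B a b'"
      using ab by (simp add: pure_tensor_def *)
  next
    fix a a' b assume ab: "b \<in> carrier B" "a \<in> carrier A" "a' \<in> carrier A"
    have "to_completion T (?s (a \<oplus>\<^bsub>A\<^esub> a') b) = to_completion T (?s a b + ?s a' b)"
      using ab relation_add_left[of a a' b 1]
        by (intro to_completion_eq_if_relation) (auto simp: keys diff_diff_eq simp del: keys_single)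
    then show "pure_tensor A B (a \<oplus>\<^bsub>A\<^esub> a') b = pure_tensor A B a b \<oplus>\<^bsub>projective_tensor A B\<^esub>
        pure_tensor A B a' b"
      using ab by (simp add: pure_tensor_def *)
  next
    fix c a b assume ab: "a \<in> carrier A" "b \<in> carrier B"
    have "to_completion T (?s a (c \<odot>\<^bsub>B\<^esub> b)) = to_completion T (pm_scale c (?s a b))"
      using ab relation_smult_right[OF ab, of c 1]
        by (intro to_completion_eq_if_relation) (auto split: if_splits)
    then show "pure_tensor A B a (c \<odot>\<^bsub>B\<^esub> b) = c \<odot>\<^bsub>projective_tensor A B\<^esub> pure_tensor A B a b"
      using ab by (simp add: pure_tensor_def ** del: pm_scale_single)
  next
    fix c a b assume ab: "b \<in> carrier B" "a \<in> carrier A"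
    have "to_completion T (?s (c \<odot>\<^bsub>A\<^esub> a) b) = to_completion T (pm_scale c (?s a b))"
      using ab relation_smult_left[of a b c 1]
        by (intro to_completion_eq_if_relation) (auto split: if_splits)
    then show "pure_tensor A B (c \<odot>\<^bsub>A\<^esub> a) b = c \<odot>\<^bsub>projective_tensor A B\<^esub> pure_tensor A B a b"
      using ab by (simp add: pure_tensor_def ** del: pm_scale_single)
  qed auto
qed

text \<open>The list with the single entry \<open>(a, b)\<close> is an admissible
  representation.\<close>

lemma seminorm_pure_tensor_le:
  assumes "a \<in> carrier A" "b \<in> carrier B"
  shows "seminorm (projective_tensor A B) n (pure_tensor A B a b) \<le> seminorm A n a * seminorm B n b"
proof -
  have "projective_seminorm A B n (Poly_Mapping.single (a, b) 1) \<le> seminorm A n a * seminorm B n b"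
    using projective_seminorm_le[of "Poly_Mapping.single (a, b) 1" "[(a, b)]" n] assms
    by (simp add: tensor_rep_list_def pm.span_zero)
  then show ?thesis
    using assms T.seminorm_to_completion[of "Poly_Mapping.single (a, b) 1" n]
    by (simp add: projective_tensor_def pure_tensor_def carrier_formal_tensor) (simp add:
        formal_tensor_def)
qed

lemma pure_tensor_mult:
  assumes "a \<in> carrier A" "b \<in> carrier B" "a' \<in> carrier A" "b' \<in> carrier B"
  shows "pure_tensor A B a b \<otimes>\<^bsub>projective_tensor A B\<^esub> pure_tensor A B a' b' = pure_tensor A B (a
      \<otimes>\<^bsub>A\<^esub> a') (b \<otimes>\<^bsub>B\<^esub> b')"
  using T.to_completion_mult[of "Poly_Mapping.single (a, b) 1" "Poly_Mapping.single (a', b') 1"]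
      assms
  by (simp add: pure_tensor_def projective_tensor_def carrier_formal_tensor) (simp add:
      formal_tensor_def)

lemma pure_tensor_one: "pure_tensor A B \<one>\<^bsub>A\<^esub> \<one>\<^bsub>B\<^esub> = \<one>\<^bsub>projective_tensor A B\<^esub>"
  using T.to_completion_one
  by (simp add: pure_tensor_def projective_tensor_def) (simp add: formal_tensor_def)

lemma eq_on_projective_tensor:
  assumes "frechet_alg F"
    and "linear_map (projective_tensor A B) F f" "bounded_map (projective_tensor A B) F f"
    and "linear_map (projective_tensor A B) F g" "bounded_map (projective_tensor A B) F g"
    and "\<And>a b. a \<in> carrier A \<Longrightarrow> b \<in> carrier B \<Longrightarrow> f (pure_tensor A B a b) = g (pure_tensor A B a b)"
    and "X \<in> carrier (projective_tensor A B)"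
  shows "f X = g X"
  using assms T.seminormed_alg_axioms unfolding projective_tensor_def pure_tensor_def
      formal_tensor_def
  by (intro eq_on_completed_monoid_algebra[of "A \<times>\<times> B" "projective_seminorm A B" F f g X]) auto

end

section \<open>The universal property for bounded bilinear maps\<close>

locale bounded_bilinear_into_frechet = tensor_factors A B + F: frechet_alg F
  for A :: "('k::real_normed_field, 'a) seminormed_algebra" and B :: "('k, 'b) seminormed_algebra"
    and F :: "('k, 'f) seminormed_algebra" +
  fixes \<beta> :: "'a \<Rightarrow> 'b \<Rightarrow> 'f"
  assumes bilinear: "bilinear_map A B F \<beta>"
    and bilinear_bounded: "\<And>n. \<exists>m D. bilinear_bound A B F \<beta> n m D"
begin

abbreviation "f \<equiv> linear_ext F (\<lambda>(a, b). \<beta> a b)"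

lemma \<beta>_closed: "a \<in> carrier A \<Longrightarrow> b \<in> carrier B \<Longrightarrow> \<beta> a b \<in> carrier F"
  and \<beta>_add_left: "\<lbrakk>a \<in> carrier A; a' \<in> carrier A; b \<in> carrier B\<rbrakk> \<Longrightarrow> \<beta> (a \<oplus>\<^bsub>A\<^esub> a') b = \<beta> a b \<oplus>\<^bsub>F\<^esub> \<beta>
      a' b"
  and \<beta>_add_right: "\<lbrakk>a \<in> carrier A; b \<in> carrier B; b' \<in> carrier B\<rbrakk> \<Longrightarrow> \<beta> a (b \<oplus>\<^bsub>B\<^esub> b') = \<beta> a b \<oplus>\<^bsub>F\<^esub> \<beta>
      a b'"
  and \<beta>_smult_left: "\<lbrakk>a \<in> carrier A; b \<in> carrier B\<rbrakk> \<Longrightarrow> \<beta> (c \<odot>\<^bsub>A\<^esub> a) b = c \<odot>\<^bsub>F\<^esub> \<beta> a b"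
  and \<beta>_smult_right: "\<lbrakk>a \<in> carrier A; b \<in> carrier B\<rbrakk> \<Longrightarrow> \<beta> a (c \<odot>\<^bsub>B\<^esub> b) = c \<odot>\<^bsub>F\<^esub> \<beta> a b"
  using bilinear by (auto simp: bilinear_map_def linear_map_def)

lemma linear_f: "linear_map (monoid_algebra (A \<times>\<times> B) (projective_seminorm A B)) F f"
  by (rule F.linear_map_linear_ext) (auto simp: \<beta>_closed)

lemma f_minus:
  assumes "Poly_Mapping.keys u \<subseteq> C" "Poly_Mapping.keys v \<subseteq> C"
  shows "f (u - v) = f u \<ominus>\<^bsub>F\<^esub> f v"
  using linear_map_minus[OF _ F.seminormed_alg_axioms linear_f, of u v] T.seminormed_alg_axioms
      assms
  by (simp add: formal_tensor_def minus_monoid_algebra)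

lemma f_closed: "Poly_Mapping.keys u \<subseteq> C \<Longrightarrow> f u \<in> carrier F"
  using linear_map_closed[OF linear_f, of u] by simp

text \<open>Bilinearity of \<beta> is exactly the vanishing on the generators. The support condition
  is carried along because \<open>f\<close> is known to be linear only on elements supported in the
  carriers.\<close>

lemma f_zero_on_relations:
  assumes "u \<in> V" shows "Poly_Mapping.keys u \<subseteq> C \<and> f u = \<zero>\<^bsub>F\<^esub>"
  using assms
proof (induction rule: pm.span_induct)
  case base
  show ?case
    unfolding pm.subspace_def
  proof (intro conjI ballI allI)
    fix u v assume "u \<in> {u. Poly_Mapping.keys u \<subseteq> C \<and> f u = \<zero>\<^bsub>F\<^esub>}" "v \<in> {u. Poly_Mapping.keys u \<subseteq> C
        \<and> f u = \<zero>\<^bsub>F\<^esub>}"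
    then show "u + v \<in> {u. Poly_Mapping.keys u \<subseteq> C \<and> f u = \<zero>\<^bsub>F\<^esub>}"
      using keys_add[of u v] linear_map_add[OF linear_f, of u v] by auto
  next
    fix c u assume "u \<in> {u. Poly_Mapping.keys u \<subseteq> C \<and> f u = \<zero>\<^bsub>F\<^esub>}"
    then show "pm_scale c u \<in> {u. Poly_Mapping.keys u \<subseteq> C \<and> f u = \<zero>\<^bsub>F\<^esub>}"
      using keys_pm_scale[of c u] linear_map_smult[OF linear_f, of u c] by auto
  qed simp
next
  case (step r)
  then have *: "f (Poly_Mapping.single (a, b) c) = c \<odot>\<^bsub>F\<^esub> \<beta> a b" if "a \<in> carrier A" "b \<in> carrier B"
      for a b c
    using that by (simp add: \<beta>_closed)
  have keys: "Poly_Mapping.keys (u - v) \<subseteq> C" if "Poly_Mapping.keys u \<subseteq> C" "Poly_Mapping.keys v \<subseteq> C"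
    for u v :: "'a \<times> 'b \<Rightarrow>\<^sub>0 'k"
    by (rule order.trans[OF keys_minus]) (use that in simp)
  have ks: "Poly_Mapping.keys (Poly_Mapping.single (a, b) (c::'k)) \<subseteq> C" if "a \<in> carrier A" "b \<in>
      carrier B" for a b c
    using that by simp
  have cancel: "x \<oplus>\<^bsub>F\<^esub> y \<ominus>\<^bsub>F\<^esub> x \<ominus>\<^bsub>F\<^esub> y = \<zero>\<^bsub>F\<^esub>" if "x \<in> carrier F" "y \<in> carrier F" for x y
    using F.r_neg[of "x \<oplus>\<^bsub>F\<^esub> y"] that by (simp add: a_minus_def F.minus_add F.a_assoc)
  from step show ?case
    by (cases rule: tensor_relationsE)
      (simp_all add: keys ks f_minus * cancel \<beta>_closed \<beta>_add_left \<beta>_add_right \<beta>_smult_left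
          \<beta>_smult_right
        del: keys_single)
qed

text \<open>Since \<open>f\<close> vanishes on the relations, it takes the same value on
  \<open>u\<close> and on every sum representing \<open>u\<close>. The cost of any representation
  therefore bounds \<open>f u\<close>, and so does the infimum.\<close>

lemma f_bound:
  assumes b: "bilinear_bound A B F \<beta> n m D" and u: "Poly_Mapping.keys u \<subseteq> C"
  shows "seminorm F n (f u) \<le> D * projective_seminorm A B m u"
proof (rule projective_seminorm_greatest_mult[OF u])
  show "0 \<le> D" using b by (simp add: bilinear_bound_def)
  let ?s = "\<lambda>l. \<Sum>(a, b)\<leftarrow>l. Poly_Mapping.single (a, b) (1::'k)"
  fix l assume l: "tensor_rep_list A B u l"
  then have keys: "Poly_Mapping.keys (?s l) \<subseteq> C"
    by (intro keys_sum_list_single) (simp add: tensor_rep_list_def)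
  have "f u \<ominus>\<^bsub>F\<^esub> f (?s l) = \<zero>\<^bsub>F\<^esub>"
    using l f_zero_on_relations f_minus[OF u keys] by (simp add: tensor_rep_list_def)
  then have "f u = f (?s l)" by (rule F.eq_if_minus_eq_zero[OF f_closed[OF u] f_closed[OF keys]])
  moreover have "seminorm F n (f (?s l)) \<le> D * tensor_cost A B m l" if "set l \<subseteq> C" for l
    using that
  proof (induction l)
    case (Cons ab l)
    then obtain a b where ab: "ab = (a, b)" "a \<in> carrier A" "b \<in> carrier B" by auto
    have kl: "Poly_Mapping.keys (?s l) \<subseteq> C" using Cons.prems by (intro keys_sum_list_single) simp
    have "f (?s (ab # l)) = \<beta> a b \<oplus>\<^bsub>F\<^esub> f (?s l)"
      using linear_map_add[OF linear_f, of "Poly_Mapping.single (a, b) 1" "?s l"] ab kl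
        by (simp add: \<beta>_closed)
    then have "seminorm F n (f (?s (ab # l))) \<le> seminorm F n (\<beta> a b) + seminorm F n (f (?s l))"
      using ab f_closed[OF kl] by (simp add: F.seminorm_triangle \<beta>_closed)
    also have "\<dots> \<le> D * (seminorm A m a * seminorm B m b) + D * tensor_cost A B m l"
    proof (rule add_mono)
      show "seminorm F n (f (?s l)) \<le> D * tensor_cost A B m l"
        by (rule Cons.IH) (use Cons.prems in simp)
    qed (use b ab in \<open>simp add: bilinear_bound_def\<close>)
    finally show ?case by (simp only: ab list.map prod.case sum_list.Cons distrib_left)
  qed simp
  ultimately show "seminorm F n (f u) \<le> D * tensor_cost A B m l" using l
    by (simp add: tensor_rep_list_def)
qed

sublocale ext: bounded_into_frechet T F f
proof
  show "linear_map T F f" using linear_f by (simp add: formal_tensor_def)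
  show "bounded_map T F f"
    unfolding bounded_map_def
  proof
    fix n
    obtain m D where "bilinear_bound A B F \<beta> n m D" using bilinear_bounded by blast
    then show "\<exists>m C. 0 \<le> C \<and> (\<forall>x\<in>carrier T. seminorm F n (f x) \<le> C * seminorm T m x)"
      using f_bound[of n m D]
        by (intro exI[of _ m] exI[of _ D]) (auto simp: bilinear_bound_def formal_tensor_def)
  qed
qed

text \<open>Justifies the \<open>THE\<close> in \<open>tensor_lift\<close>: extension to the
  completion gives existence, density of the span of pure tensors gives uniqueness on the carrier,
  and extensionality gives it elsewhere.\<close>

lemma tensor_lift_eq_completion_lift: "tensor_lift A B F \<beta> = completion_lift T F f"
  unfolding tensor_lift_def
proof (rule the_equality)
  have pure: "completion_lift T F f (pure_tensor A B a b) = \<beta> a b" if "a \<in> carrier A" "b \<in> carrier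
      B" for a b
    using that ext.completion_lift_to_completion[of "Poly_Mapping.single (a, b) 1"]
    by (simp add: pure_tensor_def carrier_formal_tensor \<beta>_closed)
  have lin: "linear_map (projective_tensor A B) F (completion_lift T F f)" and bdd: "bounded_map
      (projective_tensor A B) F (completion_lift T F f)"
    using ext.completion_lift_linear ext.completion_lift_bounded
      by (simp_all add: projective_tensor_def)
  show "completion_lift T F f \<in> extensional (carrier (projective_tensor A B)) \<and> continuous_linear
      (projective_tensor A B) F (completion_lift T F f) \<and>
      (\<forall>a\<in>carrier A. \<forall>b\<in>carrier B. completion_lift T F f (pure_tensor A B a b) = \<beta> a b)"
    using ext.completion_lift_extensional lin bdd pure
    by (simp add: continuous_linear_iff_bounded PT.seminormed_alg_axioms F.seminormed_alg_axioms)
        (simp add: projective_tensor_def)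
  fix h assume h: "h \<in> extensional (carrier (projective_tensor A B)) \<and> continuous_linear
      (projective_tensor A B) F h \<and>
      (\<forall>a\<in>carrier A. \<forall>b\<in>carrier B. h (pure_tensor A B a b) = \<beta> a b)"
  then have "linear_map (projective_tensor A B) F h" "bounded_map (projective_tensor A B) F h"
    by (simp_all add: continuous_linear_iff_bounded PT.seminormed_alg_axioms
        F.seminormed_alg_axioms)
  then have "h X = completion_lift T F f X" if "X \<in> carrier (projective_tensor A B)" for X
    using that h lin bdd pure
      by (intro eq_on_projective_tensor[OF F.frechet_alg_axioms, of h "completion_lift T F f" X]) auto
  then show "h = completion_lift T F f"
    using h ext.completion_lift_extensional
      by (intro extensionalityI) (auto simp: projective_tensor_def)
qed

lemma tensor_lift_linear: "linear_map (projective_tensor A B) F (tensor_lift A B F \<beta>)"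
  and tensor_lift_bounded: "bounded_map (projective_tensor A B) F (tensor_lift A B F \<beta>)"
  using ext.completion_lift_linear ext.completion_lift_bounded
    by (simp_all add: tensor_lift_eq_completion_lift projective_tensor_def)

lemma tensor_lift_pure:
  "a \<in> carrier A \<Longrightarrow> b \<in> carrier B \<Longrightarrow> tensor_lift A B F \<beta> (pure_tensor A B a b) = \<beta> a b"
  using ext.completion_lift_to_completion[of "Poly_Mapping.single (a, b) 1"]
  by (simp add: tensor_lift_eq_completion_lift pure_tensor_def carrier_formal_tensor \<beta>_closed)

lemma tensor_lift_bound:
  assumes "bilinear_bound A B F \<beta> n m D" "X \<in> carrier (projective_tensor A B)"
  shows "seminorm F n (tensor_lift A B F \<beta> X) \<le> D * seminorm (projective_tensor A B) m X"
  using ext.completion_lift_bound[of n D m X] f_bound[OF assms(1)] assms(2)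
  by (simp add: tensor_lift_eq_completion_lift projective_tensor_def) (simp add: formal_tensor_def)

end


section \<open>The ground field\<close>

lemma ground_simps [simp]:
  "carrier ground = UNIV" "mult ground = (*)" "one ground = 1" "zero ground = 0"
  "add ground = (+)" "smult ground = (*)" "seminorm ground n = norm"
  by (simp_all add: ground_def)

lemma minus_ground [simp]: "(x::'k::real_normed_field) \<ominus>\<^bsub>ground\<^esub> y = x - y"
proof -
  interpret cring "ground :: ('k, 'k) seminormed_algebra" by (rule cring_ground)
  have "\<ominus>\<^bsub>ground\<^esub> y = - y" by (rule minus_equality) simp_all
  then show ?thesis by (simp add: a_minus_def)
qed

lemma frechet_alg_ground: "frechet_alg (ground :: ('k::{real_normed_field, banach}, 'k)
    seminormed_algebra)"
proof -
  interpret cring "ground :: ('k, 'k) seminormed_algebra" by (rule cring_ground)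
  show ?thesis
  proof (unfold_locales, goal_cases)
    case (13 s)
    then have "Cauchy s"
      unfolding cauchy_seqs_def by (simp add: Cauchy_iff)
    then obtain L where "s \<longlonglongrightarrow> L" using Cauchy_convergent convergent_def by blast
    then have "(\<lambda>i. norm (s i - L)) \<longlonglongrightarrow> 0" by (simp add: LIM_zero_iff tendsto_norm_zero)
    then show ?case by (intro bexI[of _ L]) auto
  qed (auto simp: norm_triangle_ineq norm_mult algebra_simps)
qed


section \<open>Word length and the group algebra\<close>

locale generated_group = group \<Gamma> for \<Gamma> :: "('g, 'm) monoid_scheme" (structure) +
  fixes S :: "'g set"
  assumes finite_S: "finite S" and S_subset: "S \<subseteq> carrier \<Gamma>" and generate_S: "generate \<Gamma> S = carrier
      \<Gamma>"
begin

abbreviation "letters \<equiv> S \<union> (\<lambda>s. inv s) ` S"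

abbreviation "word_val l \<equiv> foldr (\<otimes>) l \<one>"

abbreviation "wlen \<equiv> word_length \<Gamma> S"

lemma letters_closed: "letters \<subseteq> carrier \<Gamma>"
  using S_subset by auto

lemma word_val_closed: "set l \<subseteq> letters \<Longrightarrow> word_val l \<in> carrier \<Gamma>"
  using S_subset by (induction l) auto

lemma word_val_append:
  "set l \<subseteq> letters \<Longrightarrow> set l' \<subseteq> letters \<Longrightarrow> word_val (l @ l') = word_val l \<otimes> word_val l'"
proof (induction l)
  case (Cons a l)
  then have "a \<in> carrier \<Gamma>" "word_val l \<in> carrier \<Gamma>" "word_val l' \<in> carrier \<Gamma>"
    using letters_closed word_val_closed[of l] word_val_closed[of l'] by auto
  with Cons show ?case by (simp add: m_assoc)
qed (simp add: word_val_closed)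

text \<open>Ensures that the \<open>LEAST\<close> in \<open>word_length\<close> ranges over a
  non-empty set; this is where generation by \<open>S\<close> enters.\<close>

lemma word_exists:
  assumes "x \<in> carrier \<Gamma>" shows "\<exists>l. set l \<subseteq> letters \<and> word_val l = x"
proof -
  have "x \<in> generate \<Gamma> S" using assms generate_S by simp
  then show ?thesis
  proof (induction rule: generate.induct)
    case one
    show ?case by (intro exI[of _ "[]"]) simp
  next
    case (incl h)
    then show ?case using S_subset by (intro exI[of _ "[h]"]) auto
  next
    case (inv h)
    then show ?case using S_subset by (intro exI[of _ "[inv h]"]) auto
  next
    case (eng h1 h2)
    then obtain l l' where "set l \<subseteq> letters" "word_val l = h1" "set l' \<subseteq> letters" "word_val l' = h2"
        by blast
    then show ?case by (intro exI[of _ "l @ l'"]) (auto simp: word_val_append[symmetric] simp del: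
        foldr_append)
  qed
qed

lemma wlen_attained:
  assumes "x \<in> carrier \<Gamma>" obtains l where "length l = wlen x" "set l \<subseteq> letters" "word_val l = x"
proof -
  have "\<exists>n l. length l = n \<and> set l \<subseteq> letters \<and> word_val l = x" using word_exists[OF assms] by blast
  from LeastI_ex[OF this] show ?thesis using that unfolding word_length_def by blast
qed

lemma wlen_le: "set l \<subseteq> letters \<Longrightarrow> wlen (word_val l) \<le> length l"
  unfolding word_length_def by (intro Least_le) blast

text \<open>Shortest words for the two factors concatenate to a word for the product.\<close>

lemma wlen_mult:
  assumes "x \<in> carrier \<Gamma>" "y \<in> carrier \<Gamma>" shows "wlen (x \<otimes> y) \<le> wlen x + wlen y"
proof -
  obtain l where l: "length l = wlen x" "set l \<subseteq> letters" "word_val l = x" using assms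
    by (blast elim: wlen_attained)
  obtain l' where l': "length l' = wlen y" "set l' \<subseteq> letters" "word_val l' = y" using assms by
      (blast elim: wlen_attained)
  show ?thesis using wlen_le[of "l @ l'"] l l' word_val_append[of l l'] by (simp del: foldr_append)
qed

section \<open>Weighted l1 norms on the group algebra\<close>

definition gnorm :: "nat \<Rightarrow> ('g \<Rightarrow>\<^sub>0 'k::real_normed_field) \<Rightarrow> real" where
  "gnorm n u = (\<Sum>\<gamma>\<in>Poly_Mapping.keys u. norm (Poly_Mapping.lookup u \<gamma>) * real (Suc n) ^ wlen \<gamma>)"

lemma group_algebra_eq: "group_algebra \<Gamma> S = monoid_algebra \<Gamma> gnorm"
  by (simp add: group_algebra_def gnorm_def[abs_def])

lemma gnorm_superset:
  assumes "finite X" "Poly_Mapping.keys u \<subseteq> X"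
  shows "gnorm n u = (\<Sum>\<gamma>\<in>X. norm (Poly_Mapping.lookup u \<gamma>) * real (Suc n) ^ wlen \<gamma>)"
  unfolding gnorm_def using assms by (intro sum.mono_neutral_left) (auto simp: in_keys_iff)

lemma gnorm_triangle: "gnorm n (u + v) \<le> gnorm n u + gnorm n v"
proof -
  let ?X = "Poly_Mapping.keys u \<union> Poly_Mapping.keys v"
  have "gnorm n (u + v) = (\<Sum>\<gamma>\<in>?X. norm (Poly_Mapping.lookup (u + v) \<gamma>) * real (Suc n) ^ wlen \<gamma>)"
    by (rule gnorm_superset) (simp_all add: keys_add)
  also have "\<dots> \<le> (\<Sum>\<gamma>\<in>?X. norm (Poly_Mapping.lookup u \<gamma>) * real (Suc n) ^ wlen \<gamma> + norm
      (Poly_Mapping.lookup v \<gamma>) * real (Suc n) ^ wlen \<gamma>)"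
    by (intro sum_mono) (simp add: lookup_add mult_right_mono norm_triangle_ineq flip:
        distrib_right)
  also have "\<dots> = gnorm n u + gnorm n v"
    by (simp add: sum.distrib gnorm_superset[of ?X])
  finally show ?thesis .
qed

lemma gnorm_zero [simp]: "gnorm n 0 = 0"
  by (simp add: gnorm_def)

lemma gnorm_sum: "gnorm n (sum f X) \<le> (\<Sum>x\<in>X. gnorm n (f x))"
proof (induction X rule: infinite_finite_induct)
  case (insert x X)
  then show ?case using gnorm_triangle[of n "f x" "sum f X"] by simp
qed simp_all

lemma gnorm_single [simp]: "gnorm n (Poly_Mapping.single \<gamma> c) = norm c * real (Suc n) ^ wlen \<gamma>"
  by (cases "c = 0") (simp_all add: gnorm_def)

text \<open>Subadditivity of the word length makes the weights submultiplicative, since their base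
  \<open>Suc n\<close> is at least 1.\<close>

lemma gnorm_mult:
  assumes "Poly_Mapping.keys u \<subseteq> carrier \<Gamma>" "Poly_Mapping.keys v \<subseteq> carrier \<Gamma>"
  shows "gnorm n (convolution \<Gamma> u v) \<le> gnorm n u * gnorm n v"
proof -
  let ?u = "Poly_Mapping.lookup u" and ?v = "Poly_Mapping.lookup v" and ?N = "real (Suc n)"
  have "gnorm n (convolution \<Gamma> u v) \<le> (\<Sum>x\<in>Poly_Mapping.keys u. \<Sum>y\<in>Poly_Mapping.keys v. norm (?u x *
      ?v y) * ?N ^ wlen (x \<otimes> y))"
    unfolding convolution_def
    by (rule order.trans[OF gnorm_sum], intro sum_mono, rule order.trans[OF gnorm_sum]) simp
  also have "\<dots> \<le> (\<Sum>x\<in>Poly_Mapping.keys u. \<Sum>y\<in>Poly_Mapping.keys v. norm (?u x * ?v y) * ?N ^ (wlen x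
      + wlen y))"
    using assms by (intro sum_mono mult_left_mono power_increasing wlen_mult) auto
  also have "\<dots> = gnorm n u * gnorm n v"
    by (simp add: gnorm_def sum_product norm_mult power_add mult_ac)
  finally show ?thesis .
qed

lemma seminormed_alg_group_algebra:
  "seminormed_alg (group_algebra \<Gamma> S :: ('k::real_normed_field, 'g \<Rightarrow>\<^sub>0 'k) seminormed_algebra)"
  unfolding group_algebra_eq
proof (rule seminormed_alg_monoid_algebra)
  fix n and c :: 'k and u :: "'g \<Rightarrow>\<^sub>0 'k"
  show "gnorm n (pm_scale c u) = norm c * gnorm n u"
    using gnorm_superset[OF finite_keys keys_pm_scale[of c u], of n]
    by (simp add: gnorm_def sum_distrib_left norm_mult mult.assoc)
  show "gnorm n u \<le> gnorm (Suc n) u"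
    unfolding gnorm_def by (intro sum_mono mult_left_mono power_mono) auto
qed (simp_all add: gnorm_triangle gnorm_mult)

lemma frechet_an_group_algebra:
  "frechet_alg (an_group_algebra \<Gamma> S :: ('k::real_normed_field, _) seminormed_algebra)"
  unfolding an_group_algebra_def
    by (rule seminormed_alg.frechet_alg_completion[OF seminormed_alg_group_algebra])

lemma universal_rep_closed:
  "\<gamma> \<in> carrier \<Gamma> \<Longrightarrow> universal_rep \<Gamma> S \<gamma> \<in> carrier (an_group_algebra \<Gamma> S :: ('k::real_normed_field, _)
      seminormed_algebra)"
  unfolding an_group_algebra_def universal_rep_def
  by (rule seminormed_alg.to_completion_closed[OF seminormed_alg_group_algebra]) (simp add:
      group_algebra_eq)

lemma universal_rep_mult:
  assumes "\<gamma> \<in> carrier \<Gamma>" "\<delta> \<in> carrier \<Gamma>"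
  shows "(universal_rep \<Gamma> S (\<gamma> \<otimes> \<delta>) :: (nat \<Rightarrow> ('g \<Rightarrow>\<^sub>0 'k::real_normed_field)) set)
    = universal_rep \<Gamma> S \<gamma> \<otimes>\<^bsub>an_group_algebra \<Gamma> S\<^esub> universal_rep \<Gamma> S \<delta>"
  using seminormed_alg.to_completion_mult[OF seminormed_alg_group_algebra[where 'k='k],
      of "Poly_Mapping.single \<gamma> 1" "Poly_Mapping.single \<delta> 1"] assms
  by (simp add: an_group_algebra_def universal_rep_def group_algebra_eq)

lemma universal_rep_one:
  "(universal_rep \<Gamma> S \<one> :: (nat \<Rightarrow> ('g \<Rightarrow>\<^sub>0 'k::real_normed_field)) set) = \<one>\<^bsub>an_group_algebra \<Gamma> S\<^esub>"
  using seminormed_alg.to_completion_one[OF seminormed_alg_group_algebra[where 'k='k]]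
  by (simp add: an_group_algebra_def universal_rep_def group_algebra_eq)

lemma eq_on_an_group_algebra:
  fixes F :: "('k::real_normed_field, 'f) seminormed_algebra"
  assumes "frechet_alg F"
    and "linear_map (an_group_algebra \<Gamma> S) F f" "bounded_map (an_group_algebra \<Gamma> S) F f"
    and "linear_map (an_group_algebra \<Gamma> S) F g" "bounded_map (an_group_algebra \<Gamma> S) F g"
    and "\<And>\<gamma>. \<gamma> \<in> carrier \<Gamma> \<Longrightarrow> f (universal_rep \<Gamma> S \<gamma>) = g (universal_rep \<Gamma> S \<gamma>)"
    and "X \<in> carrier (an_group_algebra \<Gamma> S)"
  shows "f X = g X"
  using assms seminormed_alg_group_algebra[where 'k='k] unfolding an_group_algebra_def
      universal_rep_def group_algebra_eq
  by (intro eq_on_completed_monoid_algebra[of \<Gamma> gnorm F f g X]) auto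

section \<open>Representability\<close>

text \<open>The values are automatically invertible: the image of the inverse is a two-sided
  inverse.\<close>

lemma hom_units_ofI:
  assumes "Group.monoid B" and closed: "\<And>x. x \<in> carrier \<Gamma> \<Longrightarrow> f x \<in> carrier B"
    and mult: "\<And>x y. x \<in> carrier \<Gamma> \<Longrightarrow> y \<in> carrier \<Gamma> \<Longrightarrow> f (x \<otimes> y) = f x \<otimes>\<^bsub>B\<^esub> f y"
    and one: "f \<one> = \<one>\<^bsub>B\<^esub>"
  shows "f \<in> hom \<Gamma> (units_of B)"
proof (rule homI)
  fix x assume x: "x \<in> carrier \<Gamma>"
  have "f (inv x) \<otimes>\<^bsub>B\<^esub> f x = \<one>\<^bsub>B\<^esub>" "f x \<otimes>\<^bsub>B\<^esub> f (inv x) = \<one>\<^bsub>B\<^esub>"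
    using x one by (simp_all flip: mult)
  then show "f x \<in> carrier (units_of B)"
    using x closed unfolding units_of_carrier Units_def by blast
qed (simp add: mult units_of_mult)

lemma hom_units_ofD:
  assumes "Group.monoid B" "f \<in> hom \<Gamma> (units_of B)"
  shows "x \<in> carrier \<Gamma> \<Longrightarrow> f x \<in> carrier B"
    and "x \<in> carrier \<Gamma> \<Longrightarrow> y \<in> carrier \<Gamma> \<Longrightarrow> f (x \<otimes> y) = f x \<otimes>\<^bsub>B\<^esub> f y"
    and "f \<one> = \<one>\<^bsub>B\<^esub>"
proof -
  interpret B: Group.monoid B by fact
  interpret h: group_hom \<Gamma> "units_of B" f
    using assms(2) by (intro group_hom.intro group_hom_axioms.intro B.units_group is_group)
  show "x \<in> carrier \<Gamma> \<Longrightarrow> f x \<in> carrier B" using h.hom_closed by (auto simp: units_of_carrier)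
  show "x \<in> carrier \<Gamma> \<Longrightarrow> y \<in> carrier \<Gamma> \<Longrightarrow> f (x \<otimes> y) = f x \<otimes>\<^bsub>B\<^esub> f y"
    using h.hom_mult by (simp add: units_of_mult)
  show "f \<one> = \<one>\<^bsub>B\<^esub>" using h.hom_one by (simp add: units_of_one)
qed

text \<open>The image of a word is a product of images of letters, so its seminorm is at most a
  power of a common bound for the finitely many letters. This is the role of finite generation in
  the representability.\<close>

lemma representation_growth:
  assumes "seminormed_alg B" "\<rho> \<in> hom \<Gamma> (units_of B)"
  obtains m D where "0 \<le> D" "\<And>\<gamma>. \<gamma> \<in> carrier \<Gamma> \<Longrightarrow> seminorm B n (\<rho> \<gamma>) \<le> D * real (Suc m) ^ wlen \<gamma>"
proof -
  interpret B: seminormed_alg B by fact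
  note \<rho> = hom_units_ofD[OF B.is_monoid assms(2)]
  \<comment> \<open>The sum over all letters bounds each single one; rounding up gives the natural
    number needed as an index of a norm.\<close>
  define m where "m = nat \<lceil>\<Sum>x\<in>letters. seminorm B n (\<rho> x)\<rceil>"
  have fin: "finite letters" using finite_S by simp
  have letter: "seminorm B n (\<rho> x) \<le> real (Suc m)" if "x \<in> letters" for x
  proof -
    have "seminorm B n (\<rho> x) \<le> (\<Sum>x\<in>letters. seminorm B n (\<rho> x))"
      using that fin letters_closed \<rho>(1) by (intro member_le_sum) auto
    then show ?thesis unfolding m_def by linarith
  qed
  \<comment> \<open>The empty word contributes the seminorm of the unit, which submultiplicativity
    does not force to be at most 1.\<close>
  have "seminorm B n (\<rho> (word_val l)) \<le> seminorm B n \<one>\<^bsub>B\<^esub> * real (Suc m) ^ length l" if "set l \<subseteq>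
      letters" for l
    using that
  proof (induction l)
    case (Cons a l)
    then have a: "a \<in> letters" "a \<in> carrier \<Gamma>" and l: "word_val l \<in> carrier \<Gamma>"
      using letters_closed word_val_closed[of l] by auto
    have "seminorm B n (\<rho> (word_val (a # l))) \<le> seminorm B n (\<rho> a) * seminorm B n (\<rho> (word_val l))"
      using a(2) l \<rho> by (simp add: B.seminorm_mult)
    also have "\<dots> \<le> real (Suc m) * (seminorm B n \<one>\<^bsub>B\<^esub> * real (Suc m) ^ length l)"
      using Cons letter[OF a(1)] l \<rho>(1) by (intro mult_mono) auto
    finally show ?case by (simp add: mult_ac)
  qed (simp add: \<rho>(3))
  then have "seminorm B n (\<rho> \<gamma>) \<le> seminorm B n \<one>\<^bsub>B\<^esub> * real (Suc m) ^ wlen \<gamma>" if "\<gamma> \<in> carrier \<Gamma>" for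
      \<gamma>
    using wlen_attained[OF that] by metis
  then show ?thesis using that[of "seminorm B n \<one>\<^bsub>B\<^esub>" m] by simp
qed

text \<open>The growth bound says that the linear extension of \<rho> is bounded by a multiple of
  \<open>gnorm m\<close>. Hence it extends to the completion, and multiplicativity survives the
  limit.\<close>

theorem corresponds_exists:
  fixes B :: "('k::real_normed_field, 'b) seminormed_algebra"
  assumes "frechet_alg B" "\<rho> \<in> hom \<Gamma> (units_of B)"
  shows "\<exists>\<phi>. corresponds \<Gamma> S B \<rho> \<phi>"
proof -
  interpret B: frechet_alg B by fact
  let ?K = "group_algebra \<Gamma> S :: ('k, 'g \<Rightarrow>\<^sub>0 'k) seminormed_algebra"
  interpret K: seminormed_alg ?K by (rule seminormed_alg_group_algebra)
  interpret A: frechet_alg "an_group_algebra \<Gamma> S :: ('k, _) seminormed_algebra"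
    by (rule frechet_an_group_algebra)
  note \<rho> = hom_units_ofD[OF B.is_monoid assms(2)]
  have lin: "linear_map ?K B (linear_ext B \<rho>)"
    unfolding group_algebra_eq using \<rho>(1) by (intro B.linear_map_linear_ext) auto
  have bdd: "bounded_map ?K B (linear_ext B \<rho>)"
    unfolding bounded_map_def
  proof
    fix n
    obtain m D where D: "0 \<le> D" "\<And>\<gamma>. \<gamma> \<in> carrier \<Gamma> \<Longrightarrow> seminorm B n (\<rho> \<gamma>) \<le> D * real (Suc m) ^ wlen \<gamma>"
      by (rule representation_growth[OF B.seminormed_alg_axioms assms(2), of n], rule that)
    have "seminorm B n (linear_ext B \<rho> u) \<le> D * gnorm m u" if u: "Poly_Mapping.keys u \<subseteq> carrier \<Gamma>"
        for u
    proof -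
      have "seminorm B n (linear_ext B \<rho> u) \<le> (\<Sum>\<gamma>\<in>Poly_Mapping.keys u. norm (Poly_Mapping.lookup u
          \<gamma>) * seminorm B n (\<rho> \<gamma>))"
        using u \<rho>(1) by (intro B.seminorm_linear_ext_le) auto
      also have "\<dots> \<le> (\<Sum>\<gamma>\<in>Poly_Mapping.keys u. norm (Poly_Mapping.lookup u \<gamma>) * (D * real (Suc m) ^
          wlen \<gamma>))"
        using u D(2) by (intro sum_mono mult_left_mono) auto
      also have "\<dots> = D * gnorm m u" by (simp add: gnorm_def sum_distrib_left mult.left_commute)
      finally show ?thesis .
    qed
    then show "\<exists>m C. 0 \<le> C \<and> (\<forall>u\<in>carrier ?K. seminorm B n (linear_ext B \<rho> u) \<le> C * seminorm ?K m u)"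
      using D(1) by (intro exI[of _ m] exI[of _ D]) (simp add: group_algebra_eq)
  qed
  interpret ext: bounded_into_frechet ?K B "linear_ext B \<rho>"
    by unfold_locales (rule lin bdd)+
  have hom: "linear_ext B \<rho> \<in> ring_hom ?K B"
    unfolding group_algebra_eq using \<rho> by (intro B.linear_ext_ring_hom is_monoid) auto
  have "corresponds \<Gamma> S B \<rho> (completion_lift ?K B (linear_ext B \<rho>))"
    unfolding corresponds_def continuous_alg_hom_def
  proof (intro conjI ballI assms(2))
    show "continuous_linear (an_group_algebra \<Gamma> S) B (completion_lift ?K B (linear_ext B \<rho>))"
      using ext.completion_lift_linear ext.completion_lift_bounded
      by (simp add: continuous_linear_iff_bounded A.seminormed_alg_axioms B.seminormed_alg_axioms
          flip: an_group_algebra_def)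
    show "completion_lift ?K B (linear_ext B \<rho>) (universal_rep \<Gamma> S \<gamma>) = \<rho> \<gamma>" if "\<gamma> \<in> carrier \<Gamma>" for
        \<gamma>
      using that \<rho>(1) ext.completion_lift_to_completion[of "Poly_Mapping.single \<gamma> 1"]
      by (simp add: universal_rep_def group_algebra_eq)
  qed (use ext.completion_lift_extensional ext.completion_lift_ring_hom[OF hom] in \<open>simp_all add:
      an_group_algebra_def\<close>)
  then show ?thesis by blast
qed

lemma corresponds_bounded_linear:
  fixes B :: "('k::real_normed_field, 'b) seminormed_algebra"
  assumes "frechet_alg B" "corresponds \<Gamma> S B \<rho> \<phi>"
  shows "linear_map (an_group_algebra \<Gamma> S) B \<phi>" "bounded_map (an_group_algebra \<Gamma> S) B \<phi>"
    and "\<And>\<gamma>. \<gamma> \<in> carrier \<Gamma> \<Longrightarrow> \<phi> (universal_rep \<Gamma> S \<gamma>) = \<rho> \<gamma>"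
proof -
  interpret A: frechet_alg "an_group_algebra \<Gamma> S :: ('k, _) seminormed_algebra"
    by (rule frechet_an_group_algebra)
  interpret B: frechet_alg B by fact
  show "linear_map (an_group_algebra \<Gamma> S) B \<phi>" "bounded_map (an_group_algebra \<Gamma> S) B \<phi>"
    "\<And>\<gamma>. \<gamma> \<in> carrier \<Gamma> \<Longrightarrow> \<phi> (universal_rep \<Gamma> S \<gamma>) = \<rho> \<gamma>"
    using assms(2)
      by (simp_all add: corresponds_def continuous_alg_hom_def continuous_linear_iff_bounded
        A.seminormed_alg_axioms B.seminormed_alg_axioms)
qed

text \<open>Agreement on the carrier follows from density of the span of \<Gamma>; the
  extensionality in \<open>corresponds\<close> turns it into equality of functions.\<close>

theorem corresponds_unique:
  fixes B :: "('k::real_normed_field, 'b) seminormed_algebra"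
  assumes "frechet_alg B" "corresponds \<Gamma> S B \<rho> \<phi>" "corresponds \<Gamma> S B \<rho> \<psi>"
  shows "\<phi> = \<psi>"
proof (rule extensionalityI)
  show "\<phi> \<in> extensional (carrier (an_group_algebra \<Gamma> S))" "\<psi> \<in> extensional (carrier
      (an_group_algebra \<Gamma> S))"
    using assms(2,3) by (auto simp: corresponds_def)
  show "\<phi> X = \<psi> X" if "X \<in> carrier (an_group_algebra \<Gamma> S)" for X
    using that corresponds_bounded_linear[OF assms(1,2)] corresponds_bounded_linear[OF assms(1,3)]
    by (intro eq_on_an_group_algebra[OF assms(1), of \<phi> \<psi> X]) auto
qed

end


section \<open>Tensor products of maps\<close>

text \<open>Sums and multiples of bounded linear maps serve the associator, where linearity in the
  third factor is an identity between maps of this kind.\<close>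

lemma linear_map_plus:
  assumes "seminormed_alg B" "linear_map A B f" "linear_map A B g"
  shows "linear_map A B (\<lambda>x. f x \<oplus>\<^bsub>B\<^esub> g x)"
proof -
  interpret B: seminormed_alg B by fact
  show ?thesis using assms(2,3)
    by (auto simp: linear_map_def Pi_iff B.smult_add_right B.a_ac)
qed

lemma bounded_map_plus:
  assumes "seminormed_alg A" "seminormed_alg B" "linear_map A B f" "linear_map A B g" "bounded_map A
      B f" "bounded_map A B g"
  shows "bounded_map A B (\<lambda>x. f x \<oplus>\<^bsub>B\<^esub> g x)"
  unfolding bounded_map_def
proof
  fix n
  interpret A: seminormed_alg A by fact
  interpret B: seminormed_alg B by fact
  obtain m C where C: "0 \<le> C" "\<And>x. x \<in> carrier A \<Longrightarrow> seminorm B n (f x) \<le> C * seminorm A m x"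
    by (rule bounded_mapE[OF assms(5), of n], rule that)
  obtain l D where D: "0 \<le> D" "\<And>x. x \<in> carrier A \<Longrightarrow> seminorm B n (g x) \<le> D * seminorm A l x"
    by (rule bounded_mapE[OF assms(6), of n], rule that)
  have "seminorm B n (f x \<oplus>\<^bsub>B\<^esub> g x) \<le> (C + D) * seminorm A (max m l) x" if x: "x \<in> carrier A" for x
  proof -
    have "seminorm B n (f x \<oplus>\<^bsub>B\<^esub> g x) \<le> seminorm B n (f x) + seminorm B n (g x)"
      using x assms(3,4) by (simp add: B.seminorm_triangle linear_map_closed)
    also have "\<dots> \<le> C * seminorm A m x + D * seminorm A l x" using C D x by (intro add_mono) auto
    also have "\<dots> \<le> C * seminorm A (max m l) x + D * seminorm A (max m l) x"
      using C D x by (intro add_mono mult_left_mono A.seminorm_mono) auto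
    finally show ?thesis by (simp add: distrib_right)
  qed
  then show "\<exists>m C. 0 \<le> C \<and> (\<forall>x\<in>carrier A. seminorm B n (f x \<oplus>\<^bsub>B\<^esub> g x) \<le> C * seminorm A m x)"
    using C D by (intro exI[of _ "max m l"] exI[of _ "C + D"]) auto
qed

lemma linear_map_scale:
  fixes B :: "('k::real_normed_field, 'b) seminormed_algebra"
  assumes "seminormed_alg B" "linear_map A B f"
  shows "linear_map A B (\<lambda>x. c \<odot>\<^bsub>B\<^esub> f x)"
proof -
  interpret B: seminormed_alg B by fact
  show ?thesis using assms(2)
    by (auto simp: linear_map_def Pi_iff B.smult_add_right mult.commute simp flip: B.smult_smult)
qed

lemma bounded_map_scale:
  fixes B :: "('k::real_normed_field, 'b) seminormed_algebra"
  assumes "seminormed_alg B" "linear_map A B f" "bounded_map A B f"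
  shows "bounded_map A B (\<lambda>x. c \<odot>\<^bsub>B\<^esub> f x)"
  unfolding bounded_map_def
proof
  fix n
  interpret B: seminormed_alg B by fact
  obtain m C where C: "0 \<le> C" "\<And>x. x \<in> carrier A \<Longrightarrow> seminorm B n (f x) \<le> C * seminorm A m x"
    by (rule bounded_mapE[OF assms(3), of n], rule that)
  have "seminorm B n (c \<odot>\<^bsub>B\<^esub> f x) \<le> (norm c * C) * seminorm A m x" if x: "x \<in> carrier A" for x
    using mult_left_mono[OF C(2)[OF x], of "norm c"] x
    by (simp add: B.seminorm_smult linear_map_closed[OF assms(2)] mult.assoc)
  then show "\<exists>m D. 0 \<le> D \<and> (\<forall>x\<in>carrier A. seminorm B n (c \<odot>\<^bsub>B\<^esub> f x) \<le> D * seminorm A m x)"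
    using C(1) by (intro exI[of _ m] exI[of _ "norm c * C"]) auto
qed

lemma linear_map_id: "linear_map A A id"
  by (simp add: linear_map_def)

lemma bounded_map_id: "bounded_map A A id"
  unfolding bounded_map_def by (intro allI exI[of _ 1] exI) auto

lemma tensor_map_bilinear:
  fixes A :: "('k::real_normed_field, 'a) seminormed_algebra"
  assumes alg: "seminormed_alg A" "seminormed_alg B" "seminormed_alg A'" "seminormed_alg B'"
    and f: "linear_map A A' f" "bounded_map A A' f" and g: "linear_map B B' g" "bounded_map B B' g"
  shows "bounded_bilinear_into_frechet A B (projective_tensor A' B') (\<lambda>a b. pure_tensor A' B' (f a)
      (g b))"
proof -
  interpret A: seminormed_alg A by fact
  interpret B: seminormed_alg B by fact
  interpret A': seminormed_alg A' by fact
  interpret B': seminormed_alg B' by fact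
  interpret P: tensor_factors A B ..
  interpret P': tensor_factors A' B' ..
  show ?thesis
  proof
    show "bilinear_map A B (projective_tensor A' B') (\<lambda>a b. pure_tensor A' B' (f a) (g b))"
      unfolding bilinear_map_def
    proof (intro conjI ballI)
      fix a assume "a \<in> carrier A"
      then have "linear_map B' (projective_tensor A' B') (pure_tensor A' B' (f a))"
        using P'.bilinear_pure_tensor linear_map_closed[OF f(1)] by (simp add: bilinear_map_def)
      from linear_map_comp[OF g(1) this] show "linear_map B (projective_tensor A' B') (\<lambda>b.
          pure_tensor A' B' (f a) (g b))" .
    next
      fix b assume "b \<in> carrier B"
      then have "linear_map A' (projective_tensor A' B') (\<lambda>a. pure_tensor A' B' a (g b))"
        using P'.bilinear_pure_tensor linear_map_closed[OF g(1)] by (simp add: bilinear_map_def)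
      from linear_map_comp[OF f(1) this] show "linear_map A (projective_tensor A' B') (\<lambda>a.
          pure_tensor A' B' (f a) (g b))" .
    qed
    fix n
    obtain m C where C: "0 \<le> C" "\<And>x. x \<in> carrier A \<Longrightarrow> seminorm A' n (f x) \<le> C * seminorm A m x"
      by (rule bounded_mapE[OF f(2), of n], rule that)
    obtain l D where D: "0 \<le> D" "\<And>x. x \<in> carrier B \<Longrightarrow> seminorm B' n (g x) \<le> D * seminorm B l x"
      by (rule bounded_mapE[OF g(2), of n], rule that)
    \<comment> \<open>The bounds for \<open>f\<close> and \<open>g\<close> may use different
      indices, while a bilinear bound wants one for both; by monotonicity \<open>max m l\<close>
      serves.\<close>
    have "seminorm (projective_tensor A' B') n (pure_tensor A' B' (f a) (g b))
        \<le> (C * D) * (seminorm A (max m l) a * seminorm B (max m l) b)" if ab: "a \<in> carrier A" "b \<in>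
            carrier B" for a b
    proof -
      note cl = linear_map_closed[OF f(1) ab(1)] linear_map_closed[OF g(1) ab(2)]
      have "seminorm A' n (f a) \<le> C * seminorm A (max m l) a"
        using C ab by (intro order.trans[OF C(2)] mult_left_mono A.seminorm_mono) auto
      moreover have "seminorm B' n (g b) \<le> D * seminorm B (max m l) b"
        using D ab by (intro order.trans[OF D(2)] mult_left_mono B.seminorm_mono) auto
      ultimately have "seminorm A' n (f a) * seminorm B' n (g b) \<le> (C * seminorm A (max m l) a) * (D
          * seminorm B (max m l) b)"
        using C D ab cl by (intro mult_mono) auto
      with P'.seminorm_pure_tensor_le[OF cl, of n] show ?thesis by (simp add: mult_ac)
    qed
    then have "bilinear_bound A B (projective_tensor A' B') (\<lambda>a b. pure_tensor A' B' (f a) (g b)) n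
        (max m l) (C * D)"
      using C D by (simp add: bilinear_bound_def)
    then show "\<exists>m E. bilinear_bound A B (projective_tensor A' B') (\<lambda>a b. pure_tensor A' B' (f a) (g
        b)) n m E" by blast
  qed
qed

lemma tensor_map_props:
  fixes A :: "('k::real_normed_field, 'a) seminormed_algebra"
  assumes "seminormed_alg A" "seminormed_alg B" "seminormed_alg A'" "seminormed_alg B'"
    and "linear_map A A' f" "bounded_map A A' f" "linear_map B B' g" "bounded_map B B' g"
  shows "linear_map (projective_tensor A B) (projective_tensor A' B') (tensor_map A B A' B' f g)"
    and "bounded_map (projective_tensor A B) (projective_tensor A' B') (tensor_map A B A' B' f g)"
    and "\<And>a b. a \<in> carrier A \<Longrightarrow> b \<in> carrier B \<Longrightarrow>
      tensor_map A B A' B' f g (pure_tensor A B a b) = pure_tensor A' B' (f a) (g b)"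
proof -
  interpret bounded_bilinear_into_frechet A B "projective_tensor A' B'" "\<lambda>a b. pure_tensor A' B' (f
      a) (g b)"
    by (rule tensor_map_bilinear[OF assms])
  show "linear_map (projective_tensor A B) (projective_tensor A' B') (tensor_map A B A' B' f g)"
    "bounded_map (projective_tensor A B) (projective_tensor A' B') (tensor_map A B A' B' f g)"
    "\<And>a b. a \<in> carrier A \<Longrightarrow> b \<in> carrier B \<Longrightarrow>
      tensor_map A B A' B' f g (pure_tensor A B a b) = pure_tensor A' B' (f a) (g b)"
    unfolding tensor_map_def
      by (simp_all add: tensor_lift_linear tensor_lift_bounded tensor_lift_pure)
qed

text \<open>The associator is a lift of lifts: the inner one is formed for each fixed
  \<open>d\<close>. The work lies in showing that the inner lift depends linearly and boundedly on
  \<open>d\<close>.\<close>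

lemma tensor_assoc_props:
  fixes A :: "('k::real_normed_field, 'a) seminormed_algebra"
  assumes "seminormed_alg A" "seminormed_alg B" "seminormed_alg D"
  defines "F \<equiv> projective_tensor A (projective_tensor B D)"
  shows "linear_map (projective_tensor (projective_tensor A B) D) F (tensor_assoc A B D)"
    and "bounded_map (projective_tensor (projective_tensor A B) D) F (tensor_assoc A B D)"
    and "\<And>a b d. a \<in> carrier A \<Longrightarrow> b \<in> carrier B \<Longrightarrow> d \<in> carrier D \<Longrightarrow>
      tensor_assoc A B D (pure_tensor (projective_tensor A B) D (pure_tensor A B a b) d)
        = pure_tensor A (projective_tensor B D) a (pure_tensor B D b d)"
proof -
  interpret A: seminormed_alg A by fact
  interpret B: seminormed_alg B by fact
  interpret D: seminormed_alg D by fact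
  interpret AB: tensor_factors A B ..
  interpret BD: tensor_factors B D ..
  interpret F: tensor_factors A "projective_tensor B D" ..
  interpret ABD: tensor_factors "projective_tensor A B" D ..
  let ?\<gamma> = "\<lambda>d a b. pure_tensor A (projective_tensor B D) a (pure_tensor B D b d)"
  let ?\<beta> = "\<lambda>t d. tensor_lift A B F (?\<gamma> d) t"
  have frechet_F: "frechet_alg F" unfolding F_def by (rule F.PT.frechet_alg_axioms)
  interpret FF: frechet_alg F by (rule frechet_F)
  \<comment> \<open>Explicit index and constant are kept here: the constant is a seminorm of
    \<open>d\<close>, which becomes the second factor of the outer bilinear bound.\<close>
  have \<gamma>_bound: "bilinear_bound A B F (?\<gamma> d) n n (seminorm D n d)" if d: "d \<in> carrier D" for d n
    unfolding bilinear_bound_def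
  proof (intro conjI ballI)
    fix a b assume ab: "a \<in> carrier A" "b \<in> carrier B"
    have "seminorm F n (?\<gamma> d a b) \<le> seminorm A n a * seminorm (projective_tensor B D) n (pure_tensor
        B D b d)"
      unfolding F_def using ab d by (intro F.seminorm_pure_tensor_le) auto
    also have "\<dots> \<le> seminorm A n a * (seminorm B n b * seminorm D n d)"
      using ab d by (intro mult_left_mono BD.seminorm_pure_tensor_le) auto
    finally show "seminorm F n (?\<gamma> d a b) \<le> seminorm D n d * (seminorm A n a * seminorm B n b)" by
        (simp add: mult_ac)
  qed (use d in simp)
  have \<gamma>: "bounded_bilinear_into_frechet A B F (?\<gamma> d)" if d: "d \<in> carrier D" for d
  proof
    show "bilinear_map A B F (?\<gamma> d)"
      unfolding bilinear_map_def
    proof (intro conjI ballI)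
      fix a assume "a \<in> carrier A"
      then have "linear_map (projective_tensor B D) F (pure_tensor A (projective_tensor B D) a)"
        using F.bilinear_pure_tensor by (simp add: bilinear_map_def F_def)
      moreover have "linear_map B (projective_tensor B D) (\<lambda>b. pure_tensor B D b d)"
        using BD.bilinear_pure_tensor d by (simp add: bilinear_map_def)
      ultimately show "linear_map B F (?\<gamma> d a)" by (rule linear_map_comp[rotated])
    next
      fix b assume "b \<in> carrier B"
      then show "linear_map A F (\<lambda>a. ?\<gamma> d a b)"
        using F.bilinear_pure_tensor d BD.pure_tensor_closed by (simp add: bilinear_map_def F_def)
    qed
    show "\<exists>m C. bilinear_bound A B F (?\<gamma> d) n m C" for n using \<gamma>_bound[OF d] by blast
  qed
  note lift_lin = bounded_bilinear_into_frechet.tensor_lift_linear[OF \<gamma>]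
    and lift_bdd = bounded_bilinear_into_frechet.tensor_lift_bounded[OF \<gamma>]
    and lift_pure = bounded_bilinear_into_frechet.tensor_lift_pure[OF \<gamma>]
  have pure_right: "linear_map D (projective_tensor B D) (pure_tensor B D b)" if "b \<in> carrier B" for
      b
    using BD.bilinear_pure_tensor that by (simp add: bilinear_map_def)
  have pure_F: "linear_map (projective_tensor B D) F (pure_tensor A (projective_tensor B D) a)" if
      "a \<in> carrier A" for a
    using F.bilinear_pure_tensor that by (simp add: bilinear_map_def F_def)
  have \<gamma>_lin: "linear_map D F (\<lambda>d. ?\<gamma> d a b)" if "a \<in> carrier A" "b \<in> carrier B" for a b
    by (rule linear_map_comp[OF pure_right[OF that(2)] pure_F[OF that(1)]])
  interpret \<beta>: bounded_bilinear_into_frechet "projective_tensor A B" D F ?\<beta>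
  proof
    show "bilinear_map (projective_tensor A B) D F ?\<beta>"
      unfolding bilinear_map_def
    proof (intro conjI ballI)
      fix t assume t: "t \<in> carrier (projective_tensor A B)"
      show "linear_map D F (\<lambda>d. ?\<beta> t d)"
        unfolding linear_map_def
      proof (intro conjI ballI allI)
        show "(\<lambda>d. ?\<beta> t d) \<in> carrier D \<rightarrow> carrier F" using linear_map_closed[OF lift_lin t] by auto
      next
        fix d d' assume d: "d \<in> carrier D" "d' \<in> carrier D"
        \<comment> \<open>For fixed \<open>d\<close> and \<open>d'\<close> both sides are bounded
          linear in \<open>t\<close>, so it suffices to compare them on pure tensors.\<close>
        show "?\<beta> t (d \<oplus>\<^bsub>D\<^esub> d') = ?\<beta> t d \<oplus>\<^bsub>F\<^esub> ?\<beta> t d'"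
        proof (rule AB.eq_on_projective_tensor[OF frechet_F _ _ _ _ _ t])
          show "linear_map (projective_tensor A B) F (\<lambda>t. ?\<beta> t d \<oplus>\<^bsub>F\<^esub> ?\<beta> t d')"
            using d by (intro linear_map_plus FF.seminormed_alg_axioms lift_lin) auto
          show "bounded_map (projective_tensor A B) F (\<lambda>t. ?\<beta> t d \<oplus>\<^bsub>F\<^esub> ?\<beta> t d')"
            using d
              by (intro bounded_map_plus AB.PT.seminormed_alg_axioms FF.seminormed_alg_axioms lift_lin lift_bdd) auto
          show "?\<beta> (pure_tensor A B a b) (d \<oplus>\<^bsub>D\<^esub> d') = ?\<beta> (pure_tensor A B a b) d \<oplus>\<^bsub>F\<^esub> ?\<beta>
              (pure_tensor A B a b) d'"
            if "a \<in> carrier A" "b \<in> carrier B" for a b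
            using that d linear_map_add[OF \<gamma>_lin[OF that]] by (simp add: lift_pure)
        qed (use d in \<open>simp_all add: lift_lin lift_bdd\<close>)
      next
        fix c d assume d: "d \<in> carrier D"
        show "?\<beta> t (c \<odot>\<^bsub>D\<^esub> d) = c \<odot>\<^bsub>F\<^esub> ?\<beta> t d"
        proof (rule AB.eq_on_projective_tensor[OF frechet_F _ _ _ _ _ t])
          show "linear_map (projective_tensor A B) F (\<lambda>t. c \<odot>\<^bsub>F\<^esub> ?\<beta> t d)"
            using d by (intro linear_map_scale FF.seminormed_alg_axioms lift_lin)
          show "bounded_map (projective_tensor A B) F (\<lambda>t. c \<odot>\<^bsub>F\<^esub> ?\<beta> t d)"
            using d by (intro bounded_map_scale FF.seminormed_alg_axioms lift_lin lift_bdd)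
          show "?\<beta> (pure_tensor A B a b) (c \<odot>\<^bsub>D\<^esub> d) = c \<odot>\<^bsub>F\<^esub> ?\<beta> (pure_tensor A B a b) d"
            if "a \<in> carrier A" "b \<in> carrier B" for a b
            using that d linear_map_smult[OF \<gamma>_lin[OF that]] by (simp add: lift_pure)
        qed (use d in \<open>simp_all add: lift_lin lift_bdd\<close>)
      qed
    qed (simp add: lift_lin)
    fix n
    \<comment> \<open>The inner lift inherits the constant \<open>seminorm D n d\<close>, so the
      outer bound has constant 1 at the same index.\<close>
    have "bilinear_bound (projective_tensor A B) D F ?\<beta> n n 1"
      using bounded_bilinear_into_frechet.tensor_lift_bound[OF \<gamma> \<gamma>_bound]
      by (simp add: bilinear_bound_def mult.commute)
    then show "\<exists>m C. bilinear_bound (projective_tensor A B) D F ?\<beta> n m C" by blast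
  qed
  have eq: "tensor_assoc A B D = tensor_lift (projective_tensor A B) D F ?\<beta>"
    by (simp add: tensor_assoc_def F_def)
  show "linear_map (projective_tensor (projective_tensor A B) D) F (tensor_assoc A B D)"
    "bounded_map (projective_tensor (projective_tensor A B) D) F (tensor_assoc A B D)"
    unfolding eq by (rule \<beta>.tensor_lift_linear \<beta>.tensor_lift_bounded)+
  show "tensor_assoc A B D (pure_tensor (projective_tensor A B) D (pure_tensor A B a b) d)
        = pure_tensor A (projective_tensor B D) a (pure_tensor B D b d)"
    if "a \<in> carrier A" "b \<in> carrier B" "d \<in> carrier D" for a b d
    unfolding eq using that by (simp add: \<beta>.tensor_lift_pure lift_pure)
qed


section \<open>Coefficient functionals\<close>

context generated_group
begin

text \<open>The continuous extension of \<open>Poly_Mapping.lookup\<close> at \<gamma>. It is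
  written as the linear extension of a delta function so that linearity comes from the general
  lemmas; \<open>ground\<close> must be complete to receive the lift.\<close>

definition coeff :: "'g \<Rightarrow> (nat \<Rightarrow> ('g \<Rightarrow>\<^sub>0 'k)) set \<Rightarrow> 'k::{real_normed_field, banach}" where
  "coeff \<gamma> = completion_lift (group_algebra \<Gamma> S) ground (linear_ext ground (\<lambda>x. if x = \<gamma> then 1 else
      0))"

lemma linear_ext_delta:
  "linear_ext ground (\<lambda>x. if x = \<gamma> then 1 else 0) u = Poly_Mapping.lookup (u :: 'g \<Rightarrow>\<^sub>0
      'k::{real_normed_field, banach}) \<gamma>"
proof -
  interpret k: frechet_alg "ground :: ('k, 'k) seminormed_algebra" by (rule frechet_alg_ground)
  have "Poly_Mapping.keys u \<subseteq> UNIV" by simp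
  then show ?thesis
  proof (induction u rule: poly_mapping_keys_induct)
    case (add u v)
    then show ?case by (simp add: k.linear_ext_add[of _ UNIV] lookup_add)
  qed (simp_all add: lookup_single when_def)
qed

text \<open>All weights are at least 1, so each norm dominates each coefficient.\<close>

lemma norm_lookup_le_gnorm: "norm (Poly_Mapping.lookup u \<gamma>) \<le> gnorm n u"
proof (cases "\<gamma> \<in> Poly_Mapping.keys u")
  case True
  have "norm (Poly_Mapping.lookup u \<gamma>) * 1 \<le> norm (Poly_Mapping.lookup u \<gamma>) * real (Suc n) ^ wlen \<gamma>"
    by (intro mult_left_mono one_le_power) auto
  also have "\<dots> \<le> gnorm n u"
    unfolding gnorm_def using True by (intro member_le_sum) auto
  finally show ?thesis by simp
next
  case False
  then show ?thesis by (simp add: in_keys_iff gnorm_def sum_nonneg)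
qed

lemma coeff_bounded_into:
  "bounded_into_frechet (group_algebra \<Gamma> S) (ground :: ('k::{real_normed_field, banach}, 'k)
      seminormed_algebra)
     (linear_ext ground (\<lambda>x. if x = \<gamma> then 1 else 0))"
proof -
  interpret k: frechet_alg "ground :: ('k, 'k) seminormed_algebra" by (rule frechet_alg_ground)
  interpret K: seminormed_alg "group_algebra \<Gamma> S :: ('k, 'g \<Rightarrow>\<^sub>0 'k) seminormed_algebra"
    by (rule seminormed_alg_group_algebra)
  show ?thesis
  proof
    show "linear_map (group_algebra \<Gamma> S) (ground :: ('k, 'k) seminormed_algebra) (linear_ext ground
        (\<lambda>x. if x = \<gamma> then 1 else 0))"
      unfolding group_algebra_eq by (intro k.linear_map_linear_ext) auto
    show "bounded_map (group_algebra \<Gamma> S) (ground :: ('k, 'k) seminormed_algebra) (linear_ext ground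
        (\<lambda>x. if x = \<gamma> then 1 else 0))"
      unfolding bounded_map_def linear_ext_delta group_algebra_eq
      by (intro allI exI[of _ "0::nat"] exI[of _ "1::real"]) (simp add: norm_lookup_le_gnorm)
  qed
qed

lemma linear_coeff: "linear_map (an_group_algebra \<Gamma> S) ground (coeff \<gamma> :: _ \<Rightarrow>
    'k::{real_normed_field, banach})"
  unfolding coeff_def an_group_algebra_def
  by (rule bounded_into_frechet.completion_lift_linear[OF coeff_bounded_into])

lemma coeff_universal_rep:
  "\<delta> \<in> carrier \<Gamma> \<Longrightarrow> coeff \<gamma> (universal_rep \<Gamma> S \<delta>) = (if \<delta> = \<gamma> then 1 else 0 ::
      'k::{real_normed_field, banach})"
  unfolding coeff_def universal_rep_def
  by (subst bounded_into_frechet.completion_lift_to_completion[OF coeff_bounded_into])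
    (simp_all add: group_algebra_eq linear_ext_delta lookup_single when_def)

lemma norm_coeff_le:
  fixes X :: "(nat \<Rightarrow> ('g \<Rightarrow>\<^sub>0 'k::{real_normed_field, banach})) set"
  assumes "X \<in> carrier (an_group_algebra \<Gamma> S)"
  shows "norm (coeff \<gamma> X) \<le> seminorm (an_group_algebra \<Gamma> S) n X"
  using bounded_into_frechet.completion_lift_bound[OF coeff_bounded_into[where 'k='k], of n \<gamma> 1 n X]
      assms
  by (simp add: coeff_def an_group_algebra_def linear_ext_delta group_algebra_eq
      norm_lookup_le_gnorm)

text \<open>A representing sequence tends to 0 in each coefficient. The Cauchy condition upgrades
  this to convergence in every norm, because the norms are sums of weighted absolute values of
  coefficients.\<close>

lemma eq_zero_if_coeff_zero:
  fixes X :: "(nat \<Rightarrow> ('g \<Rightarrow>\<^sub>0 'k::{real_normed_field, banach})) set"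
  assumes X: "X \<in> carrier (an_group_algebra \<Gamma> S)" and zero: "\<And>\<gamma>. \<gamma> \<in> carrier \<Gamma> \<Longrightarrow> coeff \<gamma> X = 0"
  shows "X = \<zero>\<^bsub>an_group_algebra \<Gamma> S\<^esub>"
proof -
  let ?K = "group_algebra \<Gamma> S :: ('k, 'g \<Rightarrow>\<^sub>0 'k) seminormed_algebra"
  interpret K: seminormed_alg ?K by (rule seminormed_alg_group_algebra)
  interpret A: frechet_alg "an_group_algebra \<Gamma> S :: ('k, _) seminormed_algebra"
    by (rule frechet_an_group_algebra)
  interpret k: frechet_alg "ground :: ('k, 'k) seminormed_algebra" by (rule frechet_alg_ground)
  obtain s where s: "s \<in> cauchy_seqs ?K" and Xs: "X = K.cls s"
    using X by (auto simp: an_group_algebra_def elim: K.completionE)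
  have keys: "Poly_Mapping.keys (s i) \<subseteq> carrier \<Gamma>" for i
    using cauchy_seqsD[OF s, of i] by (simp add: group_algebra_eq)
  \<comment> \<open>A coefficient of \<open>X\<close> is by construction the limit of the
    coefficients of the representing sequence.\<close>
  have lim: "(\<lambda>i. Poly_Mapping.lookup (s i) \<gamma>) \<longlonglongrightarrow> 0" if "\<gamma> \<in> carrier \<Gamma>" for \<gamma>
  proof -
    have "converges_to ground (\<lambda>i. linear_ext ground (\<lambda>x. if x = \<gamma> then 1 else 0) (s i)) (coeff \<gamma>
        X)"
      unfolding coeff_def Xs
        by (rule bounded_into_frechet.completion_lift_cls(2)[OF coeff_bounded_into s])
    then show ?thesis
      using zero[OF that] by (simp add: converges_to_def linear_ext_delta tendsto_norm_zero_iff)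
  qed
  have "seminorm (an_group_algebra \<Gamma> S) n X \<le> e" if e: "e > 0" for n e
  proof -
    obtain N where N: "\<And>i j. i \<ge> N \<Longrightarrow> j \<ge> N \<Longrightarrow> gnorm n (s i - s j) < e"
    proof (rule cauchy_seqsE[OF s e, of n])
      fix N assume *: "\<And>i j. N \<le> i \<Longrightarrow> N \<le> j \<Longrightarrow> seminorm ?K n (s i \<ominus>\<^bsub>?K\<^esub> s j) < e"
      have "seminorm ?K n (s i \<ominus>\<^bsub>?K\<^esub> s j) = gnorm n (s i - s j)" for i j
        using minus_monoid_algebra[OF _ keys keys, of gnorm i j] K.seminormed_alg_axioms
          by (simp add: group_algebra_eq)
      with * show thesis by (intro that[of N]) simp
    qed
    \<comment> \<open>The support of \<open>s i\<close> is finite, so \<open>j \<rightarrow> \<infinity>\<close> is allowed in \<open>gnorm n (s i - s j) < e\<close> there.\<close>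
    have "gnorm n (s i) \<le> e" if i: "i \<ge> N" for i
    proof (rule LIMSEQ_le_const2)
      have "(\<lambda>j. \<Sum>\<gamma>\<in>Poly_Mapping.keys (s i). norm (Poly_Mapping.lookup (s i - s j) \<gamma>) * real (Suc n)
          ^ wlen \<gamma>)
          \<longlonglongrightarrow> (\<Sum>\<gamma>\<in>Poly_Mapping.keys (s i). norm (Poly_Mapping.lookup (s i) \<gamma> - 0) * real (Suc n) ^
              wlen \<gamma>)"
        unfolding lookup_minus using keys by (intro tendsto_intros lim) auto
      then show "(\<lambda>j. \<Sum>\<gamma>\<in>Poly_Mapping.keys (s i). norm (Poly_Mapping.lookup (s i - s j) \<gamma>) * real
          (Suc n) ^ wlen \<gamma>) \<longlonglongrightarrow> gnorm n (s i)"
        by (simp add: gnorm_def)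
      \<comment> \<open>Restricting the sum to the support of \<open>s i\<close> drops only
        non-negative terms.\<close>
      have "(\<Sum>\<gamma>\<in>Poly_Mapping.keys (s i). norm (Poly_Mapping.lookup (s i - s j) \<gamma>) * real (Suc n) ^
          wlen \<gamma>) \<le> gnorm n (s i - s j)" for j
      proof -
        have "gnorm n (s i - s j) = (\<Sum>\<gamma>\<in>Poly_Mapping.keys (s i) \<union> Poly_Mapping.keys (s j).
            norm (Poly_Mapping.lookup (s i - s j) \<gamma>) * real (Suc n) ^ wlen \<gamma>)"
          by (rule gnorm_superset) (simp_all add: keys_minus)
        then show ?thesis by (auto intro!: sum_mono2)
      qed
      then show "\<exists>N. \<forall>j\<ge>N. (\<Sum>\<gamma>\<in>Poly_Mapping.keys (s i). norm (Poly_Mapping.lookup (s i - s j) \<gamma>) *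
          real (Suc n) ^ wlen \<gamma>) \<le> e"
        using N[OF i] by (meson less_imp_le order.trans)
    qed
    moreover have "(\<lambda>i. gnorm n (s i)) \<longlonglongrightarrow> seminorm (an_group_algebra \<Gamma> S) n X"
      using K.seminorm_cls[OF s, of n]
        by (simp add: an_group_algebra_def Xs) (simp add: group_algebra_eq)
    ultimately show ?thesis by (intro LIMSEQ_le_const2[of "\<lambda>i. gnorm n (s i)"]) auto
  qed
  then have "seminorm (an_group_algebra \<Gamma> S) n X = 0" for n
    using X by (intro antisym[OF field_le_epsilon]) auto
  then show ?thesis using X by (intro A.hausdorff)
qed

end


section \<open>The bialgebra and its grouplike elements\<close>

locale an_bialgebra = generated_group \<Gamma> S
  for \<Gamma> :: "('g, 'm) monoid_scheme" (structure) and S :: "'g set" +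
  fixes A :: "('k::{real_normed_field, banach}, (nat \<Rightarrow> ('g \<Rightarrow>\<^sub>0 'k)) set) seminormed_algebra"
    and \<xi> :: "'g \<Rightarrow> (nat \<Rightarrow> ('g \<Rightarrow>\<^sub>0 'k)) set"
  defines A_def: "A \<equiv> an_group_algebra \<Gamma> S" and \<xi>_def: "\<xi> \<equiv> universal_rep \<Gamma> S"
begin

sublocale A: frechet_alg A
  unfolding A_def by (rule frechet_an_group_algebra)

sublocale k: frechet_alg "ground :: ('k, 'k) seminormed_algebra"
  by (rule frechet_alg_ground)

sublocale AA: tensor_factors A A ..

sublocale kA: tensor_factors "ground :: ('k, 'k) seminormed_algebra" A ..

sublocale Ak: tensor_factors A "ground :: ('k, 'k) seminormed_algebra" ..

sublocale A_AA: tensor_factors A "projective_tensor A A" ..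

sublocale AA_A: tensor_factors "projective_tensor A A" A ..

lemma \<xi>_closed [simp, intro]: "\<gamma> \<in> carrier \<Gamma> \<Longrightarrow> \<xi> \<gamma> \<in> carrier A"
  by (simp add: A_def \<xi>_def universal_rep_closed)

lemma \<xi>_mult: "\<gamma> \<in> carrier \<Gamma> \<Longrightarrow> \<delta> \<in> carrier \<Gamma> \<Longrightarrow> \<xi> (\<gamma> \<otimes> \<delta>) = \<xi> \<gamma> \<otimes>\<^bsub>A\<^esub> \<xi> \<delta>"
  by (simp add: A_def \<xi>_def universal_rep_mult)

lemma \<xi>_one: "\<xi> \<one> = \<one>\<^bsub>A\<^esub>"
  by (simp add: A_def \<xi>_def universal_rep_one)

text \<open>Pure tensors multiply factor by factor, so \<xi> in both factors is again multiplicative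
  and unital.\<close>

lemma tensor_rep_hom: "tensor_rep A A \<xi> \<xi> \<in> hom \<Gamma> (units_of (projective_tensor A A))"
  by (rule hom_units_ofI[OF AA.PT.is_monoid])
    (simp_all add: tensor_rep_def \<xi>_mult \<xi>_one AA.pure_tensor_mult AA.pure_tensor_one)

lemma trivial_rep_hom: "trivial_rep \<in> hom \<Gamma> (units_of (ground :: ('k, 'k) seminormed_algebra))"
  by (rule hom_units_ofI[OF k.is_monoid]) (simp_all add: trivial_rep_def)

lemmas eq_on_A = eq_on_an_group_algebra[where 'k='k, folded A_def \<xi>_def]

lemmas corresponds_A = corresponds_bounded_linear[where 'k='k, folded A_def \<xi>_def]

lemmas norm_coeff_A = norm_coeff_le[where 'k='k, folded A_def]

lemmas linear_coeff_A = linear_coeff[where 'k='k, folded A_def]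

lemma coeff_\<xi>: "\<delta> \<in> carrier \<Gamma> \<Longrightarrow> coeff \<gamma> (\<xi> \<delta>) = (if \<delta> = \<gamma> then 1 else 0 :: 'k)"
  by (simp add: \<xi>_def coeff_universal_rep)

definition coeff_tensor :: "'g \<Rightarrow> 'g \<Rightarrow> _ \<Rightarrow> 'k" where
  "coeff_tensor \<gamma> \<delta> = tensor_lift A A ground (\<lambda>a b. coeff \<gamma> a * coeff \<delta> b)"

lemma coeff_closed_simps:
  "x \<in> carrier A \<Longrightarrow> y \<in> carrier A \<Longrightarrow> coeff \<gamma> (x \<oplus>\<^bsub>A\<^esub> y) = coeff \<gamma> x + (coeff \<gamma> y :: 'k)"
  "x \<in> carrier A \<Longrightarrow> coeff \<gamma> (c \<odot>\<^bsub>A\<^esub> x) = c * (coeff \<gamma> x :: 'k)"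
  using linear_coeff_A[of \<gamma>] by (auto simp: linear_map_def)

sublocale coeff_tensor: bounded_bilinear_into_frechet A A "ground :: ('k, 'k) seminormed_algebra"
    "\<lambda>a b. coeff \<gamma> a * coeff \<delta> b" for \<gamma> \<delta>
proof
  show "bilinear_map A A ground (\<lambda>a b. coeff \<gamma> a * (coeff \<delta> b :: 'k))"
    by (auto simp: bilinear_map_def linear_map_def coeff_closed_simps algebra_simps)
  \<comment> \<open>Every norm dominates every coefficient with constant 1, so index 0 serves for
    all \<open>n\<close>.\<close>
  have "bilinear_bound A A ground (\<lambda>a b. coeff \<gamma> a * (coeff \<delta> b :: 'k)) n 0 1" for n
    by (auto simp: bilinear_bound_def norm_mult intro!: mult_mono norm_coeff_A)
  then show "\<exists>m D. bilinear_bound A A ground (\<lambda>a b. coeff \<gamma> a * (coeff \<delta> b :: 'k)) n m D" for n by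
      blast
qed

section \<open>Bialgebra laws\<close>

context
  fixes \<mu> \<epsilon>
  assumes \<mu>: "corresponds \<Gamma> S (projective_tensor A A) (tensor_rep A A \<xi> \<xi>) \<mu>"
    and \<epsilon>: "corresponds \<Gamma> S (ground :: ('k, 'k) seminormed_algebra) trivial_rep \<epsilon>"
begin

lemma \<mu>_linear: "linear_map A (projective_tensor A A) \<mu>"
  and \<mu>_bounded: "bounded_map A (projective_tensor A A) \<mu>"
  and \<mu>_\<xi>: "\<gamma> \<in> carrier \<Gamma> \<Longrightarrow> \<mu> (\<xi> \<gamma>) = pure_tensor A A (\<xi> \<gamma>) (\<xi> \<gamma>)"
  using corresponds_A[OF AA.PT.frechet_alg_axioms \<mu>] by (simp_all add: tensor_rep_def)

lemma \<epsilon>_linear: "linear_map A ground \<epsilon>"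
  and \<epsilon>_bounded: "bounded_map A ground \<epsilon>"
  and \<epsilon>_\<xi>: "\<gamma> \<in> carrier \<Gamma> \<Longrightarrow> \<epsilon> (\<xi> \<gamma>) = 1"
  using corresponds_A[OF k.frechet_alg_axioms \<epsilon>] by (simp_all add: trivial_rep_def)

text \<open>On \<open>\<xi> \<gamma>\<close> both sides give the triple pure tensor of
  \<open>\<xi> \<gamma>\<close>, bracketed to the right.\<close>

lemma coassoc:
  assumes "a \<in> carrier A"
  shows "tensor_assoc A A A (tensor_map A A (projective_tensor A A) A \<mu> id (\<mu> a))
    = tensor_map A A A (projective_tensor A A) id \<mu> (\<mu> a)"
proof -
  note alg = A.seminormed_alg_axioms AA.PT.seminormed_alg_axioms
  note L = tensor_map_props[OF alg(1) alg(1) alg(2) alg(1) \<mu>_linear \<mu>_bounded linear_map_id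
      bounded_map_id]
  note R = tensor_map_props[OF alg(1) alg(1) alg(1) alg(2) linear_map_id bounded_map_id \<mu>_linear
      \<mu>_bounded]
  note T = tensor_assoc_props[OF alg(1) alg(1) alg(1)]
  note L' = linear_map_comp[OF \<mu>_linear L(1)] bounded_map_comp[OF \<mu>_linear \<mu>_bounded L(2)]
  show ?thesis
  proof (rule eq_on_A[OF A_AA.PT.frechet_alg_axioms linear_map_comp[OF L'(1) T(1)]
      bounded_map_comp[OF L' T(2)]
        linear_map_comp[OF \<mu>_linear R(1)] bounded_map_comp[OF \<mu>_linear \<mu>_bounded R(2)] _ assms])
    fix \<gamma> assume "\<gamma> \<in> carrier \<Gamma>"
    then show "tensor_assoc A A A (tensor_map A A (projective_tensor A A) A \<mu> id (\<mu> (\<xi> \<gamma>)))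
        = tensor_map A A A (projective_tensor A A) id \<mu> (\<mu> (\<xi> \<gamma>))"
      by (simp add: \<mu>_\<xi> L(3) R(3) T(3))
  qed
qed

text \<open>On \<open>\<xi> \<gamma>\<close> the left side is the pure tensor of
  \<open>\<epsilon> (\<xi> \<gamma>) = 1\<close> and \<open>\<xi> \<gamma>\<close>.\<close>

lemma counit_left:
  assumes "a \<in> carrier A"
  shows "tensor_map A A ground A \<epsilon> id (\<mu> a) = pure_tensor ground A 1 a"
proof -
  note alg = A.seminormed_alg_axioms k.seminormed_alg_axioms
  note L = tensor_map_props[OF alg(1) alg(1) alg(2) alg(1) \<epsilon>_linear \<epsilon>_bounded linear_map_id
      bounded_map_id]
  have R: "linear_map A (projective_tensor ground A) (pure_tensor ground A 1)"
    using kA.bilinear_pure_tensor by (simp add: bilinear_map_def)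
  \<comment> \<open>Index \<open>n\<close> and constant 1 suffice because the first factor has norm
    1.\<close>
  have R': "bounded_map A (projective_tensor ground A) (pure_tensor ground A (1::'k))"
    unfolding bounded_map_def
  proof
    fix n
    show "\<exists>m C. 0 \<le> C \<and> (\<forall>x\<in>carrier A. seminorm (projective_tensor ground A) n (pure_tensor ground A
        (1::'k) x) \<le> C * seminorm A m x)"
      using kA.seminorm_pure_tensor_le[of 1 _ n] by (intro exI[of _ n] exI[of _ 1]) simp
  qed
  show ?thesis
    by (rule eq_on_A[OF kA.PT.frechet_alg_axioms linear_map_comp[OF \<mu>_linear L(1)]
        bounded_map_comp[OF \<mu>_linear \<mu>_bounded L(2)] R R' _ assms])
      (simp add: \<mu>_\<xi> L(3) \<epsilon>_\<xi>)
qed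

lemma counit_right:
  assumes "a \<in> carrier A"
  shows "tensor_map A A A ground id \<epsilon> (\<mu> a) = pure_tensor A ground a 1"
proof -
  note alg = A.seminormed_alg_axioms k.seminormed_alg_axioms
  note L = tensor_map_props[OF alg(1) alg(1) alg(1) alg(2) linear_map_id bounded_map_id \<epsilon>_linear
      \<epsilon>_bounded]
  have R: "linear_map A (projective_tensor A ground) (\<lambda>a. pure_tensor A ground a 1)"
    using Ak.bilinear_pure_tensor by (simp add: bilinear_map_def)
  have R': "bounded_map A (projective_tensor A ground) (\<lambda>a. pure_tensor A ground a (1::'k))"
    unfolding bounded_map_def
  proof
    fix n
    show "\<exists>m C. 0 \<le> C \<and> (\<forall>x\<in>carrier A. seminorm (projective_tensor A ground) n (pure_tensor A ground
        x (1::'k)) \<le> C * seminorm A m x)"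
      using Ak.seminorm_pure_tensor_le[of _ 1 n] by (intro exI[of _ n] exI[of _ 1]) simp
  qed
  show ?thesis
    by (rule eq_on_A[OF Ak.PT.frechet_alg_axioms linear_map_comp[OF \<mu>_linear L(1)]
        bounded_map_comp[OF \<mu>_linear \<mu>_bounded L(2)] R R' _ assms])
      (simp add: \<mu>_\<xi> L(3) \<epsilon>_\<xi>)
qed

text \<open>That \<mu> and \<epsilon> are continuous algebra homomorphisms is part of
  \<open>corresponds\<close>, so only the three laws above have to be supplied.\<close>

theorem bialgebra: "mc_frechet_bialgebra A \<mu> \<epsilon>"
  unfolding mc_frechet_bialgebra_def
  using \<mu> \<epsilon> A.frechet_alg_axioms
  by (simp add: coassoc counit_left counit_right corresponds_def mc_frechet_algebra_iff_frechet_alg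
      flip: A_def)

section \<open>Grouplike elements\<close>

lemma coeff_tensor_\<mu>:
  assumes "a \<in> carrier A"
  shows "coeff_tensor \<gamma> \<delta> (\<mu> a) = (if \<gamma> = \<delta> then coeff \<gamma> a else 0)"
proof (rule eq_on_A[OF k.frechet_alg_axioms _ _ _ _ _ assms])
  show "linear_map A ground (\<lambda>a. coeff_tensor \<gamma> \<delta> (\<mu> a))"
    unfolding coeff_tensor_def
      by (rule linear_map_comp[OF \<mu>_linear coeff_tensor.tensor_lift_linear])
  show "bounded_map A ground (\<lambda>a. coeff_tensor \<gamma> \<delta> (\<mu> a))"
    unfolding coeff_tensor_def
      by (rule bounded_map_comp[OF \<mu>_linear \<mu>_bounded coeff_tensor.tensor_lift_bounded])
  show "linear_map A ground (\<lambda>a. if \<gamma> = \<delta> then coeff \<gamma> a else (0::'k))"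
    by (simp add: linear_map_def coeff_closed_simps)
  show "bounded_map A ground (\<lambda>a. if \<gamma> = \<delta> then coeff \<gamma> a else (0::'k))"
    unfolding bounded_map_def
    by (intro allI exI[of _ "0::nat"] exI[of _ "1::real"]) (auto intro: norm_coeff_A)
  \<comment> \<open>The left side is a product of two Kronecker deltas, non-zero only for
    \<open>\<gamma> = \<alpha> = \<delta>\<close>.\<close>
  show "coeff_tensor \<gamma> \<delta> (\<mu> (\<xi> \<alpha>)) = (if \<gamma> = \<delta> then coeff \<gamma> (\<xi> \<alpha>) else 0)" if "\<alpha> \<in> carrier \<Gamma>" for \<alpha>
    using that by (auto simp: \<mu>_\<xi> coeff_tensor_def coeff_tensor.tensor_lift_pure coeff_\<xi>)
qed

lemma grouplike_imp_\<xi>: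
  assumes a: "a \<in> carrier A" and \<mu>a: "\<mu> a = pure_tensor A A a a" and \<epsilon>a: "\<epsilon> a = 1"
  obtains \<gamma> where "\<gamma> \<in> carrier \<Gamma>" "a = \<xi> \<gamma>"
proof -
  have prod: "coeff \<gamma> a * coeff \<delta> a = (if \<gamma> = \<delta> then coeff \<gamma> a else 0)" for \<gamma> \<delta>
    using coeff_tensor_\<mu>[OF a, of \<gamma> \<delta>] a
      by (simp add: \<mu>a coeff_tensor_def coeff_tensor.tensor_lift_pure)
  have "\<exists>\<gamma>\<in>carrier \<Gamma>. coeff \<gamma> a \<noteq> 0"
  proof (rule ccontr)
    assume "\<not> ?thesis"
    then have "a = \<zero>\<^bsub>A\<^esub>" using eq_zero_if_coeff_zero a by (auto simp: A_def)
    then have "\<epsilon> a = 0" using linear_map_zero[OF A.seminormed_alg_axioms k.seminormed_alg_axioms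
        \<epsilon>_linear] by simp
    then show False using \<epsilon>a by simp
  qed
  then obtain \<gamma> where \<gamma>: "\<gamma> \<in> carrier \<Gamma>" "coeff \<gamma> a \<noteq> 0" by blast
  then have one: "coeff \<gamma> a = 1" using prod[of \<gamma> \<gamma>] by simp
  \<comment> \<open>The coefficients of \<open>a\<close> are those of \<open>\<xi> \<gamma>\<close>;
    separation of points is then applied to the difference.\<close>
  have "coeff \<delta> (a \<ominus>\<^bsub>A\<^esub> \<xi> \<gamma>) = 0" for \<delta>
  proof -
    have "coeff \<delta> a = (if \<delta> = \<gamma> then 1 else 0)" using prod[of \<gamma> \<delta>] one by auto
    moreover have "coeff \<delta> (\<xi> \<gamma>) = (if \<delta> = \<gamma> then 1 else 0 :: 'k)"
      using \<gamma>(1) by (auto simp: coeff_\<xi>)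
    ultimately show ?thesis
      using linear_map_minus[OF A.seminormed_alg_axioms k.seminormed_alg_axioms linear_coeff_A, of a
          "\<xi> \<gamma>" \<delta>] a \<gamma>(1)
      by simp
  qed
  then have "a \<ominus>\<^bsub>A\<^esub> \<xi> \<gamma> = \<zero>\<^bsub>A\<^esub>"
    using eq_zero_if_coeff_zero[of "a \<ominus>\<^bsub>A\<^esub> \<xi> \<gamma>"] a \<gamma>(1) by (simp add: A_def[symmetric])
  then have "a = \<xi> \<gamma>" by (rule A.eq_if_minus_eq_zero[OF a \<xi>_closed[OF \<gamma>(1)]])
  with \<gamma>(1) show ?thesis by (rule that)
qed

theorem grouplikes_iso: "\<xi> \<in> iso \<Gamma> (grouplikes A \<mu> \<epsilon>)"
proof (rule isoI)
  show "\<xi> \<in> hom \<Gamma> (grouplikes A \<mu> \<epsilon>)"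
    by (rule homI) (simp_all add: grouplikes_def \<mu>_\<xi> \<epsilon>_\<xi> \<xi>_mult)
  have "inj_on \<xi> (carrier \<Gamma>)"
  proof (rule inj_onI)
    fix \<gamma> \<delta> assume "\<gamma> \<in> carrier \<Gamma>" "\<delta> \<in> carrier \<Gamma>" "\<xi> \<gamma> = \<xi> \<delta>"
    \<comment> \<open>The coefficient at \<gamma> distinguishes \<open>\<xi> \<gamma>\<close> from
      \<open>\<xi> \<delta>\<close> since \<open>1 \<noteq> 0\<close> in the ground field.\<close>
    then have "(if \<delta> = \<gamma> then 1 else 0 :: 'k) = (if \<gamma> = \<gamma> then 1 else 0)"
      by (metis coeff_\<xi>)
    then show "\<gamma> = \<delta>" by (simp split: if_splits)
  qed
  moreover have "\<xi> ` carrier \<Gamma> = carrier (grouplikes A \<mu> \<epsilon>)"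
    by (auto simp: grouplikes_def \<mu>_\<xi> \<epsilon>_\<xi> elim: grouplike_imp_\<xi>)
  ultimately show "bij_betw \<xi> (carrier \<Gamma>) (carrier (grouplikes A \<mu> \<epsilon>))" by (simp add: bij_betw_def)
qed

text \<open>Inverses are transported from \<Gamma> along the isomorphism. The transported unit is
  \<open>\<xi> \<one>\<close>, which is the unit of \<open>A\<close>.\<close>

theorem grouplikes_group: "group (grouplikes A \<mu> \<epsilon>)"
  using iso_imp_img_group[OF grouplikes_iso] by (simp add: \<xi>_one grouplikes_def)

end

end

theorem lemma2p11:
  fixes \<Gamma> :: "('g, 'm) monoid_scheme"
    and S :: "'g set"
    and A :: "('k::{real_normed_field, banach}, (nat \<Rightarrow> ('g \<Rightarrow>\<^sub>0 'k)) set) seminormed_algebra"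
    and \<xi> :: "'g \<Rightarrow> (nat \<Rightarrow> ('g \<Rightarrow>\<^sub>0 'k)) set"
  assumes "group \<Gamma>"
    and "finite S" and "S \<subseteq> carrier \<Gamma>" and "generate \<Gamma> S = carrier \<Gamma>"
    and "A = an_group_algebra \<Gamma> S"
    and "\<xi> = universal_rep \<Gamma> S"
  shows "(\<exists>!\<mu>. corresponds \<Gamma> S (projective_tensor A A) (tensor_rep A A \<xi> \<xi>) \<mu>) \<and>
    (\<exists>!\<epsilon>. corresponds \<Gamma> S (ground :: ('k, 'k) seminormed_algebra) trivial_rep \<epsilon>) \<and>
    (\<forall>\<mu> \<epsilon>. corresponds \<Gamma> S (projective_tensor A A) (tensor_rep A A \<xi> \<xi>) \<mu> \<longrightarrow>
       corresponds \<Gamma> S (ground :: ('k, 'k) seminormed_algebra) trivial_rep \<epsilon> \<longrightarrow>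
       mc_frechet_bialgebra A \<mu> \<epsilon> \<and>
       group (grouplikes A \<mu> \<epsilon>) \<and>
       \<xi> \<in> iso \<Gamma> (grouplikes A \<mu> \<epsilon>))"
proof -
  \<comment> \<open>The locale introduces \<open>A\<close> and \<xi> by \<open>defines\<close>, so
    its interpretation asks for meta-equalities.\<close>
  have A: "A \<equiv> an_group_algebra \<Gamma> S" and \<xi>: "\<xi> \<equiv> universal_rep \<Gamma> S"
    by (rule eq_reflection, fact assms)+
  interpret an_bialgebra \<Gamma> S A \<xi>
    by (intro an_bialgebra.intro generated_group.intro generated_group_axioms.intro assms(1-4)) (fact A \<xi>)+
  have "\<exists>!\<mu>. corresponds \<Gamma> S (projective_tensor A A) (tensor_rep A A \<xi> \<xi>) \<mu>"
    using corresponds_exists[OF AA.PT.frechet_alg_axioms tensor_rep_hom] corresponds_unique[OF AA.PT.frechet_alg_axioms] by blast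
  moreover have "\<exists>!\<epsilon>. corresponds \<Gamma> S (ground :: ('k, 'k) seminormed_algebra) trivial_rep \<epsilon>"
    using corresponds_exists[OF k.frechet_alg_axioms trivial_rep_hom] corresponds_unique[OF k.frechet_alg_axioms] by blast
  ultimately show ?thesis using bialgebra grouplikes_group grouplikes_iso by simp
qed

end
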